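(* Let $a,b>0$ and let the parameters $\gamma^\pm>0$ depend on $N$ with $\gamma^+/N\to a$ and $\gamma^-/N\to b$ as $N\to\infty$. Let $k\ge1$, and let the integers $x_1,\dots,x_k$ and the positive integers $n_1,\dots,n_k$ depend on $N$ in such a way that $n_i-n_j$ and $x_i-x_j$ are constant, the points $(n_i,x_i)$ are pairwise distinct, $n_j/N\to1$ and $x_j/N\to c\in\mathbb{R}$ for all $1\le i,j\le k$. Let $q_1<\dots<q_m$ denote the distinct real roots of $Q_{a,b}$ ($m$ can be $2$, $3$ or $4$), and assume $Q_{a,b}(c)\ne0$. Let $z_+$ be a root of $R_{a,b,c}$ such that $\Im(z_+)\ge0$, chosen nonreal if $R_{a,b,c}$ has nonreal roots. If $m=4$, then as $N\to\infty$ $$\det[K(n_i,x_i;n_j,x_j)]_{1\le i,j\le k}\to\begin{cases}0,& c\le q_1,\\ \det[\mathrm{B}_{z_+}(n_i-n_j,x_j-x_i)]_{1\le i,j\le k},& q_1<c<q_2,\\ 1,& q_2\le c\le q_3,\\ \det[\mathrm{B}_{z_+}(n_i-n_j,x_j-x_i)]_{1\le i,j\le k},& q_3<c<q_4,\\ 0,& c\ge q_4.\end{cases}$$ If $m=2$ or $3$, then $$\det[K(n_i,x_i;n_j,x_j)]_{1\le i,j\le k}\to\begin{cases}0,& c\le q_1,\\ \det[\mathrm{B}_{z_+}(n_i-n_j,x_j-x_i)]_{1\le i,j\le k},& q_1<c<q_m,\\ 0,& c\ge q_m.\end{cases}$$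
   Context: For parameters $\gamma^\pm$, positive integers $n_1,n_2$ and integers $x_1,x_2$, the kernel $K$ (the correlation kernel of the determinantal point process on $\mathbb{Z}_+\times\mathbb{Z}$ attached to the Plancherel measures of $U(\infty)$ with parameters $\gamma^\pm$) is $$K(n_1,x_1;n_2,x_2)=-\mathbf{1}_{n_1<n_2}\frac{1}{2\pi i}\oint\frac{z^{x_1-x_2-1}}{(1-z)^{n_2-n_1}}dz+\left(\frac{1}{2\pi i}\right)^2\oint\oint \frac{e^{\gamma^-u+\gamma^+u^{-1}}u^{x_1}(1-u)^{n_1}}{e^{\gamma^-w+\gamma^+w^{-1}}w^{1+x_2}(1-w)^{n_2}}\frac{du\,dw}{u-w},$$ with $u$ over $|u|=r<1$, $w$ over $|w-1|=\epsilon<1-r$, $z$ over $|z|=r<1$ ($r,\epsilon>0$, counterclockwise). For $a,b>0$, $c\in\mathbb{R}$: $R_{a,b,c}(z)=-bz^3+(b-c-1)z^2+(c+a)z-a$, and $$Q_{a,b}(z)=p_0+p_1(z+\tfrac12)+p_2(z+\tfrac12)^2+p_3(z+\tfrac12)^3+16(z+\tfrac12)^4,$$ $p_0=1-12(a+b)+4(a^2+b^2)+184ab-256ab(a+b)+64ab(a-b)^2$, $p_1=8(b-a)(7-2a-2b+16ab)$, $p_2=8(2(a+b)^2-10(a+b)-1)$, $p_3=32(b-a)$. (When $c$ lies in a range where $\mathrm{B}_{z_+}$ appears above, $R_{a,b,c}$ has a pair of nonreal complex conjugate roots.) The incomplete beta kernel is, for $z$ in the upper half-plane and $k,l\in\mathbb{Z}$,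 $$\mathrm{B}_z(k,l)=\frac{1}{2\pi i}\int_{\bar z}^z(1-u)^ku^{-l-1}du,$$ where the path of integration crosses $(0,1)$ for $k\ge0$ and $(-\infty,0)$ for $k<0$ (and crosses the real axis only there). *)

theory Defs
  imports "HOL-Complex_Analysis.Complex_Analysis"
begin

definition kernel_weight :: "real \<Rightarrow> real \<Rightarrow> complex \<Rightarrow> complex" where
  "kernel_weight gp gm u = exp (of_real gm * u + of_real gp * inverse u)"

text \<open>The correlation kernel, with \<open>gp = \<gamma>\<^sup>+\<close> and \<open>gm = \<gamma>\<^sup>-\<close>. The radii \<open>r\<close>, \<open>\<epsilon>\<close> of the
  contours are explicit arguments; they are meant to satisfy \<open>0 < r\<close>, \<open>0 < \<epsilon> < 1 - r\<close>. Under these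
  conditions the two circles of the double integral are disjoint, so that its integrand is
  continuous and the double integral can be written as an iterated one.\<close>

definition plancherel_kernel ::
  "real \<Rightarrow> real \<Rightarrow> real \<Rightarrow> real \<Rightarrow> nat \<Rightarrow> int \<Rightarrow> nat \<Rightarrow> int \<Rightarrow> complex" where
  "plancherel_kernel r \<epsilon> gp gm n\<^sub>1 x\<^sub>1 n\<^sub>2 x\<^sub>2 =
     - (if n\<^sub>1 < n\<^sub>2
        then 1 / (2 * of_real pi * \<i>) *
             contour_integral (circlepath 0 r)
               (\<lambda>z. z powi (x\<^sub>1 - x\<^sub>2 - 1) / (1 - z) ^ (n\<^sub>2 - n\<^sub>1))
        else 0)
     + (1 / (2 * of_real pi * \<i>))\<^sup>2 *
       contour_integral (circlepath 0 r) (\<lambda>u.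
         contour_integral (circlepath 1 \<epsilon>) (\<lambda>w.
           (kernel_weight gp gm u * u powi x\<^sub>1 * (1 - u) ^ n\<^sub>1) /
           (kernel_weight gp gm w * w powi (1 + x\<^sub>2) * (1 - w) ^ n\<^sub>2) *
           (1 / (u - w))))"

definition R_poly :: "real \<Rightarrow> real \<Rightarrow> real \<Rightarrow> complex \<Rightarrow> complex" where
  "R_poly a b c z =
     - of_real b * z ^ 3 + of_real (b - c - 1) * z\<^sup>2 + of_real (c + a) * z - of_real a"

definition Q_poly :: "real \<Rightarrow> real \<Rightarrow> real \<Rightarrow> real" where
  "Q_poly a b z =
     (let p\<^sub>0 = 1 - 12 * (a + b) + 4 * (a\<^sup>2 + b\<^sup>2) + 184 * a * b - 256 * a * b * (a + b)
               + 64 * a * b * (a - b)\<^sup>2;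
          p\<^sub>1 = 8 * (b - a) * (7 - 2 * a - 2 * b + 16 * a * b);
          p\<^sub>2 = 8 * (2 * (a + b)\<^sup>2 - 10 * (a + b) - 1);
          p\<^sub>3 = 32 * (b - a)
      in p\<^sub>0 + p\<^sub>1 * (z + 1/2) + p\<^sub>2 * (z + 1/2)\<^sup>2 + p\<^sub>3 * (z + 1/2) ^ 3 + 16 * (z + 1/2) ^ 4)"

definition beta_crossing :: "int \<Rightarrow> real set" where
  "beta_crossing k = (if k \<ge> 0 then {0<..<1} else {..<0})"

definition beta_path :: "int \<Rightarrow> complex \<Rightarrow> (real \<Rightarrow> complex) \<Rightarrow> bool" where
  "beta_path k z g \<longleftrightarrow> valid_path g \<and> pathstart g = cnj z \<and> pathfinish g = z \<and>
     path_image g \<inter> \<real> \<subseteq> of_real ` beta_crossing k"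

text \<open>The choice of the path is immaterial, see \<open>incomplete_beta_eq\<close> below.\<close>

definition incomplete_beta :: "complex \<Rightarrow> int \<Rightarrow> int \<Rightarrow> complex" where
  "incomplete_beta z k l =
     1 / (2 * of_real pi * \<i>) *
     contour_integral (SOME g. beta_path k z g) (\<lambda>u. (1 - u) powi k * u powi (- l - 1))"

lemma beta_path_exists:
  assumes "Im z > 0"
  shows "\<exists>g. beta_path k z g"
proof -
  define p :: real where "p = (if k \<ge> 0 then 1/2 else -1)"
  define g where "g = linepath (cnj z) (of_real p) +++ linepath (of_real p) z"
  have p: "p \<in> beta_crossing k"
    by (auto simp: p_def beta_crossing_def)
  have *: "w = of_real p"
    if w: "w \<in> closed_segment v (of_real p)" "w \<in> \<real>" and v: "Im v \<noteq> 0" for v w :: complex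
  proof -
    from w(1) obtain t where t: "w = (1 - t) *\<^sub>R v + t *\<^sub>R of_real p"
      by (auto simp: closed_segment_def)
    with w(2) have "(1 - t) * Im v = 0"
      by (auto simp: complex_is_Real_iff)
    with v have "t = 1" by simp
    with t show ?thesis by simp
  qed
  have "path_image g \<inter> \<real> \<subseteq> {of_real p}"
    using *[of _ "cnj z"] *[of _ z] assms
    by (auto simp: g_def path_image_join closed_segment_commute)
  with p have "beta_path k z g"
    by (auto simp: beta_path_def g_def)
  thus ?thesis by blast
qed

lemma incomplete_beta_eq:
  assumes z: "Im z > 0" and g: "beta_path k z g"
  shows "incomplete_beta z k l =
           1 / (2 * of_real pi * \<i>) * contour_integral g (\<lambda>u. (1 - u) powi k * u powi (- l - 1))"
proof -
  define f where "f = (\<lambda>u::complex. (1 - u) powi k * u powi (- l - 1))"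
  define I where "I = beta_crossing k"
  define S where "S = {u. Im u \<noteq> 0} \<union> {u. Re u \<in> I}"
  define p :: real where "p = (if k \<ge> 0 then 1/2 else -1)"
  have pI: "p \<in> I" and I: "open I" "convex I"
    by (auto simp: p_def I_def beta_crossing_def)
  have "open S"
  proof -
    have "open (Re -` I)"
      by (intro open_vimage I continuous_intros)
    moreover have "open {u. Im u \<noteq> 0}"
      by (intro open_Collect_neq continuous_intros)
    ultimately show ?thesis
      by (auto simp: S_def vimage_def)
  qed
  have "starlike S"
    unfolding starlike_def
  proof (intro bexI ballI subsetI)
    fix x w assume x: "x \<in> S" and w: "w \<in> closed_segment (of_real p) x"
    then obtain t where t: "0 \<le> t" "t \<le> 1" "w = (1 - t) *\<^sub>R of_real p + t *\<^sub>R x"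
      by (auto simp: closed_segment_def)
    show "w \<in> S"
    proof (cases "Im w = 0")
      case True
      with t have "t = 0 \<or> Im x = 0" by auto
      hence "t = 0 \<or> Re x \<in> I" using x by (auto simp: S_def)
      moreover have "Re w = (1 - t) *\<^sub>R p + t *\<^sub>R Re x" using t by simp
      ultimately have "Re w \<in> I"
        using pI t convexD_alt[OF I(2) pI, of "Re x" t] by auto
      thus ?thesis by (simp add: S_def)
    qed (simp add: S_def)
  qed (use pI in \<open>simp add: S_def\<close>)
  have nz: "u \<noteq> 0" "1 - u \<noteq> 0 \<or> k \<ge> 0" if "u \<in> S" for u
    using that by (auto simp: S_def I_def beta_crossing_def split: if_splits)
  have hol: "f holomorphic_on S"
    unfolding f_def using nz by (auto intro!: holomorphic_intros)
  obtain F where F: "\<And>u. u \<in> S \<Longrightarrow> (F has_field_derivative f u) (at u)"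
    using holomorphic_starlike_primitive[OF holomorphic_on_imp_continuous_on[OF hol]
            \<open>starlike S\<close> \<open>open S\<close> finite.emptyI] hol \<open>open S\<close>
    by (auto simp: holomorphic_on_open field_differentiable_def)
  have eq: "contour_integral h f = F z - F (cnj z)" if h: "beta_path k z h" for h
  proof -
    have "path_image h \<subseteq> S"
    proof
      fix u assume u: "u \<in> path_image h"
      show "u \<in> S"
      proof (cases "u \<in> \<real>")
        case True
        with u h show ?thesis by (auto simp: beta_path_def S_def I_def)
      qed (auto simp: S_def complex_is_Real_iff)
    qed
    hence "(f has_contour_integral (F (pathfinish h) - F (pathstart h))) h"
      using h F by (intro contour_integral_primitive[of S])
        (auto simp: beta_path_def intro: has_field_derivative_at_within)
    with h show ?thesis
      by (auto simp: beta_path_def dest: contour_integral_unique)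
  qed
  have "beta_path k z (SOME h. beta_path k z h)"
    using beta_path_exists[OF z] by (rule someI_ex)
  from eq[OF this] eq[OF g] show ?thesis
    by (simp add: incomplete_beta_def f_def)
qed

end

theory Submission
  imports Defs "HOL-Computational_Algebra.Fundamental_Theorem_Algebra"
begin

text \<open>Deform both contours of the double integral. With \<open>S(u) = b u + a / u + c log u + log (1 - u)\<close>,
  the integrand is governed by \<open>|exp S(u)|\<close> on the \<open>u\<close>-contour and by \<open>1 / |exp S(w)|\<close> on the
  \<open>w\<close>-contour, and \<open>R\<^bsub>a,b,c\<^esub>\<close> is, up to a factor, \<open>S'\<close>. The \<open>u\<close>-contour is a circle about \<open>0\<close> through a
  critical point at which \<open>|exp S|\<close> is maximal on that circle. By the maximum principle every circle
  of another radius (in a suitable range) contains a point with a larger value of \<open>|exp S|\<close>; since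
  on a circle \<open>|exp S|\<close> is unimodal in \<open>Re u\<close>, the upper half of its superlevel set is connected, so
  there is a \<open>w\<close>-contour inside it that meets the \<open>u\<close>-circle only at critical points. The remaining
  double integral vanishes in the limit, and moving the contours collects the residue at \<open>w = u\<close>,
  whose integral over an arc is the incomplete beta kernel.

  If \<open>R\<^bsub>a,b,c\<^esub>\<close> has nonreal roots, the arc joins \<open>cnj z\<^sub>+\<close> to \<open>z\<^sub>+\<close>. If all roots are real (and distinct,
  as \<open>Q\<^bsub>a,b\<^esub>(c) \<noteq> 0\<close>), the arc is empty or the full circle, and the limit matrix is triangular once the
  points are ordered by \<open>n\<^sub>i\<close>. The position of the real roots is found from the graph of the function
  \<open>u \<mapsto> a / u - b u + u / (1 - u)\<close>, whose level set at \<open>c\<close> is the root set.\<close>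

section \<open>The discriminant and the phases\<close>

text \<open>The deformation is never carried out on the double integral. For fixed \<open>u\<close>
  the residue theorem turns the \<open>w\<close>-integral into one function \<open>H\<close>, and
  the kernel becomes a circle integral of \<open>\<phi> - F * H\<close>, without
  \<open>\<phi>\<close> if \<open>n1 < n2\<close>. The single integral of the kernel thus removes
  \<open>\<phi>\<close> exactly when it has a pole at 1, so the radius is free, also beyond 1, and a
  \<open>w\<close>-contour only serves to estimate \<open>F * H\<close> or
  \<open>F * H - \<phi>\<close> pointwise in \<open>u\<close>. The parameters converge without a
  rate, so that \<open>n\<close>-th powers of the limiting modulus and of the modulus at stage
  \<open>N\<close> are not comparable. With real critical points a strict gap between the levels on
  the two contours absorbs this. With nonreal ones the contours meet and there is no gap; the circle
  is then drawn through the critical point at stage \<open>N\<close>, whose level cancels exactly.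
  In place of Laplace asymptotics, the \<open>w\<close>-integral is bounded by an inverse square
  root of the distance from \<open>u\<close> to the nearer critical point, and the Gaussian decay of
  \<open>F\<close> along the circle is traded for a small negative power of \<open>n\<close>, such
  that the remaining singularity is integrable.\<close>

lemma R_poly_factor:
  assumes "b \<noteq> 0"
  obtains z1 z2 z3 :: complex where
    "\<And>z. R_poly a b c z = - of_real b * ((z - z1) * (z - z2) * (z - z3))"
    "of_real (b - c - 1) = of_real b * (z1 + z2 + z3)"
    "of_real (c + a) = - of_real b * (z1 * z2 + z1 * z3 + z2 * z3)"
    "of_real a = - of_real b * (z1 * z2 * z3)"
proof -
  let ?A = "of_real a :: complex" and ?B = "of_real b :: complex"
  let ?C = "of_real (b - c - 1) :: complex" and ?D = "of_real (c + a) :: complex"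
  have B: "?B \<noteq> 0" using assms by simp
  have "\<exists>z. poly [:- ?A, ?D, ?C, - ?B:] z = 0"
    using B by (intro alg_closed_imp_poly_has_root) auto
  then obtain z1 where z1: "- ?A + z1 * (?D + z1 * (?C - z1 * ?B)) = 0" by auto
  \<comment> \<open>The quotient of the cubic by \<open>z - z1\<close>.\<close>
  have "\<exists>z. poly [:?D + z1 * ?C - z1^2 * ?B, ?C - z1 * ?B, - ?B:] z = 0"
    using B by (intro alg_closed_imp_poly_has_root) auto
  then obtain z2 where z2: "?D + z1 * ?C - z1^2 * ?B + z2 * (?C - z1 * ?B - z2 * ?B) = 0"
    by (auto simp: algebra_simps)
  define z3 where "z3 = ?C / ?B - z1 - z2"
  have C: "?C = ?B * (z1 + z2 + z3)" using B by (simp add: z3_def)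
  have D: "?D = - ?B * (z1 * z2 + z1 * z3 + z2 * z3)"
    using z2 unfolding C by (simp add: algebra_simps power2_eq_square eq_neg_iff_add_eq_0)
  have A: "?A = - ?B * (z1 * z2 * z3)"
  proof -
    have "- ?A = ?B * (z1 * z2 * z3)"
      using z1 unfolding C D by (simp add: algebra_simps power2_eq_square)
    thus ?thesis by (metis minus_minus mult_minus_left)
  qed
  have R: "R_poly a b c z = - ?B * ((z - z1) * (z - z2) * (z - z3))" for z
    unfolding R_poly_def C D A by (simp add: algebra_simps power2_eq_square power3_eq_cube)
  show ?thesis by (rule that[OF R C D A])
qed

text \<open>\<open>Q\<close> is 16 times the discriminant of the cubic \<open>R_poly a b c\<close>;
  the powers of \<open>z + 1/2\<close> only arrange it by \<open>c\<close>.\<close>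

lemma Q_poly_disc:
  "Q_poly a b c = 16 * ((b-c-1)^2*(c+a)^2 + 4*b*(c+a)^3 + 4*(b-c-1)^3*a - 27*b^2*a^2
     + 18*b*(b-c-1)*(c+a)*a)"
  unfolding Q_poly_def Let_def
  by (simp add: field_simps power2_eq_square power3_eq_cube power4_eq_xxxx)

text \<open>The discriminant of \<open>- B * t ^ 3 + b1 * t ^ 2 + b2 * t - b3\<close> in terms of
  its roots. The ring is left open because real and complex roots both occur.\<close>

lemma cubic_disc:
  fixes x y z B :: "'a::comm_ring_1"
  assumes "b1 = B*(x+y+z)" "b2 = -B*(x*y+x*z+y*z)" "b3 = -B*(x*y*z)"
  shows "b1^2*b2^2 + 4*B*b2^3 + 4*b1^3*b3 - 27*B^2*b3^2 + 18*B*b1*b2*b3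
           = B^4 * ((x-y)*(x-z)*(y-z))^2"
  unfolding assms by (simp add: algebra_simps power2_eq_square power3_eq_cube power4_eq_xxxx)

lemma R_poly_cnj: "R_poly a b c (cnj z) = cnj (R_poly a b c z)"
  by (simp add: R_poly_def)

lemma Q_poly_roots:
  assumes "of_real (b - c - 1) = of_real b * (z1 + z2 + z3 :: complex)"
    "of_real (c + a) = - of_real b * (z1 * z2 + z1 * z3 + z2 * z3)"
    "of_real a = - of_real b * (z1 * z2 * z3)"
  shows "of_real (Q_poly a b c) = 16 * of_real b ^ 4 * ((z1 - z2) * (z1 - z3) * (z2 - z3))^2"
proof -
  have "of_real (Q_poly a b c) = 16 * (of_real (b - c - 1)^2 * of_real (c + a)^2
      + 4 * of_real b * of_real (c + a)^3 + 4 * of_real (b - c - 1)^3 * of_real a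
      - 27 * of_real b^2 * of_real a^2 + 18 * of_real b * of_real (b - c - 1) * of_real (c + a) * of_real a :: complex)"
    unfolding Q_poly_disc by simp
  also have "\<dots> = 16 * (of_real b ^ 4 * ((z1 - z2) * (z1 - z3) * (z2 - z3))^2)"
    using cubic_disc[OF assms] by simp
  finally show ?thesis by simp
qed

text \<open>With three real roots the discriminant is a nonnegative multiple of a square.\<close>

lemma Q_poly_neg_imp_nonreal:
  assumes "Q_poly a b c < 0" "b \<noteq> 0"
  shows "\<exists>z. R_poly a b c z = 0 \<and> z \<notin> \<real>"
proof (rule ccontr)
  assume no: "\<not> ?thesis"
  obtain z1 z2 z3 where z: "\<And>z. R_poly a b c z = - of_real b * ((z - z1) * (z - z2) * (z - z3))"
    "of_real (b - c - 1) = of_real b * (z1 + z2 + z3)"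
    "of_real (c + a) = - of_real b * (z1 * z2 + z1 * z3 + z2 * z3)"
    "of_real a = - of_real b * (z1 * z2 * z3)"
    using R_poly_factor[OF \<open>b \<noteq> 0\<close>] by blast
  have "z1 \<in> \<real>" "z2 \<in> \<real>" "z3 \<in> \<real>" using no z(1)[of z1] z(1)[of z2] z(1)[of z3] by auto
  then obtain x1 x2 x3 where x: "z1 = of_real x1" "z2 = of_real x2" "z3 = of_real x3"
    by (auto elim!: Reals_cases)
  have "of_real (Q_poly a b c) = (of_real (16 * b^4 * ((x1-x2)*(x1-x3)*(x2-x3))^2) :: complex)"
    using Q_poly_roots[OF z(2-4)] by (simp add: x)
  hence "Q_poly a b c = 16 * b^4 * ((x1-x2)*(x1-x3)*(x2-x3))^2"
    using of_real_eq_iff by blast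
  moreover have "0 \<le> 16 * b^4 * ((x1-x2)*(x1-x3)*(x2-x3))^2" by simp
  ultimately show False using assms by linarith
qed

text \<open>If one root \<open>w\<close> is nonreal, the others are \<open>cnj w\<close> and a real
  \<open>s\<close>, and the product of the differences is purely imaginary, which makes
  \<open>Q\<close> nonpositive. So all roots are real, and they are distinct because the
  discriminant does not vanish.\<close>

lemma Q_poly_pos_imp_real:
  assumes "Q_poly a b c > 0" "b \<noteq> 0"
  obtains x1 x2 x3 :: real where "x1 < x2" "x2 < x3"
    "\<And>z. R_poly a b c z = - of_real b * ((z - of_real x1) * (z - of_real x2) * (z - of_real x3))"
    "b - c - 1 = b * (x1 + x2 + x3)" "c + a = - b * (x1 * x2 + x1 * x3 + x2 * x3)"
    "a = - b * (x1 * x2 * x3)"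
proof -
  note finish = that
  obtain z1 z2 z3 where z: "\<And>z. R_poly a b c z = - of_real b * ((z - z1) * (z - z2) * (z - z3))"
    "of_real (b - c - 1) = of_real b * (z1 + z2 + z3)"
    "of_real (c + a) = - of_real b * (z1 * z2 + z1 * z3 + z2 * z3)"
    "of_real a = - of_real b * (z1 * z2 * z3)"
    using R_poly_factor[OF \<open>b \<noteq> 0\<close>] by blast
  note Q = Q_poly_roots[OF z(2-4)]
  have key: False if "w \<notin> \<real>" and R: "\<And>z. R_poly a b c z = - of_real b * ((z - w) * (z - v) * (z - t))"
    and Q: "of_real (Q_poly a b c) = 16 * of_real b ^ 4 * ((w - v) * (w - t) * (v - t))^2" for w v t
  proof -
    have wc: "w \<noteq> cnj w" using that(1) by (metis Reals_cnj_iff)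
    have "R_poly a b c (cnj w) = 0" using R[of w] by (simp add: R_poly_cnj)
    hence "cnj w = v \<or> cnj w = t" using R[of "cnj w"] wc \<open>b \<noteq> 0\<close> by auto
    then obtain s where s: "\<And>z. R_poly a b c z = - of_real b * ((z - w) * (z - cnj w) * (z - s))"
      "of_real (Q_poly a b c) = 16 * of_real b ^ 4 * ((w - cnj w) * (w - s) * (cnj w - s))^2"
    proof (elim disjE)
      assume v: "cnj w = v"
      show ?thesis by (rule that[of t]) (use R Q v in auto)
    next
      assume v: "cnj w = t"
      show ?thesis
      proof (rule that[of v])
        show "R_poly a b c z = - of_real b * ((z - w) * (z - cnj w) * (z - v))" for z
          unfolding R v by (simp add: mult_ac)
        show "of_real (Q_poly a b c) = 16 * of_real b ^ 4 * ((w - cnj w) * (w - v) * (cnj w - v))^2"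
          unfolding Q v by (simp add: power2_eq_square algebra_simps)
      qed
    qed
    have "R_poly a b c (cnj s) = 0" using s(1)[of s] by (simp add: R_poly_cnj)
    hence "cnj s = s \<or> cnj s = w \<or> cnj s = cnj w" using s(1)[of "cnj s"] \<open>b \<noteq> 0\<close> by auto
    moreover have "s \<noteq> w" "s \<noteq> cnj w" using s(2) assms by auto
    ultimately have sr: "cnj s = s" by (metis complex_cnj_cancel_iff complex_cnj_cnj)
    have "(w - s) * (cnj w - s) = of_real ((cmod (w - s))^2)"
      using complex_norm_square[of "w - s"] sr by simp
    moreover have "w - cnj w = of_real (2 * Im w) * \<i>" by (simp add: complex_diff_cnj)
    ultimately have "((w - cnj w) * (w - s) * (cnj w - s))^2
        = (of_real (2 * Im w) * \<i> * of_real ((cmod (w - s))^2))^2"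
      by (metis mult.assoc)
    also have "\<dots> = of_real (- (((2 * Im w) * (cmod (w - s))\<^sup>2)\<^sup>2))"
      by (simp add: power_mult_distrib)
    finally have "of_real (Q_poly a b c) = (of_real (16 * b ^ 4 * (- (((2 * Im w) * (cmod (w - s))\<^sup>2)\<^sup>2))) :: complex)"
      using s(2) by simp
    hence "Q_poly a b c = - (16 * b ^ 4 * (((2 * Im w) * (cmod (w - s))\<^sup>2)\<^sup>2))"
      using of_real_eq_iff by (metis mult_minus_right)
    moreover have "0 \<le> 16 * b ^ 4 * (((2 * Im w) * (cmod (w - s))\<^sup>2)\<^sup>2)" by simp
    ultimately show False using assms by linarith
  qed
  have "z1 \<in> \<real>" using key[of z1 z2 z3] z(1) Q by blast
  moreover have "z2 \<in> \<real>"
  proof (rule ccontr)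
    assume "z2 \<notin> \<real>"
    thus False using key[of z2 z1 z3] z(1) Q by (simp add: power2_eq_square mult_ac algebra_simps)
  qed
  moreover have "z3 \<in> \<real>"
  proof (rule ccontr)
    assume "z3 \<notin> \<real>"
    thus False using key[of z3 z1 z2] z(1) Q by (simp add: power2_eq_square mult_ac algebra_simps)
  qed
  ultimately obtain y1 y2 y3 where y: "z1 = of_real y1" "z2 = of_real y2" "z3 = of_real y3"
    by (auto elim!: Reals_cases)
  have dist: "y1 \<noteq> y2" "y1 \<noteq> y3" "y2 \<noteq> y3" using Q assms by (auto simp: y)
  have co: "b - c - 1 = b * (y1 + y2 + y3)" "c + a = - b * (y1 * y2 + y1 * y3 + y2 * y3)"
    "a = - b * (y1 * y2 * y3)"
    using z(2-4) unfolding y of_real_mult[symmetric] of_real_add[symmetric] of_real_minus[symmetric] of_real_eq_iff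
    by auto
  have R: "R_poly a b c z = - of_real b * ((z - of_real y1) * (z - of_real y2) * (z - of_real y3))" for z
    using z(1) y by simp
  \<comment> \<open>The relations are symmetric in the roots, so sorting them loses nothing.\<close>
  have perm: thesis if "v1 < v2" "v2 < v3" "v1 + v2 + v3 = y1 + y2 + y3"
    "v1 * v2 + v1 * v3 + v2 * v3 = y1 * y2 + y1 * y3 + y2 * y3" "v1 * v2 * v3 = y1 * y2 * y3"
    "\<And>z::complex. (z - of_real v1) * (z - of_real v2) * (z - of_real v3)
       = (z - of_real y1) * (z - of_real y2) * (z - of_real y3)" for v1 v2 v3
    
    using that(1,2)
    by (rule finish[of v1 v2 v3]) (simp_all only: that R co[symmetric])
  consider "y1 < y2" "y2 < y3" | "y1 < y3" "y3 < y2" | "y2 < y1" "y1 < y3" | "y2 < y3" "y3 < y1"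
    | "y3 < y1" "y1 < y2" | "y3 < y2" "y2 < y1" using dist by linarith
  thus ?thesis
    by cases (rule perm, assumption+, (assumption | simp add: mult_ac add_ac)+)+
qed

section \<open>Real roots and the graph of \<open>crit_value\<close>\<close>

definition real_cubic :: "real \<Rightarrow> real \<Rightarrow> real \<Rightarrow> real \<Rightarrow> real" where
  "real_cubic a b c u = - b * u ^ 3 + (b - c - 1) * u\<^sup>2 + (c + a) * u - a"

text \<open>The value of \<open>c\<close> for which \<open>u\<close> is a root of \<open>R_poly a b c\<close>.\<close>

definition crit_value :: "real \<Rightarrow> real \<Rightarrow> real \<Rightarrow> real" where
  "crit_value a b u = a / u - b * u + u / (1 - u)"

text \<open>The cubic is affine in \<open>c\<close> with coefficient \<open>u * (1 - u)\<close>, so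
  away from 0 and 1 each \<open>u\<close> is a root for exactly one \<open>c\<close>.\<close>

lemma real_cubic_crit_value:
  assumes "u \<noteq> 0" "u \<noteq> 1"
  shows "real_cubic a b c u = u * (1 - u) * (c - crit_value a b u)"
  using assms unfolding real_cubic_def crit_value_def
  by (simp add: divide_simps) (simp add: algebra_simps power2_eq_square power3_eq_cube)

lemma crit_value_deriv:
  assumes "u \<noteq> 0" "u \<noteq> 1"
  shows "(crit_value a b has_real_derivative (- a / u\<^sup>2 - b + 1 / (1 - u)\<^sup>2)) (at u)"
proof -
  have "((\<lambda>u. a / u - b * u + u / (1 - u)) has_real_derivative
      (0 * u - a * 1) / (u * u) - b + (1 * (1 - u) - u * (0 - 1)) / ((1 - u) * (1 - u))) (at u)"
    using assms by (auto intro!: derivative_eq_intros)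
  thus ?thesis by (simp add: crit_value_def[abs_def] power2_eq_square)
qed

lemma continuous_on_crit_value:
  assumes "0 \<notin> S" "1 \<notin> S"
  shows "continuous_on S (crit_value a b)"
  unfolding crit_value_def using assms by (auto intro!: continuous_intros)

text \<open>Vieta's relations instead of a set of roots: they keep multiplicities, so that double
  roots, which belong to the critical points of \<open>crit_value\<close>, can be expressed.\<close>

definition vieta3 :: "real \<Rightarrow> real \<Rightarrow> real \<Rightarrow> real \<Rightarrow> real \<Rightarrow> real \<Rightarrow> bool" where
  "vieta3 a b c x1 x2 x3 \<longleftrightarrow> b - c - 1 = b * (x1 + x2 + x3) \<and>
     c + a = - b * (x1 * x2 + x1 * x3 + x2 * x3) \<and> a = - b * (x1 * x2 * x3)"

lemma vieta3_cubic:
  assumes "vieta3 a b c x1 x2 x3"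
  shows "real_cubic a b c u = - b * ((u - x1) * (u - x2) * (u - x3))"
proof -
  have B: "b - c - 1 = b * (x1 + x2 + x3)" and C: "c + a = - b * (x1 * x2 + x1 * x3 + x2 * x3)"
    and D: "a = - b * (x1 * x2 * x3)" using assms by (auto simp: vieta3_def)
  have "real_cubic a b c u = - b * u ^ 3 + b * (x1 + x2 + x3) * u\<^sup>2
     - b * (x1 * x2 + x1 * x3 + x2 * x3) * u + b * (x1 * x2 * x3)"
    unfolding real_cubic_def B C using D by simp
  thus ?thesis by (simp add: algebra_simps power2_eq_square power3_eq_cube)
qed

lemma vieta3_Q:
  assumes "vieta3 a b c x1 x2 x3"
  shows "Q_poly a b c = 16 * b ^ 4 * ((x1 - x2) * (x1 - x3) * (x2 - x3))\<^sup>2"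
  using cubic_disc[of "b-c-1" b x1 x2 x3 "c+a" a] assms unfolding vieta3_def Q_poly_disc
  by (simp add: algebra_simps)

lemma vieta3_at_1: "vieta3 a b c x1 x2 x3 \<Longrightarrow> b * ((1 - x1) * (1 - x2) * (1 - x3)) = 1"
  using vieta3_cubic[of a b c x1 x2 x3 1] by (simp add: real_cubic_def)

text \<open>At a root \<open>u\<close>, the derivative of
  \<open>u * (1 - u) * (c - crit_value a b u)\<close> is \<open>- u * (1 - u)\<close> times that of
  \<open>crit_value\<close>; a critical point is therefore a double root. The third root
  \<open>v\<close> comes from the sum of the roots.\<close>

lemma vieta3_double:
  assumes "u \<noteq> 0" "u \<noteq> 1" "b \<noteq> 0" "- a / u\<^sup>2 - b + 1 / (1 - u)\<^sup>2 = 0"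
  shows "\<exists>v. vieta3 a b (crit_value a b u) u u v"
proof -
  define c where "c = crit_value a b u"
  define v where "v = (b - c - 1) / b - 2 * u"
  have B: "b - c - 1 = b * (2 * u + v)" using assms by (simp add: v_def)
  have r0: "- b * u ^ 3 + (b - c - 1) * u\<^sup>2 + (c + a) * u - a = 0"
    using real_cubic_crit_value[OF assms(1,2), of a b c] by (simp add: real_cubic_def c_def)
  have "(a + b * u\<^sup>2) * (1 - u)\<^sup>2 = u\<^sup>2"
    using assms by (simp add: divide_simps split: if_splits) (simp add: algebra_simps)
  hence a: "a = u\<^sup>2 / (1-u)\<^sup>2 - b * u\<^sup>2" using assms by (simp add: field_simps)
  have c: "c = u / (1-u)\<^sup>2 - 2 * b * u + u / (1 - u)"
  proof -
    have "(u\<^sup>2 / (1-u)\<^sup>2 - b * u\<^sup>2) / u = u / (1-u)\<^sup>2 - b * u"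
      using assms(1) by (simp add: diff_divide_distrib power2_eq_square)
    thus ?thesis unfolding c_def crit_value_def by (subst a) simp
  qed
  have r1: "- 3 * b * u\<^sup>2 + 2 * (b - c - 1) * u + (c + a) = 0"
    unfolding c a using assms
    by (simp add: divide_simps) (simp add: algebra_simps power2_eq_square power3_eq_cube)
  have C: "c + a = - b * (u * u + 2 * (u * v))"
    using r1 unfolding B by (simp add: algebra_simps power2_eq_square)
  have "a = - b * (u * u * v)"
    using r0 unfolding B C by (simp add: algebra_simps power2_eq_square power3_eq_cube)
  hence "vieta3 a b c u u v" using B C unfolding vieta3_def by (simp add: algebra_simps)
  thus ?thesis unfolding c_def by blast
qed

text \<open>The sum of the roots dictates \<open>v\<close>; the divided difference of the cubic at
  \<open>x\<close> and \<open>y\<close> gives the second relation and the equation at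
  \<open>x\<close> the third.\<close>

lemma vieta3_of_roots:
  assumes "b \<noteq> 0" "x \<noteq> y" "real_cubic a b c x = 0" "real_cubic a b c y = 0"
  shows "\<exists>v. vieta3 a b c v x y"
proof -
  define v where "v = (b - c - 1) / b - x - y"
  have B: "b - c - 1 = b * (v + x + y)" using assms by (simp add: v_def)
  have "(x - y) * (c + a + b * (v * x + v * y + x * y)) = real_cubic a b c x - real_cubic a b c y"
    unfolding real_cubic_def B by (simp add: algebra_simps power2_eq_square power3_eq_cube)
  hence C: "c + a = - b * (v * x + v * y + x * y)" using assms by simp
  have "a = - b * (v * x * y)"
    using assms(3) unfolding real_cubic_def B C
    by (simp add: algebra_simps power2_eq_square power3_eq_cube)
  thus ?thesis using B C unfolding vieta3_def by blast
qed

lemma Q_poly_pos_vieta3: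
  assumes "Q_poly a b c > 0" "b \<noteq> 0"
  obtains x1 x2 x3 where "x1 < x2" "x2 < x3" "vieta3 a b c x1 x2 x3"
  using Q_poly_pos_imp_real[OF assms] unfolding vieta3_def by metis

text \<open>The signs at 0 and 1 decide: \<open>x1 * x2 * x3 = - a / b\<close> is negative and
  \<open>(1 - x1) * (1 - x2) * (1 - x3) = 1 / b\<close> is positive.\<close>

lemma vieta3_trichotomy:
  assumes "vieta3 a b c x1 x2 x3" "a > 0" "b > 0" "x1 < x2" "x2 < x3"
  shows "x1 < 0 \<and> (0 < x2 \<and> x3 < 1 \<or> 1 < x2 \<or> x3 < 0)"
proof -
  have p: "b * (x1 * x2 * x3) < 0" using assms by (simp add: vieta3_def)
  hence p: "x1 * x2 * x3 < 0" using assms by (simp add: mult_less_0_iff)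
  have "b * ((1 - x1) * (1 - x2) * (1 - x3)) > 0" using vieta3_at_1[OF assms(1)] by simp
  hence q: "(1 - x1) * (1 - x2) * (1 - x3) > 0" using assms by (simp add: zero_less_mult_iff)
  show ?thesis using p q assms(4,5)
    by (auto simp: mult_less_0_iff zero_less_mult_iff)
qed

text \<open>\<open>crit_value\<close> tends to infinity at both ends of \<open>(0,1)\<close>, so the
  infimum is attained on a compact subinterval.\<close>

lemma crit_value_min:
  assumes "a > 0" "b > 0"
  shows "\<exists>u0. 0 < u0 \<and> u0 < 1 \<and> (\<forall>u. 0 < u \<longrightarrow> u < 1 \<longrightarrow> crit_value a b u0 \<le> crit_value a b u)"
proof -
  define M where "M = crit_value a b (1/2)"
  \<comment> \<open>Within \<open>e\<close> of 0 the term \<open>a / u\<close>, within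
    \<open>e\<close> of 1 the term \<open>u / (1 - u)\<close> is at least
    \<open>\<bar>M\<bar> + b\<close>, which outweighs \<open>- b * u\<close>.\<close>
  define e where "e = min (1/2) (min (a / (\<bar>M\<bar> + b + 1)) (1 / (2 * (\<bar>M\<bar> + b + 1))))"
  have e: "0 < e" using assms by (auto simp: e_def)
  have e2: "e \<le> 1/2" unfolding e_def by (rule min.cobounded1)
  note e = e e2
  have out: "crit_value a b u \<ge> M" if "0 < u" "u < 1" and u: "u < e \<or> u > 1 - e" for u
  proof -
    have bu: "b * u \<le> b" using that assms by (simp add: mult_le_cancel_left1)
    consider "u < e" | "u > 1 - e" using u by blast
    thus ?thesis
    proof cases
      case 1
      hence "u < a / (\<bar>M\<bar> + b + 1)" by (simp add: e_def)
      hence "\<bar>M\<bar> + b + 1 < a / u" using assms that by (simp add: field_simps)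
      moreover have "u / (1 - u) \<ge> 0" using that by simp
      ultimately show ?thesis using bu unfolding crit_value_def by linarith
    next
      case 2
      hence "1 - u < 1 / (2 * (\<bar>M\<bar> + b + 1))" by (simp add: e_def)
      hence *: "(1 - u) * (2 * (\<bar>M\<bar> + b + 1)) < 1" using assms by (simp add: field_simps)
      have "u \<ge> 1/2" using 2 e by linarith
      hence "(1 - u) * (\<bar>M\<bar> + b + 1) \<le> u" using * by linarith
      hence "\<bar>M\<bar> + b + 1 \<le> u / (1 - u)" using that by (simp add: field_simps)
      moreover have "a / u \<ge> 0" using that assms by simp
      ultimately show ?thesis using bu unfolding crit_value_def by linarith
    qed
  qed
  have "\<exists>u0\<in>{e..1-e}. \<forall>u\<in>{e..1-e}. crit_value a b u0 \<le> crit_value a b u"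
    using e by (intro continuous_attains_inf continuous_on_crit_value) auto
  then obtain u0 where u0: "u0 \<in> {e..1-e}" "\<And>u. u \<in> {e..1-e} \<Longrightarrow> crit_value a b u0 \<le> crit_value a b u"
    by blast
  have "crit_value a b u0 \<le> M" using u0(2)[of "1/2"] e by (simp add: M_def)
  thus ?thesis using u0 out e
    by (intro exI[of _ u0]) (force simp: not_less)
qed

text \<open>To the right of 1, \<open>crit_value\<close> tends to minus infinity both at 1, through
  \<open>u / (1 - u)\<close>, and at infinity, through \<open>- b * u\<close>.\<close>

lemma crit_value_max:
  assumes "a > 0" "b > 0"
  shows "\<exists>u0>1. \<forall>u>1. crit_value a b u \<le> crit_value a b u0"
proof -
  define M where "M = crit_value a b 2"
  define e where "e = min (1/2) (1 / (\<bar>M\<bar> + a + 1))"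
  define T where "T = max 2 ((\<bar>M\<bar> + a + 1) / b)"
  have e: "0 < e" using assms by (auto simp: e_def)
  have e2: "e \<le> 1/2" unfolding e_def by (rule min.cobounded1)
  note e = e e2
  have out: "crit_value a b u \<le> M" if "1 < u" and u: "u < 1 + e \<or> u > T" for u
  proof -
    have au: "a / u \<le> a" using that assms by (simp add: divide_le_eq mult_le_cancel_left1)
    consider "u < 1 + e" | "u > T" using u by blast
    thus ?thesis
    proof cases
      case 1
      hence "u - 1 < 1 / (\<bar>M\<bar> + a + 1)" by (simp add: e_def)
      hence *: "(u - 1) * (\<bar>M\<bar> + a + 1) < 1" using assms by (simp add: field_simps)
      hence "\<bar>M\<bar> + a + 1 \<le> u / (u - 1)" using that assms by (simp add: field_simps)
      moreover have "u / (u - 1) = - (u / (1 - u))" using minus_divide_right[of u "1 - u"] by simp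
      moreover have "b * u \<ge> 0" using that assms by simp
      ultimately show ?thesis using au unfolding crit_value_def by linarith
    next
      case 2
      hence "(\<bar>M\<bar> + a + 1) / b < u" by (simp add: T_def)
      hence "\<bar>M\<bar> + a + 1 < b * u" using assms by (simp add: field_simps)
      moreover have "u / (1 - u) \<le> 0" using that by (simp add: divide_nonneg_neg)
      ultimately show ?thesis using au unfolding crit_value_def by linarith
    qed
  qed
  have "\<exists>u0\<in>{1+e..T}. \<forall>u\<in>{1+e..T}. crit_value a b u \<le> crit_value a b u0"
    using e by (intro continuous_attains_sup continuous_on_crit_value) (auto simp: T_def)
  then obtain u0 where u0: "u0 \<in> {1+e..T}" "\<And>u. u \<in> {1+e..T} \<Longrightarrow> crit_value a b u \<le> crit_value a b u0"
    by blast
  have "M \<le> crit_value a b u0" using u0(2)[of 2] e by (simp add: M_def T_def)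
  thus ?thesis using u0 out e
    by (intro exI[of _ u0]) (force simp: not_less)
qed

lemma local_min_crit_value:
  assumes "u \<noteq> 0" "u \<noteq> 1" "e > 0" "\<And>y. \<bar>u - y\<bar> < e \<Longrightarrow> crit_value a b u \<le> crit_value a b y" "b \<noteq> 0"
  shows "\<exists>v. vieta3 a b (crit_value a b u) u u v"
  using DERIV_local_min[OF crit_value_deriv[OF assms(1,2)] assms(3)] assms vieta3_double by blast

lemma local_max_crit_value:
  assumes "u \<noteq> 0" "u \<noteq> 1" "e > 0" "\<And>y. \<bar>u - y\<bar> < e \<Longrightarrow> crit_value a b y \<le> crit_value a b u" "b \<noteq> 0"
  shows "\<exists>v. vieta3 a b (crit_value a b u) u u v"
  using DERIV_local_max[OF crit_value_deriv[OF assms(1,2)] assms(3)] assms vieta3_double by blast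

lemma continuous_on_real_cubic: "continuous_on S (real_cubic a b c)"
  unfolding real_cubic_def[abs_def] by (intro continuous_intros)

text \<open>The cubic is negative at 0 and 1 and positive at \<open>u0\<close>, which gives two
  roots in \<open>(0,1)\<close>; the third is negative because the product of the roots is.\<close>

lemma type_A_exists:
  assumes ab: "a > 0" "b > 0" and u0: "0 < u0" "u0 < 1" "c > crit_value a b u0"
  shows "\<exists>x1 x2 x3. vieta3 a b c x1 x2 x3 \<and> x1 < 0 \<and> 0 < x2 \<and> x2 < x3 \<and> x3 < 1"
proof -
  have p: "real_cubic a b c u0 > 0" using u0 by (simp add: real_cubic_crit_value)
  have 0: "real_cubic a b c 0 < 0" and 1: "real_cubic a b c 1 < 0" using ab by (auto simp: real_cubic_def)
  obtain y where y: "0 \<le> y" "y \<le> u0" "real_cubic a b c y = 0"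
    using IVT'[of "real_cubic a b c" 0 0 u0] p 0 u0 continuous_on_real_cubic by force
  obtain z where z: "u0 \<le> z" "z \<le> 1" "real_cubic a b c z = 0"
    using IVT2'[of "real_cubic a b c" 1 0 u0] p 1 u0 continuous_on_real_cubic by force
  have "y < u0" "u0 < z" "0 < y" "z < 1" using y z 0 1 p
    by (metis less_eq_real_def less_irrefl)+
  moreover obtain x where x: "vieta3 a b c x y z"
    using vieta3_of_roots[of b y z a c] y z ab \<open>y < u0\<close> \<open>u0 < z\<close> by auto
  moreover have "x < 0"
  proof -
    have "b * (x * y * z) < 0" using x ab by (simp add: vieta3_def)
    thus ?thesis using ab calculation by (simp add: mult_less_0_iff)
  qed
  ultimately show ?thesis by (intro exI[of _ x] exI[of _ y] exI[of _ z]) auto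
qed

text \<open>Sign changes between 1, \<open>u0\<close> and a large point give two roots beyond 1; the
  product of the roots makes the third negative.\<close>

lemma type_B_exists:
  assumes ab: "a > 0" "b > 0" and u0: "1 < u0" "c < crit_value a b u0"
  shows "\<exists>x1 x2 x3. vieta3 a b c x1 x2 x3 \<and> x1 < 0 \<and> 1 < x2 \<and> x2 < x3"
proof -
  have p: "real_cubic a b c u0 > 0" using u0 by (simp add: real_cubic_crit_value mult_neg_neg mult_pos_neg)
  have 1: "real_cubic a b c 1 < 0" using ab by (auto simp: real_cubic_def)
  \<comment> \<open>Large enough for \<open>b * T ^ 3\<close> to outweigh the terms of degree 2 and
    1.\<close>
  define T where "T = max u0 (1 + (\<bar>b - c - 1\<bar> + \<bar>c + a\<bar>) / b)"
  have T1: "T \<ge> 1" using u0 by (simp add: T_def)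
  have "b * T \<ge> \<bar>b - c - 1\<bar> + \<bar>c + a\<bar>"
  proof -
    have "T \<ge> (\<bar>b - c - 1\<bar> + \<bar>c + a\<bar>) / b" by (simp add: T_def)
    thus ?thesis using ab by (simp add: field_simps)
  qed
  hence "(b * T) * T\<^sup>2 \<ge> (\<bar>b - c - 1\<bar> + \<bar>c + a\<bar>) * T\<^sup>2" by (intro mult_right_mono) auto
  moreover have "(b - c - 1) * T\<^sup>2 \<le> \<bar>b - c - 1\<bar> * T\<^sup>2" by (intro mult_right_mono) auto
  moreover have "(c + a) * T \<le> \<bar>c + a\<bar> * T\<^sup>2"
    using T1 by (intro mult_mono) (auto simp: power2_eq_square)
  ultimately have 2: "real_cubic a b c T < 0" using ab
    by (simp add: real_cubic_def algebra_simps power2_eq_square power3_eq_cube)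
  obtain y where y: "1 \<le> y" "y \<le> u0" "real_cubic a b c y = 0"
    using IVT'[of "real_cubic a b c" 1 0 u0] p 1 u0 continuous_on_real_cubic by force
  obtain z where z: "u0 \<le> z" "z \<le> T" "real_cubic a b c z = 0"
    using IVT2'[of "real_cubic a b c" T 0 u0] p 2 u0 continuous_on_real_cubic by (force simp: T_def)
  have "y < u0" "u0 < z" "1 < y" using y z 1 2 p
    by (metis less_eq_real_def less_irrefl)+
  moreover obtain x where x: "vieta3 a b c x y z"
    using vieta3_of_roots[of b y z a c] y z ab \<open>y < u0\<close> \<open>u0 < z\<close> by auto
  moreover have "x < 0"
  proof -
    have "b * (x * y * z) < 0" using x ab by (simp add: vieta3_def)
    thus ?thesis using ab calculation by (simp add: mult_less_0_iff)
  qed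
  ultimately show ?thesis by (intro exI[of _ x] exI[of _ y] exI[of _ z]) auto
qed

lemma double_root_negative:
  assumes "vieta3 a b c u u v" "a > 0" "b > 0" "u \<noteq> 0" shows "v < 0"
proof -
  have "b * (u * u * v) < 0" using assms by (simp add: vieta3_def)
  moreover have "u * u > 0" using assms by (metis not_real_square_gt_zero)
  ultimately show ?thesis using assms by (simp add: mult_less_0_iff)
qed

lemma vieta3_Q_pos:
  assumes "vieta3 a b c x1 x2 x3" "x1 < x2" "x2 < x3" "b > 0"
  shows "Q_poly a b c > 0"
  unfolding vieta3_Q[OF assms(1)] using assms by simp

text \<open>The real roots of \<open>Q\<close> are the critical values of \<open>crit_value\<close>; \<open>\<alpha>\<close> and \<open>\<beta>\<close> are those
  attained in \<open>(0,1)\<close> and \<open>(1,\<infinity>)\<close>.\<close>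

lemma Q_poly_extreme_roots:
  assumes ab: "a > 0" "b > 0"
  obtains \<alpha> \<beta> where "\<beta> < \<alpha>" "Q_poly a b \<alpha> = 0" "Q_poly a b \<beta> = 0"
    "\<And>t. Q_poly a b t = 0 \<Longrightarrow> \<beta> \<le> t \<and> t \<le> \<alpha>"
    "\<And>c. c > \<alpha> \<Longrightarrow> \<exists>x1 x2 x3. vieta3 a b c x1 x2 x3 \<and> x1 < 0 \<and> 0 < x2 \<and> x2 < x3 \<and> x3 < 1"
    "\<And>c. c < \<beta> \<Longrightarrow> \<exists>x1 x2 x3. vieta3 a b c x1 x2 x3 \<and> x1 < 0 \<and> 1 < x2 \<and> x2 < x3"
    "\<And>c x1 x2 x3. vieta3 a b c x1 x2 x3 \<Longrightarrow> x1 < x2 \<Longrightarrow> x2 < x3 \<Longrightarrow> \<beta> < c \<Longrightarrow> c < \<alpha> \<Longrightarrow>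
       x3 < 0 \<and> (\<exists>\<mu> \<nu>. Q_poly a b \<mu> = 0 \<and> Q_poly a b \<nu> = 0 \<and> \<beta> < \<mu> \<and> \<mu> < c \<and> c < \<nu> \<and> \<nu> < \<alpha>)"
proof -
  note finish = that
  obtain u0 where u0: "0 < u0" "u0 < 1" "\<And>u. 0 < u \<Longrightarrow> u < 1 \<Longrightarrow> crit_value a b u0 \<le> crit_value a b u"
    using crit_value_min[OF ab] by blast
  obtain v0 where v0: "1 < v0" "\<And>u. 1 < u \<Longrightarrow> crit_value a b u \<le> crit_value a b v0"
    using crit_value_max[OF ab] by blast
  define \<alpha> where "\<alpha> = crit_value a b u0"
  define \<beta> where "\<beta> = crit_value a b v0"
  obtain u1 where u1: "vieta3 a b \<alpha> u0 u0 u1"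
    unfolding \<alpha>_def using local_min_crit_value[of u0 "min u0 (1 - u0)"] u0 ab by (force simp: abs_if split: if_splits)
  obtain v1 where v1: "vieta3 a b \<beta> v0 v0 v1"
    unfolding \<beta>_def using local_max_crit_value[of v0 "v0 - 1" a b] v0 ab by (force simp: abs_if split: if_splits)
  have u1n: "u1 < 0" and v1n: "v1 < 0" using double_root_negative u1 v1 ab u0 v0 by (metis less_irrefl not_one_less_zero)+
  have Q: "Q_poly a b \<alpha> = 0" "Q_poly a b \<beta> = 0" using vieta3_Q[OF u1] vieta3_Q[OF v1] by auto
  have A: "\<exists>x1 x2 x3. vieta3 a b c x1 x2 x3 \<and> x1 < 0 \<and> 0 < x2 \<and> x2 < x3 \<and> x3 < 1" if "c > \<alpha>" for c
    using type_A_exists[OF ab u0(1,2)] that by (simp add: \<alpha>_def)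
  have B: "\<exists>x1 x2 x3. vieta3 a b c x1 x2 x3 \<and> x1 < 0 \<and> 1 < x2 \<and> x2 < x3" if "c < \<beta>" for c
    using type_B_exists[OF ab v0(1)] that by (simp add: \<beta>_def)
  \<comment> \<open>At \<open>c = \<alpha>\<close> the roots \<open>u0\<close>, \<open>u0\<close>,
    \<open>u1\<close> are below 1, so the cubic is negative at \<open>v0\<close>; with
    \<open>\<alpha> \<le> \<beta>\<close> the formula through \<open>crit_value\<close> would make
    it nonnegative there.\<close>
  have lt: "\<beta> < \<alpha>"
  proof (rule ccontr)
    assume "\<not> \<beta> < \<alpha>"
    hence "real_cubic a b \<alpha> v0 \<ge> 0" using v0
      by (simp add: real_cubic_crit_value \<beta>_def[symmetric] mult_nonpos_nonpos mult_le_0_iff)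
    moreover have "real_cubic a b \<alpha> v0 < 0"
      using vieta3_cubic[OF u1, of v0] u0 v0 u1n ab by (simp add: zero_less_mult_iff)
    ultimately show False by linarith
  qed
  have ends: "\<beta> \<le> t \<and> t \<le> \<alpha>" if "Q_poly a b t = 0" for t
    using A[of t] B[of t] vieta3_Q_pos[of a b t] that ab by (metis less_irrefl less_trans not_less zero_less_one)
  show ?thesis
  proof (rule finish[of \<beta> \<alpha>])
    fix c x1 x2 x3
    assume v: "vieta3 a b c x1 x2 x3" "x1 < x2" "x2 < x3" and c: "\<beta> < c" "c < \<alpha>"
    have root: "crit_value a b x = c" if "x \<in> {x1,x2,x3}" "x \<noteq> 0" "x \<noteq> 1" for x
      using vieta3_cubic[OF v(1), of x] real_cubic_crit_value[of x a b c] that by auto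
    \<comment> \<open>A root in \<open>(0,1)\<close> would force \<open>c \<ge> \<alpha>\<close> and
      a root beyond 1 would force \<open>c \<le> \<beta>\<close>, by the extremal choice of
      \<open>u0\<close> and \<open>v0\<close>.\<close>
    have x3: "x3 < 0"
    proof (rule ccontr)
      assume "\<not> x3 < 0"
      hence "0 < x2 \<and> x3 < 1 \<or> 1 < x2" using vieta3_trichotomy[OF v(1) ab v(2,3)] by auto
      thus False
        using u0(3)[of x2] v0(2)[of x2] root[of x2] c v unfolding \<alpha>_def \<beta>_def by force
    qed
    have sgn: "crit_value a b u < c \<longleftrightarrow> (u - x1) * (u - x2) * (u - x3) > 0"
      "c < crit_value a b u \<longleftrightarrow> (u - x1) * (u - x2) * (u - x3) < 0" if "u < 0" for u
    proof -
      define P where "P = (u - x1) * (u - x2) * (u - x3)"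
      have e: "b * P = (- u * (1 - u)) * (c - crit_value a b u)"
        using vieta3_cubic[OF v(1), of u] real_cubic_crit_value[of u a b c] that
        by (simp add: P_def algebra_simps)
      have k: "- u * (1 - u) > 0" using that by (simp add: mult_neg_pos)
      show "crit_value a b u < c \<longleftrightarrow> P > 0"
        using e k ab zero_less_mult_iff[of b P] zero_less_mult_iff[of "- u * (1 - u)" "c - crit_value a b u"]
        by auto
      show "c < crit_value a b u \<longleftrightarrow> P < 0"
        using e k ab mult_less_0_iff[of b P] mult_less_0_iff[of "- u * (1 - u)" "c - crit_value a b u"]
        by auto
    qed
    \<comment> \<open>Between the roots \<open>crit_value\<close> dips below \<open>c\<close> on
      \<open>[x1,x2]\<close> and rises above \<open>c\<close> on \<open>[x2,x3]\<close>. The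
      interior extrema are critical points, and their values are the roots \<open>\<mu>\<close> and
      \<open>\<nu>\<close> of \<open>Q\<close>.\<close>
    obtain m where m: "m \<in> {x1..x2}" "\<And>u. u \<in> {x1..x2} \<Longrightarrow> crit_value a b m \<le> crit_value a b u"
      using continuous_attains_inf[of "{x1..x2}" "crit_value a b"] v x3
        continuous_on_crit_value[of "{x1..x2}" a b] by force
    have mid: "crit_value a b ((x1+x2)/2) < c"
      using v x3 by (subst sgn) (auto simp: zero_less_mult_iff mult_less_0_iff)
    have mc: "crit_value a b m < c" using m(2)[of "(x1+x2)/2"] v mid by auto
    hence "m \<noteq> x1" "m \<noteq> x2" using root[of x1] root[of x2] v x3 by auto
    hence m': "x1 < m" "m < x2" using m by auto
    obtain w where w: "vieta3 a b (crit_value a b m) m m w"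
      using local_min_crit_value[of m "min (m - x1) (x2 - m)" a b] m m' x3 v ab
      by (force simp: abs_if split: if_splits)
    have wn: "w < 0" using double_root_negative[OF w ab] m' v x3 by auto
    obtain k where k: "k \<in> {x2..x3}" "\<And>u. u \<in> {x2..x3} \<Longrightarrow> crit_value a b u \<le> crit_value a b k"
      using continuous_attains_sup[of "{x2..x3}" "crit_value a b"] v x3
        continuous_on_crit_value[of "{x2..x3}" a b] by force
    have mid: "c < crit_value a b ((x2+x3)/2)"
      using v x3 by (subst sgn) (auto simp: zero_less_mult_iff mult_less_0_iff)
    have kc: "c < crit_value a b k" using k(2)[of "(x2+x3)/2"] v mid by auto
    hence "k \<noteq> x2" "k \<noteq> x3" using root[of x2] root[of x3] v x3 by auto
    hence k': "x2 < k" "k < x3" using k by auto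
    obtain s where s: "vieta3 a b (crit_value a b k) k k s"
      using local_max_crit_value[of k "min (k - x2) (x3 - k)" a b] k k' x3 v ab
      by (force simp: abs_if split: if_splits)
    have sn: "s < 0" using double_root_negative[OF s ab] k' v x3 by auto
    have Qm: "Q_poly a b (crit_value a b m) = 0" "Q_poly a b (crit_value a b k) = 0"
      using vieta3_Q[OF w] vieta3_Q[OF s] by auto
    \<comment> \<open>Equality would put \<open>v0 > 1\<close> among the roots \<open>m\<close>,
      \<open>m\<close>, \<open>w\<close>, which are all negative.\<close>
    have "crit_value a b m \<noteq> \<beta>"
    proof
      assume "crit_value a b m = \<beta>"
      hence "real_cubic a b (crit_value a b m) v0 = 0"
        using vieta3_cubic[OF v1, of v0] by simp
      thus False using vieta3_cubic[OF w, of v0] wn m' v x3 v0 ab by auto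
    qed
    moreover have "crit_value a b k \<noteq> \<alpha>"
    proof
      assume "crit_value a b k = \<alpha>"
      hence "real_cubic a b (crit_value a b k) u0 = 0"
        using vieta3_cubic[OF u1, of u0] by simp
      thus False using vieta3_cubic[OF s, of u0] sn k' v x3 u0 ab by auto
    qed
    ultimately show "x3 < 0 \<and> (\<exists>\<mu> \<nu>. Q_poly a b \<mu> = 0 \<and> Q_poly a b \<nu> = 0 \<and> \<beta> < \<mu> \<and> \<mu> < c \<and> c < \<nu> \<and> \<nu> < \<alpha>)"
      using x3 Qm ends[OF Qm(1)] ends[OF Qm(2)] mc kc by fastforce
  qed (use lt Q ends A B in auto)
qed

section \<open>The quartic \<open>Q\<close> and the order of its roots\<close>

lemma Q_poly_eq_poly:
  obtains p where "degree p = 4" "coeff p 4 = 16" "\<And>t. Q_poly a b t = poly p (t + 1/2)"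
proof -
  define p0 p1 p2 where "p0 = 1 - 12 * (a + b) + 4 * (a\<^sup>2 + b\<^sup>2) + 184 * a * b - 256 * a * b * (a + b)
               + 64 * a * b * (a - b)\<^sup>2" and "p1 = 8 * (b - a) * (7 - 2 * a - 2 * b + 16 * a * b)"
    and "p2 = 8 * (2 * (a + b)\<^sup>2 - 10 * (a + b) - 1)"
  show ?thesis
  proof (rule that[of "[:p0, p1, p2, 32 * (b - a), 16:]"])
    show "coeff [:p0, p1, p2, 32 * (b - a), 16:] 4 = 16" by (simp add: numeral_eq_Suc)
    show "Q_poly a b t = poly [:p0, p1, p2, 32 * (b - a), 16:] (t + 1/2)" for t
      unfolding Q_poly_def Let_def p0_def[symmetric] p1_def[symmetric] p2_def[symmetric]
      by (simp only: poly_pCons poly_0 power2_eq_square power3_eq_cube power4_eq_xxxx) (simp add: field_simps power2_eq_square power3_eq_cube power4_eq_xxxx)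
  qed simp
qed

lemma card_Q_roots: "card {t. Q_poly a b t = 0} \<le> 4"
proof -
  obtain p where p: "degree p = 4" "coeff p 4 = 16" "\<And>t. Q_poly a b t = poly p (t + 1/2)"
    using Q_poly_eq_poly by blast
  have "p \<noteq> 0" using p by auto
  have im: "{t. Q_poly a b t = 0} = (\<lambda>s. s - 1/2) ` {s. poly p s = 0}"
    by (auto simp: p image_iff intro!: exI[of _ "_ + 1/2"])
  have fin: "finite {s. poly p s = 0}" using \<open>p \<noteq> 0\<close> poly_roots_finite by blast
  have "card {s. poly p s = 0} \<le> 4" using card_poly_roots_bound[OF \<open>p \<noteq> 0\<close>] p by simp
  thus "card {t. Q_poly a b t = 0} \<le> 4" unfolding im using card_image_le[OF fin] order_trans by blast
qed

text \<open>Both sides are quartics with leading coefficient 16, so their difference has degree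
  below 4 and yet four roots.\<close>

lemma Q_poly_four_roots:
  assumes "t1 < t2" "t2 < t3" "t3 < t4" "Q_poly a b t1 = 0" "Q_poly a b t2 = 0" "Q_poly a b t3 = 0" "Q_poly a b t4 = 0"
  shows "Q_poly a b t = 16 * ((t - t1) * (t - t2) * (t - t3) * (t - t4))"
proof -
  obtain p where p: "degree p = 4" "coeff p 4 = 16" "\<And>t. Q_poly a b t = poly p (t + 1/2)"
    using Q_poly_eq_poly by blast
  define r where "r = [:- (t1 + 1/2), 1:] * [:- (t2 + 1/2), 1:] * [:- (t3 + 1/2), 1:] * [:- (t4 + 1/2), 1:]"
  have r: "degree r = 4" "lead_coeff r = 1" unfolding r_def
    by (simp add: degree_mult_eq) (simp add: lead_coeff_mult)
  have rp: "poly r s = (s - (t1 + 1/2)) * (s - (t2 + 1/2)) * (s - (t3 + 1/2)) * (s - (t4 + 1/2))" for s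
  proof -
    have "poly [:- (t + 1/2), 1:] s = s - (t + 1/2)" for t by simp
    thus ?thesis unfolding r_def poly_mult by presburger
  qed
  have "p = smult 16 r"
  proof (rule ccontr)
    assume ne: "p \<noteq> smult 16 r"
    define d where "d = p - smult 16 r"
    have d0: "d \<noteq> 0" using ne by (simp add: d_def)
    have "degree d \<le> 4" unfolding d_def using p r by (intro degree_diff_le) auto
    moreover have "coeff d 4 = 0" using p r by (simp add: d_def)
    ultimately have "degree d < 4" using d0 by (metis leading_coeff_0_iff order_le_imp_less_or_eq)
    moreover have "card {t1 + 1/2, t2 + 1/2, t3 + 1/2, t4 + 1/2} \<le> card {s. poly d s = 0}"
    proof (rule card_mono)
      show "finite {s. poly d s = 0}" using poly_roots_finite[OF d0] .
      have "poly p (t1 + 1/2) = 0" "poly p (t2 + 1/2) = 0" "poly p (t3 + 1/2) = 0" "poly p (t4 + 1/2) = 0"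
        using assms(4-7) unfolding p(3) .
      thus "{t1 + 1/2, t2 + 1/2, t3 + 1/2, t4 + 1/2} \<subseteq> {s. poly d s = 0}"
        by (simp add: d_def rp)
    qed
    moreover have "card {t1 + 1/2, t2 + 1/2, t3 + 1/2, t4 + 1/2} = 4" using assms by simp
    ultimately show False using card_poly_roots_bound[OF d0] by simp
  qed
  thus ?thesis using p(3)[of t] by (simp add: rp)
qed

text \<open>\<open>q 1\<close> and \<open>q m\<close> are the extreme values \<beta> and \<alpha>.
  If \<open>c\<close> lies strictly between them and the cubic has three distinct real roots, two
  further roots of \<open>Q\<close> enclose \<open>c\<close>, which forces \<open>m = 4\<close> and
  \<open>q 2 < c < q 3\<close>; in that interval \<open>Q\<close> is indeed positive, by its
  factorization.\<close>

lemma phase_cases: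
  fixes m :: nat and q :: "nat \<Rightarrow> real"
  assumes ab: "a > 0" "b > 0"
    and q: "strict_mono_on {1..m} q" "q ` {1..m} = {t. Q_poly a b t = 0}"
  shows "m \<in> {2,3,4}"
    and "\<And>c. c < q 1 \<Longrightarrow> \<exists>x1 x2 x3. vieta3 a b c x1 x2 x3 \<and> x1 < 0 \<and> 1 < x2 \<and> x2 < x3"
    and "\<And>c. c > q m \<Longrightarrow> \<exists>x1 x2 x3. vieta3 a b c x1 x2 x3 \<and> x1 < 0 \<and> 0 < x2 \<and> x2 < x3 \<and> x3 < 1"
    and "\<And>c. m = 4 \<Longrightarrow> q 2 < c \<Longrightarrow> c < q 3 \<Longrightarrow> \<exists>x1 x2 x3. vieta3 a b c x1 x2 x3 \<and> x1 < x2 \<and> x2 < x3 \<and> x3 < 0"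
    and "\<And>c. q 1 < c \<Longrightarrow> c < q m \<Longrightarrow> Q_poly a b c \<noteq> 0 \<Longrightarrow> \<not> (m = 4 \<and> q 2 < c \<and> c < q 3)
          \<Longrightarrow> \<exists>w. R_poly a b c w = 0 \<and> w \<notin> \<real>"
proof -
  obtain \<alpha> \<beta> where E: "\<beta> < \<alpha>" "Q_poly a b \<alpha> = 0" "Q_poly a b \<beta> = 0"
    "\<And>t. Q_poly a b t = 0 \<Longrightarrow> \<beta> \<le> t \<and> t \<le> \<alpha>"
    "\<And>c. c > \<alpha> \<Longrightarrow> \<exists>x1 x2 x3. vieta3 a b c x1 x2 x3 \<and> x1 < 0 \<and> 0 < x2 \<and> x2 < x3 \<and> x3 < 1"
    "\<And>c. c < \<beta> \<Longrightarrow> \<exists>x1 x2 x3. vieta3 a b c x1 x2 x3 \<and> x1 < 0 \<and> 1 < x2 \<and> x2 < x3"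
    "\<And>c x1 x2 x3. vieta3 a b c x1 x2 x3 \<Longrightarrow> x1 < x2 \<Longrightarrow> x2 < x3 \<Longrightarrow> \<beta> < c \<Longrightarrow> c < \<alpha> \<Longrightarrow>
       x3 < 0 \<and> (\<exists>\<mu> \<nu>. Q_poly a b \<mu> = 0 \<and> Q_poly a b \<nu> = 0 \<and> \<beta> < \<mu> \<and> \<mu> < c \<and> c < \<nu> \<and> \<nu> < \<alpha>)"
    by (rule Q_poly_extreme_roots[OF ab], rule that; assumption)
  have inj: "inj_on q {1..m}"
    by (rule strict_mono_on_imp_inj_on[OF q(1)])
  have cardm: "card {t. Q_poly a b t = 0} = m"
    using card_image[OF inj] unfolding q(2) by simp
  have m4: "m \<le> 4" using card_Q_roots[of a b] cardm by simp
  obtain i where i: "i \<in> {1..m}" "q i = \<beta>" using E(3) q(2) by (metis (mono_tags, lifting) imageE mem_Collect_eq)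
  obtain j where j: "j \<in> {1..m}" "q j = \<alpha>" using E(2) q(2) by (metis (mono_tags, lifting) imageE mem_Collect_eq)
  have mono: "s \<in> {1..m} \<Longrightarrow> t \<in> {1..m} \<Longrightarrow> s < t \<Longrightarrow> q s < q t" for s t
    using q(1) by (simp add: strict_mono_on_def)
  have less: "s < t" if "q s < q t" "s \<in> {1..m}" "t \<in> {1..m}" for s t
    using mono[of t s] that by (metis less_asym less_irrefl linorder_neqE_nat)
  have Qq: "Q_poly a b (q s) = 0" if "s \<in> {1..m}" for s using that q(2) by blast
  have m2: "2 \<le> m" using less[of i j] i j E(1) by auto
  show m234: "m \<in> {2,3,4}" using m2 m4 by auto
  have i1: "i = 1"
    using mono[of 1 i] i E(4)[OF Qq[of 1]] m2 by (cases "i = 1") auto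
  have jm: "j = m"
    using mono[of j m] j E(4)[OF Qq[of m]] m2 by (cases "j = m") auto
  have q1: "q 1 = \<beta>" and qm: "q m = \<alpha>" using i j i1 jm by auto
  show "\<And>c. c < q 1 \<Longrightarrow> \<exists>x1 x2 x3. vieta3 a b c x1 x2 x3 \<and> x1 < 0 \<and> 1 < x2 \<and> x2 < x3"
    using E(6) unfolding q1 .
  show "\<And>c. c > q m \<Longrightarrow> \<exists>x1 x2 x3. vieta3 a b c x1 x2 x3 \<and> x1 < 0 \<and> 0 < x2 \<and> x2 < x3 \<and> x3 < 1"
    using E(5) unfolding qm .
  show "\<exists>x1 x2 x3. vieta3 a b c x1 x2 x3 \<and> x1 < x2 \<and> x2 < x3 \<and> x3 < 0"
    if c: "m = 4" "q 2 < c" "c < q 3" for c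
  proof -
    have o: "q 1 < q 2" "q 2 < q 3" "q 3 < q 4" using mono c(1) by auto
    have "Q_poly a b c = 16 * ((c - q 1) * (c - q 2) * (c - q 3) * (c - q 4))"
      using Qq c(1) by (intro Q_poly_four_roots o) auto
    moreover have "(c - q 1) * (c - q 2) * (c - q 3) * (c - q 4) > 0"
      using o c by (simp add: zero_less_mult_iff mult_less_0_iff)
    ultimately obtain x1 x2 x3 where x: "x1 < x2" "x2 < x3" "vieta3 a b c x1 x2 x3"
      using Q_poly_pos_vieta3[of a b c] ab by auto
    thus ?thesis using E(7)[of c x1 x2 x3] o c q1 qm by force
  qed
  show "\<exists>w. R_poly a b c w = 0 \<and> w \<notin> \<real>"
    if c: "q 1 < c" "c < q m" "Q_poly a b c \<noteq> 0" "\<not> (m = 4 \<and> q 2 < c \<and> c < q 3)" for c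
  proof (rule ccontr)
    assume "\<not> ?thesis"
    hence "Q_poly a b c > 0" using Q_poly_neg_imp_nonreal[of a b c] c(3) ab by force
    then obtain x1 x2 x3 where x: "x1 < x2" "x2 < x3" "vieta3 a b c x1 x2 x3"
      using Q_poly_pos_vieta3[of a b c] ab by auto
    then obtain \<mu> \<nu> where mn: "Q_poly a b \<mu> = 0" "Q_poly a b \<nu> = 0" "\<beta> < \<mu>" "\<mu> < c" "c < \<nu>" "\<nu> < \<alpha>"
      using E(7)[of c x1 x2 x3] c q1 qm by auto
    obtain s where s: "s \<in> {1..m}" "q s = \<mu>" using mn(1) q(2) by (metis (mono_tags, lifting) imageE mem_Collect_eq)
    obtain t where t: "t \<in> {1..m}" "q t = \<nu>" using mn(2) q(2) by (metis (mono_tags, lifting) imageE mem_Collect_eq)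
    have "1 < s" "s < t" "t < m" using less[of 1 s] less[of s t] less[of t m] s t mn q1 qm m2 by auto
    hence "m = 4" "s = 2" "t = 3" using m4 by auto
    thus False using c s t mn by auto
  qed
qed

section \<open>The modulus of the saddle function\<close>

text \<open>The function \<open>|exp S|\<close>; it is single-valued although \<open>S\<close> is not.\<close>

definition saddle_mod :: "real \<Rightarrow> real \<Rightarrow> real \<Rightarrow> complex \<Rightarrow> real" where
  "saddle_mod a b c u = exp (b * Re u + a * Re (inverse u)) * norm u powr c * norm (1 - u)"

lemma saddle_mod_nonneg [simp]: "saddle_mod a b c u \<ge> 0"
  by (simp add: saddle_mod_def)

lemma saddle_mod_pos: "u \<noteq> 0 \<Longrightarrow> u \<noteq> 1 \<Longrightarrow> saddle_mod a b c u > 0"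
  by (simp add: saddle_mod_def)

lemma saddle_mod_cnj [simp]: "saddle_mod a b c (cnj u) = saddle_mod a b c u"
proof -
  have "norm (1 - cnj u) = norm (1 - u)" by (metis complex_cnj_diff complex_cnj_one complex_mod_cnj)
  moreover have "Re (inverse (cnj u)) = Re (inverse u)" by simp
  ultimately show ?thesis by (simp add: saddle_mod_def)
qed

lemma continuous_on_saddle_mod: "0 \<notin> S \<Longrightarrow> continuous_on S (saddle_mod a b c)"
  unfolding saddle_mod_def[abs_def] by (intro continuous_intros) auto

lemma cmod_one_minus_sq: "(cmod (1 - u))\<^sup>2 = 1 - 2 * Re u + (cmod u)\<^sup>2"
  unfolding cmod_power2 by (simp add: power2_eq_square algebra_simps)

lemma Re_inverse: "Re (inverse u) = Re u / (cmod u)\<^sup>2"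
  by (simp add: cmod_power2)

text \<open>On a circle about 0 only \<open>Re u\<close> varies in the square, which reduces the
  behaviour along circles to calculus in one real variable.\<close>

lemma saddle_mod_sq:
  assumes "u \<noteq> 0"
  shows "(saddle_mod a b c u)\<^sup>2 = exp (2 * (b + a / (cmod u)\<^sup>2) * Re u) * cmod u powr (2 * c) * (cmod (1 - u))\<^sup>2"
proof -
  have e: "exp (b * Re u + a * Re (inverse u)) ^ 2 = exp (2 * (b + a / (cmod u)\<^sup>2) * Re u)"
    unfolding Re_inverse by (simp add: exp_double[symmetric] algebra_simps)
  have p: "(cmod u powr c)\<^sup>2 = cmod u powr (2 * c)" by (simp add: power2_eq_square powr_add[symmetric])
  show ?thesis unfolding saddle_mod_def power_mult_distrib e p ..
qed

lemma R_poly_finite_zeros: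
  assumes "b \<noteq> 0" shows "finite {z. R_poly a b c z = 0}"
proof -
  obtain z1 z2 z3 where "\<And>z. R_poly a b c z = - of_real b * ((z - z1) * (z - z2) * (z - z3))"
    using R_poly_factor[OF assms] by blast
  hence "{z. R_poly a b c z = 0} \<subseteq> {z1, z2, z3}" using assms by auto
  thus ?thesis by (rule finite_subset) auto
qed

text \<open>Around \<open>w\<close>, a branch of \<open>u powr c\<close> exists, so that \<open>saddle_mod\<close> is locally the modulus of a
  holomorphic function whose logarithmic derivative is a multiple of \<open>R_poly\<close>.\<close>

lemma saddle_mod_no_local_max:
  assumes b: "b \<noteq> 0" and w: "w \<noteq> 0" and U: "open U" "w \<in> U"
    and le: "\<And>u. u \<in> U \<Longrightarrow> saddle_mod a b c u \<le> saddle_mod a b c w"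
  shows False
proof -
  obtain e0 where e0: "e0 > 0" "ball w e0 \<subseteq> U" using U by (meson openE)
  define e where "e = min e0 (cmod w)"
  have e: "e > 0" "ball w e \<subseteq> U" "e \<le> cmod w" using e0 w by (auto simp: e_def)
  define E where "E = (\<lambda>u. exp (of_real b * u + of_real a * inverse u) * exp (of_real c * Ln (u / w)))"
  define f where "f = (\<lambda>u. E u * (1 - u))"
  have pos: "Re (u / w) > 0" "u \<noteq> 0" if "u \<in> ball w e" for u
  proof -
    have "cmod (u - w) < cmod w" using that e by (simp add: dist_norm norm_minus_commute)
    hence "cmod (u / w - 1) < 1" using w by (simp add: diff_divide_distrib[symmetric] norm_divide divide_simps)
    moreover have "\<bar>Re (u / w - 1)\<bar> \<le> cmod (u / w - 1)" by (rule abs_Re_le_cmod)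
    ultimately show "Re (u / w) > 0" by simp
    thus "u \<noteq> 0" by auto
  qed
  have notneg: "u / w \<notin> \<real>\<^sub>\<le>\<^sub>0" if "u \<in> ball w e" for u
    using pos(1)[OF that] by (auto simp: complex_nonpos_Reals_iff)
  have der: "(f has_field_derivative E u * ((of_real b - of_real a / u\<^sup>2 + of_real c / u) * (1 - u) - 1)) (at u)"
    if "u \<in> ball w e" for u
    unfolding f_def E_def using pos[OF that] notneg[OF that] w
    by (auto intro!: derivative_eq_intros simp: field_simps power2_eq_square)
  have norm_f: "cmod (f u) = saddle_mod a b c u / cmod w powr c" if "u \<in> ball w e" for u
  proof -
    have "cmod (exp (of_real c * Ln (u / w))) = (cmod u / cmod w) powr c"
      using pos[OF that] w by (simp add: norm_exp_eq_Re Re_Ln norm_divide powr_def)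
    also have "\<dots> = cmod u powr c / cmod w powr c" by (simp add: powr_divide)
    finally show ?thesis by (simp add: f_def E_def norm_mult saddle_mod_def)
  qed
  have wb: "w \<in> ball w e" using e by simp
  have "f constant_on ball w e"
  proof (rule maximum_modulus_principle[of f "ball w e" "ball w e" w])
    show "f holomorphic_on ball w e" using der
      by (meson holomorphic_on_open open_ball)
    show "cmod (f z) \<le> cmod (f w)" if "z \<in> ball w e" for z
      unfolding norm_f[OF that] norm_f[OF wb] using le e(2) that by (intro divide_right_mono) auto
  qed (use e in auto)
  then obtain k where k: "\<And>u. u \<in> ball w e \<Longrightarrow> f u = k" by (auto simp: constant_on_def)
  have "R_poly a b c u = 0" if u: "u \<in> ball w e" for u
  proof -
    have "((\<lambda>_. k) has_field_derivative E u * ((of_real b - of_real a / u\<^sup>2 + of_real c / u) * (1 - u) - 1)) (at u)"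
      by (rule has_field_derivative_transform_within_open[OF der[OF u], of "ball w e"]) (use k u in auto)
    hence "E u * ((of_real b - of_real a / u\<^sup>2 + of_real c / u) * (1 - u) - 1) = 0"
      using DERIV_unique[OF _ DERIV_const] by blast
    hence "(of_real b - of_real a / u\<^sup>2 + of_real c / u) * (1 - u) - 1 = 0" by (simp add: E_def)
    hence "u\<^sup>2 * ((of_real b - of_real a / u\<^sup>2 + of_real c / u) * (1 - u) - 1) = 0" by simp
    moreover have "u\<^sup>2 * ((of_real b - of_real a / u\<^sup>2 + of_real c / u) * (1 - u) - 1) = R_poly a b c u"
      using pos(2)[OF u] by (simp add: R_poly_def field_simps power2_eq_square power3_eq_cube)
    ultimately show ?thesis by simp
  qed
  hence "ball w e \<subseteq> {z. R_poly a b c z = 0}" by auto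
  hence "finite (ball w e)" using R_poly_finite_zeros[OF b] finite_subset by blast
  thus False using e(1) using uncountable_ball[OF e(1), of w] countable_finite by blast
qed

text \<open>A branch of \<open>exp S\<close> need not extend around the annulus, so the maximum
  principle is used locally: a maximum exists by compactness and cannot be interior.\<close>

lemma saddle_mod_annulus_max:
  assumes b: "b \<noteq> 0" and s: "0 < s1" "s1 \<le> cmod w" "cmod w \<le> s2"
    and M1: "\<And>u. cmod u = s1 \<Longrightarrow> saddle_mod a b c u \<le> M"
    and M2: "\<And>u. cmod u = s2 \<Longrightarrow> saddle_mod a b c u \<le> M"
  shows "saddle_mod a b c w \<le> M"
proof -
  define K where "K = {u. s1 \<le> cmod u \<and> cmod u \<le> s2}"
  have "compact K"
  proof -
    have "K = cball 0 s2 \<inter> {u. s1 \<le> cmod u}" by (auto simp: K_def)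
    moreover have "closed {u::complex. s1 \<le> cmod u}" by (intro closed_Collect_le continuous_intros)
    ultimately show ?thesis by (simp add: compact_Int_closed)
  qed
  moreover have "w \<in> K" using s by (simp add: K_def)
  ultimately obtain v where v: "v \<in> K" "\<And>u. u \<in> K \<Longrightarrow> saddle_mod a b c u \<le> saddle_mod a b c v"
    using continuous_attains_sup[of K "saddle_mod a b c"] continuous_on_saddle_mod[of K a b c] s
    by (force simp: K_def)
  have "cmod v = s1 \<or> cmod v = s2"
  proof (rule ccontr)
    assume "\<not> ?thesis"
    hence "v \<in> {u. s1 < cmod u \<and> cmod u < s2}" using v(1) by (auto simp: K_def)
    moreover have "open {u::complex. s1 < cmod u \<and> cmod u < s2}"
      by (intro open_Collect_conj open_Collect_less continuous_intros)
    ultimately show False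
      using saddle_mod_no_local_max[OF b, of v "{u. s1 < cmod u \<and> cmod u < s2}" a c] v s
      by (force simp: K_def)
  qed
  hence "saddle_mod a b c v \<le> M" using M1 M2 by auto
  thus ?thesis using v(2)[OF \<open>w \<in> K\<close>] by linarith
qed

text \<open>With \<open>t = Re w\<close>, the logarithm of the squared modulus is a linear function
  of \<open>t\<close> plus the logarithm of the positive affine function
  \<open>1 - 2 * t + s^2\<close>, hence concave. Its superlevel sets are intervals of
  \<open>t\<close>, and the upper half-circle is a graph over \<open>t\<close>.\<close>

lemma connected_arc_superlevel:
  assumes s: "s > 0" and V: "V > 0"
  shows "connected {w. cmod w = s \<and> Im w > 0 \<and> saddle_mod a b c w > V}"
proof -
  define B where "B = b + a / s\<^sup>2"
  define C where "C = s powr (2 * c)"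
  have C: "C > 0" using s by (simp add: C_def)
  define I where "I = {t. - s < t \<and> t < s \<and> ln (V\<^sup>2 / C) < 2 * B * t + ln (1 - 2 * t + s\<^sup>2)}"
  have pos: "1 - 2 * t + s\<^sup>2 > 0" if "t < s" for t
  proof -
    have "0 \<le> (1 - s)\<^sup>2" by simp
    thus ?thesis using that by (simp add: power2_eq_square algebra_simps)
  qed
  have iff: "V < saddle_mod a b c w \<longleftrightarrow> ln (V\<^sup>2 / C) < 2 * B * Re w + ln (1 - 2 * Re w + s\<^sup>2)"
    if w: "cmod w = s" "Re w < s" for w
  proof -
    have "V < saddle_mod a b c w \<longleftrightarrow> V\<^sup>2 < (saddle_mod a b c w)\<^sup>2"
      using V by (simp add: power2_less_imp_less power_strict_mono less_le_not_le)
    also have "(saddle_mod a b c w)\<^sup>2 = C * (exp (2 * B * Re w) * (1 - 2 * Re w + s\<^sup>2))"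
      using w s by (subst saddle_mod_sq) (auto simp: cmod_one_minus_sq B_def C_def)
    also have "V\<^sup>2 < \<dots> \<longleftrightarrow> V\<^sup>2 / C < exp (2 * B * Re w) * (1 - 2 * Re w + s\<^sup>2)"
      using C by (simp add: field_simps)
    also have "\<dots> \<longleftrightarrow> ln (V\<^sup>2 / C) < ln (exp (2 * B * Re w) * (1 - 2 * Re w + s\<^sup>2))"
      using V C pos[OF w(2)] by (intro ln_less_cancel_iff[symmetric]) auto
    also have "\<dots> \<longleftrightarrow> ln (V\<^sup>2 / C) < 2 * B * Re w + ln (1 - 2 * Re w + s\<^sup>2)"
      using pos[OF w(2)] by (subst ln_mult) auto
    finally show ?thesis .
  qed
  have "convex I"
  proof (rule convexI)
    fix x y u v :: real
    assume xy: "x \<in> I" "y \<in> I" and uv: "0 \<le> u" "0 \<le> v" "u + v = 1"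
    have v1: "v = 1 - u" using uv by simp
    have r: "- s < u * x + v * y" "u * x + v * y < s"
      using xy uv convexD[OF convex_real_interval(8)[of "-s" s], of x y u v] by (auto simp: I_def)
    have lin: "1 - 2 * (u * x + v * y) + s\<^sup>2 = u * (1 - 2 * x + s\<^sup>2) + v * (1 - 2 * y + s\<^sup>2)"
      unfolding v1 by (simp add: algebra_simps)
    have "u * ln (1 - 2 * x + s\<^sup>2) + v * ln (1 - 2 * y + s\<^sup>2) \<le> ln (1 - 2 * (u * x + v * y) + s\<^sup>2)"
      unfolding lin using ln_concave[unfolded concave_on_iff] pos[of x] pos[of y] xy uv by (force simp: I_def)
    moreover have "ln (V\<^sup>2 / C) < u * (2 * B * x + ln (1 - 2 * x + s\<^sup>2)) + v * (2 * B * y + ln (1 - 2 * y + s\<^sup>2))"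
    proof -
      have "convex {ln (V\<^sup>2 / C)<..}" by (rule convex_real_interval)
      from convexD[OF this, of "2 * B * x + ln (1 - 2 * x + s\<^sup>2)" "2 * B * y + ln (1 - 2 * y + s\<^sup>2)" u v]
      show ?thesis using xy uv by (simp add: I_def)
    qed
    ultimately show "u *\<^sub>R x + v *\<^sub>R y \<in> I" using r by (simp add: I_def algebra_simps)
  qed
  define g where "g = (\<lambda>t. Complex t (sqrt (s\<^sup>2 - t\<^sup>2)))"
  have "{w. cmod w = s \<and> Im w > 0 \<and> saddle_mod a b c w > V} = g ` I"
  proof (intro equalityI subsetI)
    fix w assume "w \<in> {w. cmod w = s \<and> Im w > 0 \<and> saddle_mod a b c w > V}"
    hence w: "cmod w = s" "Im w > 0" "saddle_mod a b c w > V" by auto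
    have sq: "s\<^sup>2 - (Re w)\<^sup>2 = (Im w)\<^sup>2" using cmod_power2[of w] w(1) by simp
    moreover have "(Im w)\<^sup>2 > 0" using w(2) by simp
    ultimately have "(Re w)\<^sup>2 < s\<^sup>2" by linarith
    hence "\<bar>Re w\<bar> < s" using s power2_less_imp_less[of "\<bar>Re w\<bar>" s] by simp
    hence "Re w \<in> I" using iff[of w] w by (auto simp: I_def)
    moreover have "w = g (Re w)" using sq w(2) by (simp add: g_def complex_eq_iff)
    ultimately show "w \<in> g ` I" by blast
  next
    fix w assume "w \<in> g ` I"
    then obtain t where t: "t \<in> I" "w = g t" by blast
    have ts: "\<bar>t\<bar> < s" using t by (auto simp: I_def)
    hence lt: "t\<^sup>2 < s\<^sup>2" using power_strict_mono[of "\<bar>t\<bar>" s 2] by simp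
    have "cmod w = s" using t lt s by (simp add: g_def cmod_def)
    moreover have "Im w > 0" "Re w = t" using t lt by (auto simp: g_def)
    ultimately show "w \<in> {w. cmod w = s \<and> Im w > 0 \<and> saddle_mod a b c w > V}"
      using iff[of w] t(1) by (auto simp: I_def)
  qed
  moreover have "connected (g ` I)"
    unfolding g_def Complex_eq using convex_connected[OF \<open>convex I\<close>]
    by (intro connected_continuous_image) (auto intro!: continuous_intros)
  ultimately show ?thesis by simp
qed

text \<open>Conjugation settles the lower half-plane; a real point is rotated a little, the strict
  inequality being an open condition.\<close>

lemma saddle_mod_upper_point:
  assumes "s > 0" "cmod w = s" "saddle_mod a b c w > V"
  shows "\<exists>u. cmod u = s \<and> Im u > 0 \<and> saddle_mod a b c u > V"
proof -
  consider "Im w > 0" | "Im w < 0" | "Im w = 0" by linarith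
  thus ?thesis
  proof cases
    case 2
    thus ?thesis using assms by (intro exI[of _ "cnj w"]) auto
  next
    case 3
    define g where "g = (\<lambda>t::real. w * cis t)"
    have n: "cmod (g t) = s" for t using assms by (simp add: g_def norm_mult)
    have Img: "Im (g t) = Re w * sin t" for t using 3 by (simp add: g_def)
    have Re: "Re w \<noteq> 0" using 3 assms by (metis complex_eq_0 norm_eq_zero less_irrefl power2_eq_square mult_zero_left add_0 zero_eq_power2)
    have cont: "continuous_on UNIV (\<lambda>t. saddle_mod a b c (g t))"
    proof (rule continuous_on_compose2[of "-{0}" "saddle_mod a b c" UNIV g])
      show "continuous_on (- {0}) (saddle_mod a b c)" by (rule continuous_on_saddle_mod) auto
      show "continuous_on UNIV g" unfolding g_def by (intro continuous_intros)
      show "range g \<subseteq> - {0}" using n assms(1) by (metis ComplI image_subsetI norm_eq_zero singletonD less_irrefl)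
    qed
    hence op: "open {t. saddle_mod a b c (g t) > V}"
      by (intro open_Collect_less) (auto intro: continuous_intros)
    have "0 \<in> {t. saddle_mod a b c (g t) > V}" using assms by (simp add: g_def)
    then obtain e where e: "e > 0" "ball 0 e \<subseteq> {t. saddle_mod a b c (g t) > V}"
      using op by (meson openE)
    define t where "t = min (e/2) 1"
    have t: "0 < t" "t < e" "t < pi" using e pi_gt3 by (auto simp: t_def)
    have "sin t > 0" using t by (simp add: sin_gt_zero)
    define t' where "t' = (if Re w > 0 then t else - t)"
    have "Im (g t') > 0" unfolding Img t'_def using Re \<open>sin t > 0\<close> by (auto simp: mult_neg_pos)
    moreover have "t' \<in> ball 0 e" using t by (auto simp: t'_def)
    ultimately show ?thesis using n e(2) by blast
  qed (use assms in blast)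
qed

text \<open>The modulus maps the set onto \<open>T\<close> with connected fibres, and it is an open
  map because points can be moved radially; such a map pulls connectedness back from
  \<open>T\<close>.\<close>

lemma connected_superlevel:
  assumes T: "connected T" "\<And>s. s \<in> T \<Longrightarrow> s > 0" "open T" and V: "V > 0"
    and ne: "\<And>s. s \<in> T \<Longrightarrow> \<exists>w. cmod w = s \<and> saddle_mod a b c w > V"
  defines "S \<equiv> {w. cmod w \<in> T \<and> Im w > 0 \<and> saddle_mod a b c w > V}"
  shows "connected S" "open S"
proof -
  have S0: "0 \<notin> S" using T(2) by (auto simp: S_def)
  define P where "P = {w. Im w > 0}"
  have oP: "open P" unfolding P_def by (intro open_Collect_less continuous_intros)
  have "open (P \<inter> saddle_mod a b c -` {V<..})"
    by (intro continuous_open_preimage continuous_on_saddle_mod oP) (auto simp: P_def)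
  moreover have "open (P \<inter> cmod -` T)"
    by (intro continuous_open_preimage oP T continuous_intros)
  ultimately have "open ((P \<inter> saddle_mod a b c -` {V<..}) \<inter> (P \<inter> cmod -` T))" by blast
  also have "(P \<inter> saddle_mod a b c -` {V<..}) \<inter> (P \<inter> cmod -` T) = S"
    by (auto simp: S_def P_def)
  finally show oS: "open S" .
  have im: "cmod ` S = T"
  proof
    show "T \<subseteq> cmod ` S"
    proof
      fix s assume s: "s \<in> T"
      then obtain w where "cmod w = s" "saddle_mod a b c w > V" using ne by blast
      then obtain u where "cmod u = s" "Im u > 0" "saddle_mod a b c u > V"
        using saddle_mod_upper_point T(2)[OF s] by blast
      thus "s \<in> cmod ` S" using s by (force simp: S_def)
    qed
  qed (auto simp: S_def)
  have "connected (S \<inter> cmod -` T)"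
  proof (rule connected_open_monotone_preimage[OF _ im])
    show "continuous_on S cmod" by (intro continuous_intros)
    show "openin (top_of_set T) (cmod ` C)" if C: "openin (top_of_set S) C" for C
    proof -
      have oC: "open C" "C \<subseteq> S" using C oS by (auto simp: openin_open_eq)
      have "open (cmod ` C)"
      proof (subst open_contains_ball, intro ballI)
        fix s assume "s \<in> cmod ` C"
        then obtain w where w: "w \<in> C" "s = cmod w" by blast
        have w0: "w \<noteq> 0" using w oC S0 by blast
        define h where "h = (\<lambda>t::real. of_real t * (w / of_real (cmod w)))"
        have "open (h -` C)" unfolding h_def by (intro open_vimage oC continuous_intros) (use w0 in auto)
        moreover have "s \<in> h -` C" using w w0 by (simp add: h_def)
        moreover have "open {0::real<..}" by simp
        ultimately have "open (h -` C \<inter> {0<..})" "s \<in> h -` C \<inter> {0<..}" using w w0 by auto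
        then obtain e where e: "e > 0" "ball s e \<subseteq> h -` C \<inter> {0<..}" by (meson openE)
        have "ball s e \<subseteq> cmod ` C"
        proof
          fix t assume "t \<in> ball s e"
          hence t: "h t \<in> C" "t > 0" using e by auto
          have "cmod (h t) = t" using t w0 by (simp add: h_def norm_mult norm_divide)
          thus "t \<in> cmod ` C" using t by force
        qed
        thus "\<exists>e>0. ball s e \<subseteq> cmod ` C" using e by blast
      qed
      moreover have "cmod ` C \<subseteq> T" using oC im by blast
      ultimately show ?thesis using T(3) by (simp add: openin_open_eq)
    qed
    show "connected (S \<inter> cmod -` {y})" if "y \<in> T" for y
    proof -
      have "S \<inter> cmod -` {y} = {w. cmod w = y \<and> Im w > 0 \<and> saddle_mod a b c w > V}"
        using that by (auto simp: S_def)
      thus ?thesis using connected_arc_superlevel[OF T(2)[OF that] V] by simp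
    qed
  qed (use T in auto)
  moreover have "S \<inter> cmod -` T = S" by (auto simp: S_def)
  ultimately show "connected S" by simp
qed

section \<open>Residues and symmetric contours\<close>

text \<open>The residues at 0 and 1 stay unevaluated: later the contour does not wind around the
  point, or the residue cancels between two contours, or it is absorbed into the regular
  part.\<close>

lemma cauchy_kernel_residues:
  assumes G: "G holomorphic_on - {0, 1}" and u: "u \<noteq> 0" "u \<noteq> 1"
    and W: "valid_path W" "pathfinish W = pathstart W" "path_image W \<subseteq> - {0, 1, u}"
  shows "contour_integral W (\<lambda>w. G w / (w - u)) = 2 * of_real pi * \<i> *
    (winding_number W u * G u + winding_number W 0 * residue (\<lambda>w. G w / (w - u)) 0
      + winding_number W 1 * residue (\<lambda>w. G w / (w - u)) 1)"
proof -
  have "contour_integral W (\<lambda>w. G w / (w - u)) = 2 * pi * \<i> *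
     (\<Sum>p\<in>{0,1,u}. winding_number W p * residue (\<lambda>w. G w / (w - u)) p)"
  proof (rule Residue_theorem[of UNIV])
    show "(\<lambda>w. G w / (w - u)) holomorphic_on UNIV - {0, 1, u}"
      by (intro holomorphic_intros holomorphic_on_subset[OF G]) auto
  qed (use W in auto)
  moreover have "residue (\<lambda>w. G w / (w - u)) u = G u"
    by (rule residue_simple[of "- {0,1}"]) (use u G in \<open>auto intro: open_Compl finite_imp_closed\<close>)
  ultimately show ?thesis using u by (simp add: algebra_simps)
qed

lemma holomorphic_circle_transform:
  assumes f: "continuous_on (sphere 0 s) f" and s: "s > 0" and S: "open S" "S \<inter> sphere 0 s = {}"
  shows "(\<lambda>u. contour_integral (circlepath 0 s) (\<lambda>w. f w / (w - u))) holomorphic_on S"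
proof -
  have "\<exists>d. ((\<lambda>u. contour_integral (circlepath 0 s) (\<lambda>w. f w / (w - u))) has_field_derivative d) (at u)"
    if u: "u \<in> S" for u
  proof -
    have int: "((\<lambda>w. f w / (w - v) ^ 1) has_contour_integral
        contour_integral (circlepath 0 s) (\<lambda>w. f w / (w - v))) (circlepath 0 s)"
      if "v \<in> S - path_image (circlepath 0 s)" for v
    proof -
      have "continuous_on (sphere 0 s) (\<lambda>w. f w / (w - v))"
        using that s by (intro continuous_intros f) (auto simp: path_image_circlepath)
      hence "(\<lambda>w. f w / (w - v)) contour_integrable_on circlepath 0 s"
        using s by (intro contour_integrable_continuous_circlepath) simp
      thus ?thesis by (simp add: has_contour_integral_integral)
    qed
    show ?thesis
      using Cauchy_next_derivative(2)[of "circlepath 0 s" f "2 * pi * s" S 1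
           "\<lambda>u. contour_integral (circlepath 0 s) (\<lambda>w. f w / (w - u))" u] int f s S u
      by (force simp: vector_derivative_circlepath norm_mult)
  qed
  thus ?thesis using S(1) by (auto simp: holomorphic_on_open)
qed

text \<open>With \<open>G = P + H\<close> split into its principal part \<open>P\<close> at \<open>1\<close> and the rest, the residue at \<open>1\<close>
  below is \<open>- P u\<close>.\<close>

lemma regular_part_exists:
  assumes G: "G holomorphic_on - {0, 1}" and e: "0 < e" "e < 1" "1 < R"
  obtains H where "H holomorphic_on {u. e < cmod u \<and> cmod u < R}"
    "\<And>u. e < cmod u \<Longrightarrow> cmod u < R \<Longrightarrow> u \<noteq> 1 \<Longrightarrow> H u = G u + residue (\<lambda>w. G w / (w - u)) 1"
proof
  define A where "A = {u. e < cmod u \<and> cmod u < R}"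
  \<comment> \<open>Cauchy's integral over the boundary of the annulus, holomorphic also at 1. The
    point 0 contributes the same residue to both circles.\<close>
  define H where "H = (\<lambda>u. 1 / (2 * of_real pi * \<i>) * (contour_integral (circlepath 0 R) (\<lambda>w. G w / (w - u))
     - contour_integral (circlepath 0 e) (\<lambda>w. G w / (w - u))))"
  have oA: "open A" unfolding A_def by (intro open_Collect_conj open_Collect_less continuous_intros)
  have cont: "continuous_on S G" if "S \<subseteq> - {0, 1}" for S
    using G that holomorphic_on_imp_continuous_on holomorphic_on_subset by blast
  have c1: "continuous_on (sphere 0 R) G" "continuous_on (sphere 0 e) G"
    using e by (auto intro!: cont)
  show "H holomorphic_on {u. e < cmod u \<and> cmod u < R}"
    unfolding H_def A_def[symmetric]
    by (intro holomorphic_intros holomorphic_circle_transform c1 oA) (use e in \<open>auto simp: A_def\<close>)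
  fix u assume u: "e < cmod u" "cmod u < R" "u \<noteq> 1"
  have u0: "u \<noteq> 0" using u e by auto
  have R: "contour_integral (circlepath 0 R) (\<lambda>w. G w / (w - u)) = 2 * of_real pi * \<i> *
    (G u + residue (\<lambda>w. G w / (w - u)) 0 + residue (\<lambda>w. G w / (w - u)) 1)"
    using e u by (subst cauchy_kernel_residues[OF G u0 u(3)]) (auto simp: winding_number_circlepath)
  have "winding_number (circlepath 0 e) v = 0" if "cmod v > e" for v
    using that e by (intro winding_number_zero_outside[of _ "cball 0 e"]) auto
  hence "contour_integral (circlepath 0 e) (\<lambda>w. G w / (w - u)) = 2 * of_real pi * \<i> *
    residue (\<lambda>w. G w / (w - u)) 0"
    using e u by (subst cauchy_kernel_residues[OF G u0 u(3)]) (auto simp: winding_number_circlepath)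
  with R show "H u = G u + residue (\<lambda>w. G w / (w - u)) 1"
    unfolding H_def by (simp add: field_simps)
qed

section \<open>Loops symmetric under conjugation\<close>

definition sym_loop :: "(real \<Rightarrow> complex) \<Rightarrow> real \<Rightarrow> complex" where
  "sym_loop g = (cnj \<circ> g) +++ reversepath g"

definition upper_path :: "real \<Rightarrow> real \<Rightarrow> (real \<Rightarrow> complex) \<Rightarrow> bool" where
  "upper_path p1 p2 g \<longleftrightarrow> valid_path g \<and> pathstart g = of_real p1 \<and> pathfinish g = of_real p2 \<and>
     path_image g \<subseteq> {z. Im z > 0} \<union> {of_real p1, of_real p2}"

lemma cnj_path_simps [simp]:
  "valid_path g \<Longrightarrow> valid_path (cnj \<circ> g)" "pathstart (cnj \<circ> g) = cnj (pathstart g)"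
  "pathfinish (cnj \<circ> g) = cnj (pathfinish g)" "path_image (cnj \<circ> g) = cnj ` path_image g"
  by (auto simp: pathstart_def pathfinish_def path_image_def valid_path_cnj)

lemma sym_loop_props:
  assumes "upper_path p1 p2 g"
  shows "valid_path (sym_loop g)" "pathfinish (sym_loop g) = pathstart (sym_loop g)"
    "path_image (sym_loop g) = cnj ` path_image g \<union> path_image g"
  using assms unfolding upper_path_def sym_loop_def
  by (auto simp: path_image_join intro!: valid_path_join)

text \<open>The lower half is expressed by the conjugated integrand on the upper path, so that
  estimates are needed only there.\<close>

lemma contour_integral_sym_loop:
  assumes g: "upper_path p1 p2 g" and f: "continuous_on (path_image (sym_loop g)) f"
    "f holomorphic_on S" "open S" "path_image (sym_loop g) \<subseteq> S"
  shows "contour_integral (sym_loop g) f = cnj (contour_integral g (cnj \<circ> f \<circ> cnj)) - contour_integral g f"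
proof -
  have v: "valid_path g" "pathstart g = of_real p1" "pathfinish g = of_real p2" using g by (auto simp: upper_path_def)
  have pi: "path_image g \<subseteq> S" "path_image (cnj \<circ> g) \<subseteq> S" using f(4) sym_loop_props(3)[OF g] by auto
  have i: "f contour_integrable_on g" "f contour_integrable_on (cnj \<circ> g)"
    using contour_integrable_holomorphic_simple[OF f(2,3)] v pi by auto
  have "contour_integral (sym_loop g) f = contour_integral (cnj \<circ> g) f - contour_integral g f"
    unfolding sym_loop_def using v i
    by (subst contour_integral_join) (auto simp: contour_integral_reversepath contour_integrable_reversepath)
  thus ?thesis using contour_integral_cnj[OF v(1), of f] by simp
qed

text \<open>The logarithm \<open>Ln (- \<i> * (w - t))\<close> has its cut pointing downwards, so it
  is a primitive along the upper half of the loop; the lower half contributes the conjugate. The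
  loop runs from \<open>p1\<close> to \<open>p2\<close> below the axis and back above it, hence
  counterclockwise.\<close>

lemma winding_sym_loop_real:
  assumes g: "upper_path p1 p2 g" and p: "p1 < p2" and t: "t \<noteq> p1" "t \<noteq> p2"
  shows "winding_number (sym_loop g) (of_real t) = (if p1 < t \<and> t < p2 then 1 else 0)"
proof -
  have v: "valid_path g" "pathstart g = of_real p1" "pathfinish g = of_real p2"
    "path_image g \<subseteq> {z. Im z > 0} \<union> {of_real p1, of_real p2}" using g by (auto simp: upper_path_def)
  have tn: "of_real t \<notin> path_image (sym_loop g)"
    using v(4) t unfolding sym_loop_props(3)[OF g]
    by (auto simp: image_iff) (metis (no_types, lifting) Im_complex_of_real complex_cnj_cnj complex_cnj_complex_of_real insertE mem_Collect_eq of_real_eq_iff order_less_irrefl subsetD)+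
  have "((\<lambda>w. 1 / (w - of_real t)) has_contour_integral
      Ln (- \<i> * (pathfinish g - of_real t)) - Ln (- \<i> * (pathstart g - of_real t))) g"
  proof (rule contour_integral_primitive)
    fix w assume "w \<in> path_image g"
    hence w: "Im w > 0 \<or> w = of_real p1 \<or> w = of_real p2" using v(4) by auto
    hence "w \<noteq> of_real t" "- \<i> * (w - of_real t) \<notin> \<real>\<^sub>\<le>\<^sub>0" using t by (auto simp: complex_nonpos_Reals_iff)
    hence "((\<lambda>w. Ln (- \<i> * (w - of_real t))) has_field_derivative 1 / (w - of_real t)) (at w)"
      by (auto intro!: derivative_eq_intros simp: field_simps)
    thus "((\<lambda>w. Ln (- \<i> * (w - of_real t))) has_field_derivative 1 / (w - of_real t)) (at w within path_image g)"
      by (rule has_field_derivative_at_within)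
  qed (use v in auto)
  hence I: "contour_integral g (\<lambda>w. 1 / (w - of_real t)) =
      Ln (- \<i> * of_real (p2 - t)) - Ln (- \<i> * of_real (p1 - t))"
    using v by (simp add: contour_integral_unique)
  have Lnval: "Ln (- \<i> * of_real x) = of_real (ln \<bar>x\<bar>) + (if x > 0 then - \<i> * of_real (pi/2) else \<i> * of_real (pi/2))" if "x \<noteq> 0" for x
    using that Ln_times_of_real[of "\<bar>x\<bar>" "- \<i>"] Ln_times_of_real[of "\<bar>x\<bar>" "\<i>"]
    by (auto simp: Ln_of_real mult.commute)
  have "contour_integral (sym_loop g) (\<lambda>w. 1 / (w - of_real t))
      = cnj (contour_integral g (cnj \<circ> (\<lambda>w. 1 / (w - of_real t)) \<circ> cnj)) - contour_integral g (\<lambda>w. 1 / (w - of_real t))"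
    by (rule contour_integral_sym_loop[OF g, of _ "- {of_real t}"])
       (use tn in \<open>auto intro!: continuous_intros holomorphic_intros\<close>)
  also have "cnj \<circ> (\<lambda>w. 1 / (w - of_real t)) \<circ> cnj = (\<lambda>w. 1 / (w - of_real t))" by auto
  also have "cnj (contour_integral g (\<lambda>w. 1 / (w - of_real t))) - contour_integral g (\<lambda>w. 1 / (w - of_real t))
     = (if p1 < t \<and> t < p2 then 2 * of_real pi * \<i> else 0)"
  proof -
    have "p2 - t \<noteq> 0" "p1 - t \<noteq> 0" using t by auto
    note L = Lnval[OF this(1)] Lnval[OF this(2)]
    show ?thesis unfolding I L using t p by (simp add: complex_eq_iff)
  qed
  finally have "contour_integral (sym_loop g) (\<lambda>w. 1 / (w - of_real t)) = (if p1 < t \<and> t < p2 then 2 * of_real pi * \<i> else 0)" .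
  thus ?thesis
    by (subst winding_number_valid_path[OF sym_loop_props(1)[OF g] tn]) simp
qed

lemma winding_sym_loop:
  assumes g: "upper_path p1 p2 g" and p: "p1 < p2" and t: "t \<noteq> p1" "t \<noteq> p2"
    and S: "connected S" "u \<in> S" "of_real t \<in> S" "S \<inter> path_image (sym_loop g) = {}"
  shows "winding_number (sym_loop g) u = (if p1 < t \<and> t < p2 then 1 else 0)"
  using winding_sym_loop_real[OF g p t] sym_loop_props[OF g]
    winding_number_eq[OF valid_path_imp_path _ S(2,3,1,4)] by simp

section \<open>The kernel as an integral over one circle of free radius\<close>

definition kernel_num :: "real \<Rightarrow> real \<Rightarrow> nat \<Rightarrow> int \<Rightarrow> complex \<Rightarrow> complex" where
  "kernel_num gp gm n x u = kernel_weight gp gm u * u powi x * (1 - u) ^ n"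

definition beta_integrand :: "int \<Rightarrow> int \<Rightarrow> complex \<Rightarrow> complex" where
  "beta_integrand k l u = (1 - u) powi k * u powi (- l - 1)"

lemma kernel_weight_nonzero [simp]: "kernel_weight gp gm u \<noteq> 0"
  by (simp add: kernel_weight_def)

lemma kernel_num_holomorphic: "0 \<notin> S \<Longrightarrow> kernel_num gp gm n x holomorphic_on S"
  unfolding kernel_num_def[abs_def] kernel_weight_def by (auto intro!: holomorphic_intros)

lemma kernel_num_eq_0_iff: "u \<noteq> 0 \<Longrightarrow> n > 0 \<Longrightarrow> kernel_num gp gm n x u = 0 \<longleftrightarrow> u = 1"
  by (simp add: kernel_num_def power_int_eq_0_iff)

lemma inverse_kernel_num_holomorphic:
  assumes "0 \<notin> S" "1 \<notin> S" shows "(\<lambda>w. inverse (kernel_num gp gm n x w)) holomorphic_on S"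
proof -
  have "kernel_num gp gm n x w \<noteq> 0" if "w \<in> S" for w
    using that assms by (auto simp: kernel_num_def power_int_eq_0_iff)
  thus ?thesis using kernel_num_holomorphic[OF assms(1)] by (auto intro!: holomorphic_intros)
qed

lemma beta_integrand_holomorphic:
  assumes "0 \<notin> S" "1 \<notin> S \<or> k \<ge> 0" shows "beta_integrand k l holomorphic_on S"
  unfolding beta_integrand_def[abs_def] using assms by (auto intro!: holomorphic_intros)

text \<open>The denominator in \<open>w\<close> is \<open>kernel_num\<close> again, with the
  exponent \<open>1 + x2\<close>. At \<open>w = u\<close> the weights cancel, and this is where the
  integrand of the incomplete beta kernel comes from.\<close>

lemma kernel_num_quotient:
  assumes "u \<noteq> 0" "u \<noteq> 1"
  shows "kernel_num gp gm n1 x1 u * inverse (kernel_num gp gm n2 (1 + x2) u)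
           = beta_integrand (int n1 - int n2) (x2 - x1) u"
proof -
  have "u powi (- (x2 - x1) - 1) = u powi x1 * inverse (u powi (1 + x2))"
    using assms by (simp add: power_int_diff power_int_add power_int_minus field_simps)
  moreover have "(1 - u) powi (int n1 - int n2) = (1 - u) ^ n1 * inverse ((1 - u) ^ n2)"
    using assms by (simp add: power_int_diff field_simps)
  ultimately show ?thesis using assms by (simp add: kernel_num_def beta_integrand_def)
qed

lemma circle_integral_radius_indep:
  assumes "f holomorphic_on S" "open S" "r > 0" "\<rho> > 0"
    and "\<And>u. min r \<rho> \<le> cmod u \<Longrightarrow> cmod u \<le> max r \<rho> \<Longrightarrow> u \<in> S"
  shows "contour_integral (circlepath 0 r) f = contour_integral (circlepath 0 \<rho>) f"
proof (rule Cauchy_theorem_homotopic_loops[OF _ assms(2,1)])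
  show "homotopic_loops S (circlepath 0 r) (circlepath 0 \<rho>)"
  proof (rule homotopic_loops_linear)
    fix t :: real assume "t \<in> {0..1}"
    show "closed_segment (circlepath 0 r t) (circlepath 0 \<rho> t) \<subseteq> S"
    proof
      fix u assume "u \<in> closed_segment (circlepath 0 r t) (circlepath 0 \<rho> t)"
      then obtain s where s: "0 \<le> s" "s \<le> 1" "u = (1 - s) *\<^sub>R circlepath 0 r t + s *\<^sub>R circlepath 0 \<rho> t"
        by (auto simp: closed_segment_def)
      have "u = of_real ((1 - s) * r + s * \<rho>) * exp (2 * of_real pi * \<i> * of_real t)"
        unfolding s(3) circlepath by (simp add: scaleR_conv_of_real algebra_simps)
      hence "cmod u = \<bar>(1 - s) * r + s * \<rho>\<bar>" by (simp only: norm_mult norm_of_real) (simp add: norm_exp_eq_Re)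
      hence n: "cmod u = (1 - s) * r + s * \<rho>" using s assms(3,4) by simp
      have "(1 - s) * min r \<rho> + s * min r \<rho> \<le> cmod u" "cmod u \<le> (1 - s) * max r \<rho> + s * max r \<rho>"
        unfolding n using s by (intro add_mono mult_left_mono; simp)+
      thus "u \<in> S" using assms(5)[of u] by (simp add: algebra_simps)
    qed
  qed auto
qed auto

text \<open>\<open>H\<close> is \<open>G\<close> minus its principal part at \<open>1\<close>, encoded by what the residue theorem says about it.\<close>

definition regular_part_on :: "real \<Rightarrow> (complex \<Rightarrow> complex) \<Rightarrow> (complex \<Rightarrow> complex) \<Rightarrow> bool" where
  "regular_part_on \<rho> G H \<longleftrightarrow> continuous_on (sphere 0 \<rho>) H \<and>
    (\<forall>u W. cmod u = \<rho> \<longrightarrow> u \<noteq> 1 \<longrightarrow> valid_path W \<longrightarrow> pathfinish W = pathstart W \<longrightarrow>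
       path_image W \<subseteq> - {0, 1, u} \<longrightarrow>
       contour_integral W (\<lambda>w. G w / (w - u)) = 2 * of_real pi * \<i> *
         (winding_number W u * G u + winding_number W 0 * residue (\<lambda>w. G w / (w - u)) 0
          + winding_number W 1 * (H u - G u)))"

lemma regular_part_onD:
  assumes "regular_part_on \<rho> G H"
  shows "continuous_on (sphere 0 \<rho>) H"
    "cmod u = \<rho> \<Longrightarrow> u \<noteq> 1 \<Longrightarrow> valid_path W \<Longrightarrow> pathfinish W = pathstart W \<Longrightarrow>
       path_image W \<subseteq> - {0, 1, u} \<Longrightarrow>
       contour_integral W (\<lambda>w. G w / (w - u)) = 2 * of_real pi * \<i> *
         (winding_number W u * G u + winding_number W 0 * residue (\<lambda>w. G w / (w - u)) 0
          + winding_number W 1 * (H u - G u))"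
  using assms unfolding regular_part_on_def by blast+

text \<open>The inner circle picks up the residue at 1, which is \<open>H u - G u\<close>; since
  \<open>F * G\<close> is the beta integrand, the double integral becomes that of
  \<open>beta_integrand - F * H\<close>. For \<open>n1 < n2\<close> the beta integrand has a pole at
  1, and exactly then the single integral cancels it. What is left is holomorphic in an annulus
  containing both circles, even if 1 lies between them.\<close>

lemma plancherel_kernel_circle:
  fixes gp gm \<rho> r \<epsilon> :: real and n1 n2 :: nat and x1 x2 :: int
  assumes r: "0 < r" "r < 1" "0 < \<epsilon>" "\<epsilon> < 1 - r" and \<rho>: "\<rho> > 0"
  defines "F \<equiv> kernel_num gp gm n1 x1" and "G \<equiv> \<lambda>w. inverse (kernel_num gp gm n2 (1 + x2) w)"
  shows "\<exists>H. regular_part_on \<rho> G H \<and> plancherel_kernel r \<epsilon> gp gm n1 x1 n2 x2 = 1 / (2 * of_real pi * \<i>) *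
       contour_integral (circlepath 0 \<rho>)
         (\<lambda>u. (if n1 < n2 then 0 else beta_integrand (int n1 - int n2) (x2 - x1) u) - F u * H u)"
proof -
  define e where "e = min r \<rho> / 2"
  define R where "R = max 1 \<rho> + 1"
  have e: "0 < e" "e < r" "e < \<rho>" "e < 1" and R: "1 < R" "\<rho> < R" "r < R"
    using r \<rho> by (auto simp: e_def R_def)
  define S where "S = {u. e < cmod u \<and> cmod u < R}"
  have oS: "open S" unfolding S_def by (intro open_Collect_conj open_Collect_less continuous_intros)
  have S0: "0 \<notin> S" using e by (simp add: S_def)
  have G: "G holomorphic_on - {0, 1}" unfolding G_def by (rule inverse_kernel_num_holomorphic) auto
  obtain H where H: "H holomorphic_on S"
    "\<And>u. u \<in> S \<Longrightarrow> u \<noteq> 1 \<Longrightarrow> H u = G u + residue (\<lambda>w. G w / (w - u)) 1"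
    using regular_part_exists[OF G e(1,4) R(1)] unfolding S_def by (metis mem_Collect_eq)
  define E where "E = (\<lambda>u. (if n1 < n2 then 0 else beta_integrand (int n1 - int n2) (x2 - x1) u) - F u * H u)"
  have Fh: "F holomorphic_on S" unfolding F_def by (rule kernel_num_holomorphic[OF S0])
  have Eh: "E holomorphic_on S" unfolding E_def
    using S0 by (cases "n1 < n2") (auto intro!: holomorphic_intros Fh H(1) beta_integrand_holomorphic)
  define \<phi> where "\<phi> = beta_integrand (int n1 - int n2) (x2 - x1)"
  have FG: "F u * G u = \<phi> u" if "u \<noteq> 0" "u \<noteq> 1" for u
    unfolding F_def G_def \<phi>_def using kernel_num_quotient[OF that] .
  have cr: "u \<noteq> 0" "u \<noteq> 1" "u \<in> S" "u \<noteq> 1 \<and> cmod (u - 1) > \<epsilon>" if "cmod u = r" for u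
  proof -
    show "u \<noteq> 0" "u \<noteq> 1" "u \<in> S" using that r e R by (auto simp: S_def)
    have "cmod 1 \<le> cmod u + cmod (1 - u)" by (metis add.commute norm_triangle_sub)
    hence "cmod (u - 1) \<ge> 1 - r" using that by (simp add: norm_minus_commute)
    thus "u \<noteq> 1 \<and> cmod (u - 1) > \<epsilon>" using r \<open>u \<noteq> 1\<close> by linarith
  qed
  have inner: "contour_integral (circlepath 1 \<epsilon>) (\<lambda>w.
           (kernel_weight gp gm u * u powi x1 * (1 - u) ^ n1) /
           (kernel_weight gp gm w * w powi (1 + x2) * (1 - w) ^ n2) * (1 / (u - w)))
       = 2 * of_real pi * \<i> * (\<phi> u - F u * H u)" if u: "cmod u = r" for u
  proof -
    have pi: "path_image (circlepath 1 \<epsilon>) \<subseteq> - {0, 1, u}"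
      using r cr[OF u] by (auto simp: dist_norm norm_minus_commute)
    have w0: "winding_number (circlepath 1 \<epsilon>) v = 0" if "cmod (v - 1) > \<epsilon>" for v
      using that r by (intro winding_number_zero_outside[of _ "cball 1 \<epsilon>"]) (auto simp: dist_norm norm_minus_commute)
    have "contour_integral (circlepath 1 \<epsilon>) (\<lambda>w. G w / (w - u)) =
       2 * of_real pi * \<i> * residue (\<lambda>w. G w / (w - u)) 1"
      using r cr[OF u] w0[of u] w0[of 0]
      by (subst cauchy_kernel_residues[OF G _ _ _ _ pi]) (auto simp: winding_number_circlepath)
    also have "residue (\<lambda>w. G w / (w - u)) 1 = H u - G u" using H(2)[of u] cr[OF u] by simp
    finally have 1: "contour_integral (circlepath 1 \<epsilon>) (\<lambda>w. G w / (w - u)) = 2 * of_real pi * \<i> * (H u - G u)" .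
    have hol: "(\<lambda>w. G w / (w - u)) holomorphic_on - {0, 1, u}"
      by (intro holomorphic_intros holomorphic_on_subset[OF G]) auto
    have int: "(\<lambda>w. G w / (w - u)) contour_integrable_on circlepath 1 \<epsilon>"
      by (rule contour_integrable_holomorphic_simple[OF hol _ _ pi]) (auto intro: open_Compl finite_imp_closed)
    have "(\<lambda>w. (kernel_weight gp gm u * u powi x1 * (1 - u) ^ n1) /
           (kernel_weight gp gm w * w powi (1 + x2) * (1 - w) ^ n2) * (1 / (u - w)))
        = (\<lambda>w. - F u * (G w / (w - u)))"
    proof
      fix w
      have "1 / (u - w) = - (1 / (w - u))" by (metis minus_diff_eq minus_divide_right)
      thus "(kernel_weight gp gm u * u powi x1 * (1 - u) ^ n1) /
           (kernel_weight gp gm w * w powi (1 + x2) * (1 - w) ^ n2) * (1 / (u - w)) = - F u * (G w / (w - u))"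
        by (simp add: F_def G_def kernel_num_def divide_inverse)
    qed
    hence "contour_integral (circlepath 1 \<epsilon>) (\<lambda>w.
           (kernel_weight gp gm u * u powi x1 * (1 - u) ^ n1) /
           (kernel_weight gp gm w * w powi (1 + x2) * (1 - w) ^ n2) * (1 / (u - w)))
       = - F u * (2 * of_real pi * \<i> * (H u - G u))"
      using contour_integral_lmul[OF int, of "- F u"] 1 by simp
    also have "\<dots> = 2 * of_real pi * \<i> * (F u * G u - F u * H u)" by (simp add: algebra_simps)
    finally show ?thesis using FG cr[OF u] by simp
  qed
  have sph: "path_image (circlepath 0 r) \<subseteq> S" using cr(3) r by auto
  have \<phi>h: "\<phi> holomorphic_on S - {1}" unfolding \<phi>_def using S0 by (intro beta_integrand_holomorphic) auto
  have oS1: "open (S - {1})" using oS by (simp add: open_delete)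
  have sph1: "path_image (circlepath 0 r) \<subseteq> S - {1}" using cr r by auto
  have i\<phi>: "\<phi> contour_integrable_on circlepath 0 r"
    by (rule contour_integrable_holomorphic_simple[OF \<phi>h oS1 _ sph1]) auto
  have iFH: "(\<lambda>u. F u * H u) contour_integrable_on circlepath 0 r"
    by (rule contour_integrable_holomorphic_simple[OF _ oS _ sph]) (auto intro!: holomorphic_intros Fh H(1))
  have idiff: "(\<lambda>u. \<phi> u - F u * H u) contour_integrable_on circlepath 0 r"
    by (intro contour_integrable_diff i\<phi> iFH)
  have "contour_integral (circlepath 0 r) (\<lambda>u. contour_integral (circlepath 1 \<epsilon>) (\<lambda>w.
           (kernel_weight gp gm u * u powi x1 * (1 - u) ^ n1) /
           (kernel_weight gp gm w * w powi (1 + x2) * (1 - w) ^ n2) * (1 / (u - w))))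
      = contour_integral (circlepath 0 r) (\<lambda>u. 2 * of_real pi * \<i> * (\<phi> u - F u * H u))"
    using inner r by (intro contour_integral_eq) auto
  also have "\<dots> = 2 * of_real pi * \<i> * (contour_integral (circlepath 0 r) \<phi> - contour_integral (circlepath 0 r) (\<lambda>u. F u * H u))"
    using contour_integral_lmul[OF idiff] contour_integral_diff[OF i\<phi> iFH] by simp
  finally have dbl: "contour_integral (circlepath 0 r) (\<lambda>u. contour_integral (circlepath 1 \<epsilon>) (\<lambda>w.
           (kernel_weight gp gm u * u powi x1 * (1 - u) ^ n1) /
           (kernel_weight gp gm w * w powi (1 + x2) * (1 - w) ^ n2) * (1 / (u - w)))) = \<dots>" .
  have sgl: "contour_integral (circlepath 0 r) (\<lambda>z. z powi (x1 - x2 - 1) / (1 - z) ^ (n2 - n1))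
     = contour_integral (circlepath 0 r) \<phi>" if "n1 < n2"
  proof (rule contour_integral_eq)
    fix z assume "z \<in> path_image (circlepath 0 r)"
    have "int n1 - int n2 = - int (n2 - n1)" using that by simp
    hence "(1 - z) powi (int n1 - int n2) = inverse ((1 - z) ^ (n2 - n1))"
      by (simp only: power_int_minus power_int_of_nat)
    thus "z powi (x1 - x2 - 1) / (1 - z) ^ (n2 - n1) = \<phi> z"
      by (simp add: \<phi>_def beta_integrand_def divide_inverse)
  qed
  have Er: "contour_integral (circlepath 0 r) E = (if n1 < n2 then 0 else contour_integral (circlepath 0 r) \<phi>)
      - contour_integral (circlepath 0 r) (\<lambda>u. F u * H u)"
    unfolding E_def \<phi>_def[symmetric] using contour_integral_diff[OF i\<phi> iFH] contour_integral_neg[of "circlepath 0 r" "\<lambda>u. F u * H u"]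
    by simp
  have "plancherel_kernel r \<epsilon> gp gm n1 x1 n2 x2 = 1 / (2 * of_real pi * \<i>) * contour_integral (circlepath 0 r) E"
    unfolding plancherel_kernel_def dbl Er using sgl by (simp add: power2_eq_square field_simps)
  also have "contour_integral (circlepath 0 r) E = contour_integral (circlepath 0 \<rho>) E"
    using r \<rho> e R by (intro circle_integral_radius_indep[OF Eh oS]) (auto simp: S_def min_def max_def split: if_splits)
  finally have K: "plancherel_kernel r \<epsilon> gp gm n1 x1 n2 x2 = 1 / (2 * of_real pi * \<i>) * contour_integral (circlepath 0 \<rho>) E" .
  have "sphere 0 \<rho> \<subseteq> S" using e R by (auto simp: S_def)
  hence Hc: "continuous_on (sphere 0 \<rho>) H"
    using H(1) holomorphic_on_imp_continuous_on continuous_on_subset by blast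
  have "regular_part_on \<rho> G H"
    unfolding regular_part_on_def
  proof (intro conjI allI impI)
    fix u W assume u: "cmod u = \<rho>" "u \<noteq> 1" and W: "valid_path W" "pathfinish W = pathstart W" "path_image W \<subseteq> - {0, 1, u}"
    have "u \<noteq> 0" "u \<in> S" using u \<rho> e R by (auto simp: S_def)
    thus "contour_integral W (\<lambda>w. G w / (w - u)) = 2 * of_real pi * \<i> *
         (winding_number W u * G u + winding_number W 0 * residue (\<lambda>w. G w / (w - u)) 0
          + winding_number W 1 * (H u - G u))"
      using cauchy_kernel_residues[OF G _ u(2) W] H(2)[of u] u by simp
  qed (rule Hc)
  thus ?thesis using K unfolding E_def by blast
qed

section \<open>Uniform bounds away from the saddle\<close>

text \<open>Dividing the parameters by the exponent \<open>n\<close> makes this an exact power, so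
  that only its base has to be compared with a limit.\<close>

lemma norm_kernel_num:
  assumes "u \<noteq> 0" "n > 0"
  shows "cmod (kernel_num gp gm n x u) = saddle_mod (gp / n) (gm / n) (x / n) u ^ n"
proof -
  have "saddle_mod (gp / n) (gm / n) (x / n) u ^ n =
     exp (real n * (gm / n * Re u + gp / n * Re (inverse u))) * (cmod u powr (x / n)) ^ n * cmod (1 - u) ^ n"
    by (simp only: saddle_mod_def power_mult_distrib exp_of_nat_mult)
  also have "real n * (gm / n * Re u + gp / n * Re (inverse u)) = gm * Re u + gp * Re (inverse u)"
    using assms(2) by (simp add: field_simps)
  also have "(cmod u powr (x / n)) ^ n = cmod u powi x"
  proof -
    have "cmod u powr (x / n) > 0" using assms by simp
    hence "(cmod u powr (x / n)) ^ n = cmod u powr (x / n * n)"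
      by (metis powr_powr powr_realpow)
    also have "x / n * n = real_of_int x" using assms(2) by simp
    also have "cmod u powr real_of_int x = cmod u powi x"
      by (rule powr_real_of_int') (use assms in auto)
    finally show ?thesis .
  qed
  finally show ?thesis
    using assms by (simp add: kernel_num_def kernel_weight_def norm_mult norm_exp_eq_Re norm_power norm_power_int)
qed

text \<open>Integrals along a path are bounded by a bound on an open neighbourhood of it, integrands
  by compactness; \<open>S\<close> and \<open>K'\<close> serve the two.\<close>

lemma compact_open_between:
  fixes K :: "complex set"
  assumes "compact K" "open A" "K \<subseteq> A"
  obtains S K' where "open S" "compact K'" "K \<subseteq> S" "S \<subseteq> K'" "K' \<subseteq> A"
proof -
  obtain e where e: "e > 0" "(\<Union>x\<in>K. cball x e) \<subseteq> A"
    using compact_subset_open_imp_cball_epsilon_subset[OF assms] by blast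
  have "(\<Union>x\<in>K. cball x e) = (\<Union>x\<in>K. \<Union>y\<in>cball 0 e. {x + y})"
  proof (intro equalityI subsetI)
    fix z assume "z \<in> (\<Union>x\<in>K. cball x e)"
    then obtain x where "x \<in> K" "z \<in> cball x e" by blast
    thus "z \<in> (\<Union>x\<in>K. \<Union>y\<in>cball 0 e. {x + y})"
      by (intro UN_I[of x] UN_I[of "z - x"]) (auto simp: dist_norm norm_minus_commute)
  next
    fix z assume "z \<in> (\<Union>x\<in>K. \<Union>y\<in>cball 0 e. {x + y})"
    then obtain x y where "x \<in> K" "y \<in> cball 0 e" "z = x + y" by blast
    thus "z \<in> (\<Union>x\<in>K. cball x e)" by (intro UN_I[of x]) (auto simp: dist_norm)
  qed
  also have "compact \<dots>" by (rule compact_sums'[OF assms(1) compact_cball])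
  finally have "compact (\<Union>x\<in>K. cball x e)" .
  thus ?thesis using e
    by (intro that[of "\<Union>x\<in>K. ball x e" "\<Union>x\<in>K. cball x e"]) (auto, fastforce?)
qed

text \<open>The logarithm of the ratio is linear in the three parameter differences, with
  coefficients bounded on \<open>K\<close>. Only a factor \<eta> close to 1 is gained, which an
  \<open>n\<close>-th power may still blow up.\<close>

lemma saddle_mod_uniform:
  fixes aN bN cN :: "nat \<Rightarrow> real"
  assumes lim: "aN \<longlonglongrightarrow> a" "bN \<longlonglongrightarrow> b" "cN \<longlonglongrightarrow> c" and K: "compact K" "0 \<notin> K" and \<eta>: "\<eta> > 1"
  shows "\<forall>\<^sub>F N in sequentially. \<forall>u\<in>K. saddle_mod (aN N) (bN N) (cN N) u \<le> \<eta> * saddle_mod a b c u \<and>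
           saddle_mod a b c u \<le> \<eta> * saddle_mod (aN N) (bN N) (cN N) u"
proof -
  define f where "f = (\<lambda>u::complex. \<bar>Re u\<bar> + \<bar>Re (inverse u)\<bar> + \<bar>ln (cmod u)\<bar>)"
  have "continuous_on K f" unfolding f_def using K(2) by (intro continuous_intros) auto
  hence "compact (f ` K)" using K(1) compact_continuous_image by blast
  then obtain M where M: "M > 0" "\<And>u. u \<in> K \<Longrightarrow> f u \<le> M"
    using compact_imp_bounded bounded_pos by (metis abs_le_D1 imageI real_norm_def)
  have rel: "saddle_mod a' b' c' u = exp ((b' - b) * Re u + (a' - a) * Re (inverse u) + (c' - c) * ln (cmod u)) * saddle_mod a b c u"
    if "u \<noteq> 0" for a' b' c' u
  proof -
    define r where "r = Re (inverse u)"
    define t where "t = ln (cmod u)"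
    have "cmod u powr c' = exp ((c' - c) * t) * cmod u powr c"
      using that by (simp add: powr_def t_def exp_add[symmetric] algebra_simps)
    moreover have "exp (b' * Re u + a' * r) = exp ((b' - b) * Re u + (a' - a) * r) * exp (b * Re u + a * r)"
      by (simp add: exp_add[symmetric] algebra_simps)
    ultimately show ?thesis unfolding saddle_mod_def r_def[symmetric] t_def[symmetric]
      by (simp only: exp_add mult_ac)
  qed
  have "(\<lambda>N. M * (\<bar>bN N - b\<bar> + \<bar>aN N - a\<bar> + \<bar>cN N - c\<bar>)) \<longlonglongrightarrow> M * (\<bar>b - b\<bar> + \<bar>a - a\<bar> + \<bar>c - c\<bar>)"
    by (intro tendsto_intros lim)
  hence "\<forall>\<^sub>F N in sequentially. M * (\<bar>bN N - b\<bar> + \<bar>aN N - a\<bar> + \<bar>cN N - c\<bar>) < ln \<eta>"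
    using \<eta> by (intro order_tendstoD(2)) auto
  thus ?thesis
  proof (eventually_elim, intro ballI)
    case (elim N)
    fix u assume u: "u \<in> K"
    have u0: "u \<noteq> 0" using u K(2) by auto
    define X where "X = (bN N - b) * Re u + (aN N - a) * Re (inverse u) + (cN N - c) * ln (cmod u)"
    have parts: "\<bar>Re u\<bar> \<le> M" "\<bar>Re (inverse u)\<bar> \<le> M" "\<bar>ln (cmod u)\<bar> \<le> M" using M(2)[OF u] unfolding f_def by linarith+
    have "\<bar>X\<bar> \<le> \<bar>bN N - b\<bar> * \<bar>Re u\<bar> + \<bar>aN N - a\<bar> * \<bar>Re (inverse u)\<bar> + \<bar>cN N - c\<bar> * \<bar>ln (cmod u)\<bar>"
      unfolding X_def abs_mult[symmetric] by linarith
    also have "\<dots> \<le> \<bar>bN N - b\<bar> * M + \<bar>aN N - a\<bar> * M + \<bar>cN N - c\<bar> * M"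
      by (intro add_mono mult_left_mono parts) auto
    finally have "\<bar>X\<bar> < ln \<eta>" using elim by (simp add: algebra_simps)
    hence "X \<le> ln \<eta>" "- X \<le> ln \<eta>" by auto
    hence e: "exp X \<le> \<eta>" "exp (- X) \<le> \<eta>" using \<eta> by (metis exp_le_cancel_iff exp_ln less_trans zero_less_one)+
    have 1: "saddle_mod (aN N) (bN N) (cN N) u = exp X * saddle_mod a b c u" unfolding X_def by (rule rel[OF u0])
    have 2: "saddle_mod a b c u = exp (- X) * saddle_mod (aN N) (bN N) (cN N) u"
      unfolding 1 by (simp add: exp_minus)
    show "saddle_mod (aN N) (bN N) (cN N) u \<le> \<eta> * saddle_mod a b c u \<and>
           saddle_mod a b c u \<le> \<eta> * saddle_mod (aN N) (bN N) (cN N) u"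
    proof
      show "saddle_mod (aN N) (bN N) (cN N) u \<le> \<eta> * saddle_mod a b c u"
        unfolding 1 by (rule mult_right_mono[OF e(1) saddle_mod_nonneg])
      show "saddle_mod a b c u \<le> \<eta> * saddle_mod (aN N) (bN N) (cN N) u"
        by (subst 2) (rule mult_right_mono[OF e(2) saddle_mod_nonneg])
    qed
  qed
qed

text \<open>One entry of the matrix. All ratios are taken with respect to \<open>n N\<close>, the
  exponent of the modulus in \<open>norm_F\<close>; \<open>V\<close> is the limiting modulus and
  \<open>VN N\<close> the one at stage \<open>N\<close>.\<close>

locale kernel_scaling =
  fixes gp gm :: "nat \<Rightarrow> real" and n n' :: "nat \<Rightarrow> nat" and x x' :: "nat \<Rightarrow> int"
    and k l :: int and a b c :: real
  assumes n_pos: "\<And>N. n N > 0"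
    and n_diff: "\<And>N. int (n N) - int (n' N) = k" and x_diff: "\<And>N. x' N - x N = l"
    and n_lim: "filterlim n at_top sequentially"
    and a_lim: "(\<lambda>N. gp N / n N) \<longlonglongrightarrow> a" and b_lim: "(\<lambda>N. gm N / n N) \<longlonglongrightarrow> b"
    and c_lim: "(\<lambda>N. x N / n N) \<longlonglongrightarrow> c"
    and a_pos: "a > 0" and b_pos: "b > 0"
begin

abbreviation V where "V \<equiv> saddle_mod a b c"
abbreviation VN where "VN N \<equiv> saddle_mod (gp N / n N) (gm N / n N) (x N / n N)"
abbreviation F where "F N \<equiv> kernel_num (gp N) (gm N) (n N) (x N)"
definition G where "G N w = inverse (kernel_num (gp N) (gm N) (n' N) (1 + x' N) w)"
abbreviation \<phi> where "\<phi> \<equiv> beta_integrand k l"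

lemma norm_F: "u \<noteq> 0 \<Longrightarrow> cmod (F N u) = VN N u ^ n N"
  by (rule norm_kernel_num[OF _ n_pos])

lemma F_G: "u \<noteq> 0 \<Longrightarrow> u \<noteq> 1 \<Longrightarrow> F N u * G N u = \<phi> u"
  using kernel_num_quotient[of u "gp N" "gm N" "n N" "x N" "n' N" "x' N"] by (simp add: G_def n_diff x_diff)

text \<open>Through \<open>F N w * G N w = \<phi> w\<close> the denominator with its own
  \<open>n'\<close> and \<open>x'\<close> is measured by the same \<open>VN N\<close> as the
  numerator.\<close>

lemma norm_G: "w \<noteq> 0 \<Longrightarrow> w \<noteq> 1 \<Longrightarrow> cmod (G N w) = cmod (\<phi> w) / VN N w ^ n N"
proof -
  assume w: "w \<noteq> 0" "w \<noteq> 1"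
  have "VN N w ^ n N * cmod (G N w) = cmod (\<phi> w)"
    unfolding F_G[OF w, of N, symmetric] norm_mult norm_F[OF w(1)] ..
  moreover have "VN N w ^ n N > 0" using saddle_mod_pos[OF w] by simp
  ultimately show ?thesis by (metis nonzero_mult_div_cancel_left less_irrefl)
qed

lemma G_holomorphic: "0 \<notin> S \<Longrightarrow> 1 \<notin> S \<Longrightarrow> G N holomorphic_on S"
  unfolding G_def[abs_def] by (rule inverse_kernel_num_holomorphic)

lemma VN_uniform:
  assumes "compact K" "0 \<notin> K" "\<eta> > 1"
  shows "\<forall>\<^sub>F N in sequentially. \<forall>u\<in>K. VN N u \<le> \<eta> * V u \<and> V u \<le> \<eta> * VN N u"
  by (rule saddle_mod_uniform[OF a_lim b_lim c_lim assms])

text \<open>By compactness \<open>V\<close> exceeds \<open>V1\<close> on \<open>K'\<close> by a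
  fixed factor \<open>\<eta> > 1\<close>, which is spent on passing from \<open>V\<close> to
  \<open>VN N\<close> before the power is taken. The radius may move with \<open>N\<close> because
  \<open>K'\<close> keeps a positive distance from the limiting circle.\<close>

lemma far_pointwise:
  assumes K': "compact K'" "K' \<subseteq> {w. w \<noteq> 0 \<and> w \<noteq> 1 \<and> cmod w \<noteq> \<rho> \<and> V w > V1}" "K' \<noteq> {}"
    and V1: "V1 > 0" and \<rho>N: "\<rho>N \<longlonglongrightarrow> \<rho>"
  shows "\<exists>C\<ge>0. \<forall>\<^sub>F N in sequentially. \<forall>u. cmod u = \<rho>N N \<longrightarrow>
           (\<forall>w\<in>K'. w \<noteq> u \<and> cmod (G N w / (w - u)) \<le> C / V1 ^ n N)"
proof -
  have K0: "0 \<notin> K'" "1 \<notin> K'" using K'(2) by auto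
  have "continuous_on K' V" by (rule continuous_on_saddle_mod[OF K0(1)])
  then obtain w1 where w1: "w1 \<in> K'" "\<And>w. w \<in> K' \<Longrightarrow> V w1 \<le> V w"
    using continuous_attains_inf[OF K'(1,3)] by blast
  define \<eta> where "\<eta> = V w1 / V1"
  have \<eta>: "\<eta> > 1" "\<And>w. w \<in> K' \<Longrightarrow> V w \<ge> \<eta> * V1"
    using w1 K'(2) V1 by (auto simp: \<eta>_def)
  have "continuous_on K' (\<lambda>w. \<bar>cmod w - \<rho>\<bar>)" by (intro continuous_intros)
  then obtain w2 where w2: "w2 \<in> K'" "\<And>w. w \<in> K' \<Longrightarrow> \<bar>cmod w2 - \<rho>\<bar> \<le> \<bar>cmod w - \<rho>\<bar>"
    using continuous_attains_inf[OF K'(1,3)] by blast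
  define \<delta> where "\<delta> = \<bar>cmod w2 - \<rho>\<bar> / 2"
  have \<delta>: "\<delta> > 0" "\<And>w. w \<in> K' \<Longrightarrow> \<bar>cmod w - \<rho>\<bar> \<ge> 2 * \<delta>"
    using w2 K'(2) by (auto simp: \<delta>_def)
  have "continuous_on K' \<phi>"
    by (intro holomorphic_on_imp_continuous_on beta_integrand_holomorphic) (use K0 in auto)
  hence "continuous_on K' (\<lambda>w. cmod (\<phi> w))" by (intro continuous_intros)
  then obtain w3 where w3: "w3 \<in> K'" "\<And>w. w \<in> K' \<Longrightarrow> cmod (\<phi> w) \<le> cmod (\<phi> w3)"
    using continuous_attains_sup[OF K'(1,3)] by blast
  define M where "M = cmod (\<phi> w3)"
  have "\<forall>\<^sub>F N in sequentially. \<bar>\<rho>N N - \<rho>\<bar> < \<delta>"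
    using tendstoD[OF \<rho>N \<delta>(1)] by (simp add: dist_real_def)
  moreover note VN_uniform[OF K'(1) K0(1) \<eta>(1)]
  ultimately have "\<forall>\<^sub>F N in sequentially. \<forall>u. cmod u = \<rho>N N \<longrightarrow>
           (\<forall>w\<in>K'. w \<noteq> u \<and> cmod (G N w / (w - u)) \<le> (M / \<delta>) / V1 ^ n N)"
  proof (eventually_elim, intro allI impI ballI)
    case (elim N)
    fix u w assume u: "cmod u = \<rho>N N" and wK: "w \<in> K'"
    have "\<bar>cmod w - cmod u\<bar> \<le> cmod (w - u)" by (rule norm_triangle_ineq3)
    hence d: "cmod (w - u) \<ge> \<delta>" using \<delta>(2)[OF wK] elim(1) u by linarith
    hence "w \<noteq> u" using \<delta>(1) by auto
    have w: "w \<noteq> 0" "w \<noteq> 1" using wK K0 by auto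
    have "\<eta> * V1 \<le> \<eta> * VN N w" using \<eta>(2)[OF wK] elim(2) wK by force
    hence "V1 \<le> VN N w" using \<eta>(1) by simp
    hence pw: "V1 ^ n N \<le> VN N w ^ n N" using V1 by (intro power_mono) auto
    have "cmod (G N w / (w - u)) = cmod (\<phi> w) / (VN N w ^ n N * cmod (w - u))"
      by (simp add: norm_divide norm_G[OF w])
    also have "\<dots> \<le> M / (V1 ^ n N * \<delta>)"
      using w3(2)[OF wK] pw d V1 \<delta>(1) unfolding M_def by (intro frac_le mult_mono) auto
    finally show "w \<noteq> u \<and> cmod (G N w / (w - u)) \<le> (M / \<delta>) / V1 ^ n N"
      using \<open>w \<noteq> u\<close> by (simp add: mult.commute)
  qed
  moreover have "M / \<delta> \<ge> 0" using \<delta>(1) by (simp add: M_def)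
  ultimately show ?thesis by blast
qed

lemma open_far_set: "open {w. w \<noteq> 0 \<and> w \<noteq> 1 \<and> cmod w \<noteq> \<rho> \<and> V w > V1}"
proof -
  define B where "B = {w::complex. w \<noteq> 0 \<and> w \<noteq> 1 \<and> cmod w \<noteq> \<rho>}"
  have "open B" unfolding B_def by (intro open_Collect_conj open_Collect_neq continuous_intros)
  hence "open (B \<inter> V -` {V1<..})"
    by (intro continuous_open_preimage continuous_on_saddle_mod) (auto simp: B_def)
  also have "B \<inter> V -` {V1<..} = {w. w \<noteq> 0 \<and> w \<noteq> 1 \<and> cmod w \<noteq> \<rho> \<and> V w > V1}" by (auto simp: B_def)
  finally show ?thesis .
qed

lemma far_bound:
  assumes g: "valid_path g" "path_image g \<subseteq> {w. w \<noteq> 0 \<and> w \<noteq> 1 \<and> cmod w \<noteq> \<rho> \<and> V w > V1}"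
    and V1: "V1 > 0" and \<rho>N: "\<rho>N \<longlonglongrightarrow> \<rho>"
  shows "\<exists>C\<ge>0. \<forall>\<^sub>F N in sequentially. \<forall>u. cmod u = \<rho>N N \<longrightarrow>
           cmod (contour_integral g (\<lambda>w. G N w / (w - u))) \<le> C / V1 ^ n N"
proof -
  obtain S K' where S: "open S" "compact K'" "path_image g \<subseteq> S" "S \<subseteq> K'"
    "K' \<subseteq> {w. w \<noteq> 0 \<and> w \<noteq> 1 \<and> cmod w \<noteq> \<rho> \<and> V w > V1}"
    by (rule compact_open_between[OF compact_valid_path_image[OF g(1)] open_far_set g(2)])
  obtain L where L: "L > 0" "\<And>f B. f holomorphic_on S \<Longrightarrow> (\<forall>z\<in>S. cmod (f z) \<le> B) \<Longrightarrow> cmod (contour_integral g f) \<le> L * B"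
    using contour_integral_bound_exists[OF S(1) g(1) S(3)] by blast
  have ne: "K' \<noteq> {}" using S(3,4) path_image_nonempty by blast
  obtain C where C: "C \<ge> 0" "\<forall>\<^sub>F N in sequentially. \<forall>u. cmod u = \<rho>N N \<longrightarrow>
           (\<forall>w\<in>K'. w \<noteq> u \<and> cmod (G N w / (w - u)) \<le> C / V1 ^ n N)"
    using far_pointwise[OF S(2,5) ne V1 \<rho>N] by blast
  from C(2) have "\<forall>\<^sub>F N in sequentially. \<forall>u. cmod u = \<rho>N N \<longrightarrow>
           cmod (contour_integral g (\<lambda>w. G N w / (w - u))) \<le> (L * C) / V1 ^ n N"
  proof (eventually_elim, intro allI impI)
    case (elim N)
    fix u assume u: "cmod u = \<rho>N N"
    have K0: "0 \<notin> S" "1 \<notin> S" using S(4,5) by auto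
    have "cmod (contour_integral g (\<lambda>w. G N w / (w - u))) \<le> L * (C / V1 ^ n N)"
    proof (rule L(2))
      have "w \<noteq> u" if "w \<in> S" for w using elim u that S(4) by blast
      thus "(\<lambda>w. G N w / (w - u)) holomorphic_on S"
        using K0 by (intro holomorphic_intros G_holomorphic) auto
      show "\<forall>w\<in>S. cmod (G N w / (w - u)) \<le> C / V1 ^ n N" using elim u S(4) by blast
    qed
    thus "cmod (contour_integral g (\<lambda>w. G N w / (w - u))) \<le> (L * C) / V1 ^ n N" by simp
  qed
  moreover have "L * C \<ge> 0" using L(1) C(1) by simp
  ultimately show ?thesis by blast
qed

text \<open>The strict gap between the level \<open>V0\<close> on the circle and \<open>V1\<close>
  on the path yields geometric decay.\<close>

lemma far_bound_times_F:
  assumes g: "valid_path g" "path_image g \<subseteq> {w. w \<noteq> 0 \<and> w \<noteq> 1 \<and> cmod w \<noteq> \<rho> \<and> V w > V1}"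
    and \<rho>: "\<rho> > 0" and V0: "\<forall>u. cmod u = \<rho> \<longrightarrow> V u \<le> V0" "V0 > 0" "V0 < V1"
    and d: "d > 0"
  shows "\<forall>\<^sub>F N in sequentially. \<forall>u. cmod u = \<rho> \<longrightarrow>
           cmod (F N u * contour_integral g (\<lambda>w. G N w / (w - u))) \<le> d"
proof -
  have V1: "V1 > 0" using V0 by linarith
  obtain C where C: "C \<ge> 0" "\<forall>\<^sub>F N in sequentially. \<forall>u. cmod u = \<rho> \<longrightarrow>
           cmod (contour_integral g (\<lambda>w. G N w / (w - u))) \<le> C / V1 ^ n N"
    using far_bound[OF g V1 tendsto_const] by blast
  \<comment> \<open>Half of the gap, on the logarithmic scale, pays for replacing \<open>V\<close>
    by \<open>VN N\<close>; the other half is the ratio \<open>q < 1\<close>.\<close>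
  define \<eta> where "\<eta> = sqrt (V1 / V0)"
  define q where "q = 1 / \<eta>"
  have \<eta>: "\<eta> > 1" using V0 by (simp add: \<eta>_def)
  have \<eta>2: "\<eta> * V0 / V1 = q"
  proof -
    have "\<eta> * \<eta> = V1 / V0" using V0 by (simp add: \<eta>_def)
    thus ?thesis using V0 \<eta> by (simp add: q_def field_simps)
  qed
  have "0 < q" "q < 1" using \<eta> by (auto simp: q_def)
  hence "(\<lambda>m. C * q ^ m) \<longlonglongrightarrow> C * 0" by (intro tendsto_intros LIMSEQ_power_zero) auto
  from filterlim_compose[OF this n_lim] have "(\<lambda>N. C * q ^ n N) \<longlonglongrightarrow> 0" by simp
  hence "\<forall>\<^sub>F N in sequentially. C * q ^ n N < d" using d by (rule order_tendstoD(2))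
  moreover have "\<forall>\<^sub>F N in sequentially. \<forall>u\<in>sphere 0 \<rho>. VN N u \<le> \<eta> * V u \<and> V u \<le> \<eta> * VN N u"
    using \<rho> \<eta> by (intro VN_uniform) auto
  ultimately show ?thesis using C(2)
  proof (eventually_elim, intro allI impI)
    case (elim N)
    fix u assume u: "cmod u = \<rho>"
    have u0: "u \<noteq> 0" using u \<rho> by auto
    have "VN N u \<le> \<eta> * V u" using elim(2) u by simp
    also have "\<dots> \<le> \<eta> * V0" using V0(1) u \<eta> by (intro mult_left_mono) auto
    finally have "VN N u ^ n N \<le> (\<eta> * V0) ^ n N" by (intro power_mono) auto
    hence "cmod (F N u * contour_integral g (\<lambda>w. G N w / (w - u))) \<le> (\<eta> * V0) ^ n N * (C / V1 ^ n N)"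
      unfolding norm_mult norm_F[OF u0] using elim(3) u \<eta> V0 by (intro mult_mono) auto
    also have "\<dots> = C * (\<eta> * V0 / V1) ^ n N" by (simp add: power_divide)
    also have "\<dots> \<le> d" using elim(1) \<eta>2 by simp
    finally show "cmod (F N u * contour_integral g (\<lambda>w. G N w / (w - u))) \<le> d" .
  qed
qed

end

lemma circle_integral_error:
  assumes "\<rho> > 0" "continuous_on (sphere 0 \<rho>) E" "continuous_on (sphere 0 \<rho>) \<psi>" "\<delta> \<ge> 0"
    and le: "\<And>u. cmod u = \<rho> \<Longrightarrow> cmod (E u - \<psi> u) \<le> \<delta>"
  shows "cmod (1 / (2 * of_real pi * \<i>) * contour_integral (circlepath 0 \<rho>) E
           - 1 / (2 * of_real pi * \<i>) * contour_integral (circlepath 0 \<rho>) \<psi>) \<le> \<delta> * \<rho>"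
proof -
  have i: "E contour_integrable_on circlepath 0 \<rho>" "\<psi> contour_integrable_on circlepath 0 \<rho>"
    using assms(1-3) by (auto intro!: contour_integrable_continuous_circlepath)
  have d: "((\<lambda>u. E u - \<psi> u) has_contour_integral
      contour_integral (circlepath 0 \<rho>) E - contour_integral (circlepath 0 \<rho>) \<psi>) (circlepath 0 \<rho>)"
    using i by (intro has_contour_integral_diff has_contour_integral_integral)
  have "cmod (contour_integral (circlepath 0 \<rho>) E - contour_integral (circlepath 0 \<rho>) \<psi>) \<le> \<delta> * (2 * pi * \<rho>)"
    by (rule has_contour_integral_bound_circlepath[OF d assms(4,1)]) (use le in simp)
  moreover have "cmod (1 / (2 * of_real pi * \<i>) * contour_integral (circlepath 0 \<rho>) E
           - 1 / (2 * of_real pi * \<i>) * contour_integral (circlepath 0 \<rho>) \<psi>)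
      = cmod (contour_integral (circlepath 0 \<rho>) E - contour_integral (circlepath 0 \<rho>) \<psi>) / (2 * pi)"
    unfolding right_diff_distrib[symmetric] norm_mult by (simp add: norm_divide norm_mult)
  ultimately show ?thesis using pi_gt_zero by (simp only: divide_le_eq mult_ac) simp
qed

lemma connected_sphere_complex: "connected (sphere (0::complex) \<rho>)"
  by (rule connected_sphere) simp

context kernel_scaling
begin

abbreviation K where
  "K r \<epsilon> N \<equiv> plancherel_kernel r \<epsilon> (gp N) (gm N) (n N) (x N) (n' N) (x' N)"

lemma kernel_circle:
  assumes r: "0 < r" "r < 1" "0 < \<epsilon>" "\<epsilon> < 1 - r" and \<rho>: "\<rho> > 0"
  shows "\<exists>H. regular_part_on \<rho> (G N) H \<and> K r \<epsilon> N = 1 / (2 * of_real pi * \<i>) *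
       contour_integral (circlepath 0 \<rho>) (\<lambda>u. (if k < 0 then 0 else \<phi> u) - F N u * H u)"
proof -
  have lt: "n N < n' N \<longleftrightarrow> k < 0" using n_diff[of N] by auto
  show ?thesis
    using plancherel_kernel_circle[OF r \<rho>, of "gp N" "gm N" "n' N" "x' N" "n N" "x N"]
    unfolding lt n_diff x_diff G_def[abs_def] .
qed

lemma continuous_on_F: "\<rho> > 0 \<Longrightarrow> continuous_on (sphere 0 \<rho>) (F N)"
  by (intro holomorphic_on_imp_continuous_on kernel_num_holomorphic) auto

text \<open>The point 1 is avoided automatically, since \<open>V\<close> vanishes there while the
  path stays above \<open>V1 > 0\<close>.\<close>

lemma sym_loop_region:
  assumes "path_image g \<subseteq> {w. cmod w \<noteq> \<rho> \<and> V w > V1}"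
    and g: "upper_path p1 p2 g" "p1 \<noteq> 0" "p2 \<noteq> 0" and V1: "V1 > 0"
  shows "path_image (sym_loop g) \<subseteq> {w. w \<noteq> 0 \<and> w \<noteq> 1 \<and> cmod w \<noteq> \<rho> \<and> V w > V1}"
proof -
  have "w \<noteq> 0 \<and> w \<noteq> 1" if w: "w \<in> path_image g" for w
  proof -
    have "w \<noteq> 0" using that g by (auto simp: upper_path_def)
    moreover have "V w > 0" using that assms(1) V1 by force
    hence "w \<noteq> 1" by (auto simp: saddle_mod_def)
    ultimately show ?thesis by simp
  qed
  thus ?thesis using assms(1) unfolding sym_loop_props(3)[OF g(1)] by force
qed

text \<open>The loop winds around 1 but neither around 0 nor around the points of the circle, so its
  integral is \<open>H - G\<close> up to the factor \<open>2 * pi * \<i>\<close>. That this times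
  \<open>F\<close> tends to 0 means that \<open>F * H\<close> may be replaced by
  \<open>\<phi>\<close>.\<close>

lemma limit_outside:
  assumes r: "0 < r" "r < 1" "0 < \<epsilon>" "\<epsilon> < 1 - r" and \<rho>: "\<rho> > 0"
    and V0: "\<forall>u. cmod u = \<rho> \<longrightarrow> V u \<le> V0" "V0 > 0" "V0 < V1"
    and g: "upper_path p1 p2 g" "path_image g \<subseteq> {w. cmod w \<noteq> \<rho> \<and> V w > V1}"
    and p: "0 < p1" "p1 < 1" "1 < p2" "\<rho> < p1 \<or> p2 < \<rho>"
  shows "K r \<epsilon> \<longlonglongrightarrow> 1 / (2 * of_real pi * \<i>) *
           contour_integral (circlepath 0 \<rho>) (\<lambda>u. if k < 0 then - \<phi> u else 0)"
proof (rule tendstoI)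
  fix e :: real assume e: "e > 0"
  define W where "W = sym_loop g"
  define \<psi> where "\<psi> = (\<lambda>u. if k < 0 then - \<phi> u else 0)"
  have V1: "V1 > 0" using V0 by linarith
  have W: "valid_path W" "pathfinish W = pathstart W" using sym_loop_props[OF g(1)] by (auto simp: W_def)
  have WI: "path_image W \<subseteq> {w. w \<noteq> 0 \<and> w \<noteq> 1 \<and> cmod w \<noteq> \<rho> \<and> V w > V1}"
    unfolding W_def using sym_loop_region[OF g(2,1) _ _ V1] p by auto
  have w0: "winding_number W 0 = 0" using winding_sym_loop_real[OF g(1), of 0] p by (simp add: W_def)
  have w1: "winding_number W 1 = 1" using winding_sym_loop_real[OF g(1), of 1] p by (simp add: W_def)
  have disj: "sphere 0 \<rho> \<inter> path_image W = {}" using WI by auto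
  have wu: "winding_number W u = 0" if "cmod u = \<rho>" for u
    using winding_sym_loop[OF g(1), of \<rho> "sphere 0 \<rho>" u] p \<rho> that disj connected_sphere_complex
    by (auto simp: W_def)
  have u01: "u \<noteq> 0 \<and> u \<noteq> 1" if "cmod u = \<rho>" for u using that p \<rho> by auto
  have sph: "0 \<notin> sphere (0::complex) \<rho>" "1 \<notin> sphere (0::complex) \<rho>" using p \<rho> by auto
  have \<phi>c: "continuous_on (sphere 0 \<rho>) \<phi>"
    using sph by (intro holomorphic_on_imp_continuous_on beta_integrand_holomorphic) auto
  have d: "e / (2 * \<rho>) > 0" using e \<rho> by simp
  from far_bound_times_F[OF W(1) WI \<rho> V0 d]
  show "\<forall>\<^sub>F N in sequentially. dist (K r \<epsilon> N) (1 / (2 * of_real pi * \<i>) *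
           contour_integral (circlepath 0 \<rho>) (\<lambda>u. if k < 0 then - \<phi> u else 0)) < e"
    unfolding \<psi>_def[symmetric]
  proof eventually_elim
    case (elim N)
    obtain H where H: "regular_part_on \<rho> (G N) H"
      and KN: "K r \<epsilon> N = 1 / (2 * of_real pi * \<i>) *
         contour_integral (circlepath 0 \<rho>) (\<lambda>u. (if k < 0 then 0 else \<phi> u) - F N u * H u)"
      using kernel_circle[OF r \<rho>, of N] by blast
    note Hc = regular_part_onD(1)[OF H] continuous_on_F[OF \<rho>] and res = regular_part_onD(2)[OF H]
    have "cmod (K r \<epsilon> N - 1 / (2 * of_real pi * \<i>) * contour_integral (circlepath 0 \<rho>) \<psi>) \<le> e / (2 * \<rho>) * \<rho>"
      unfolding KN
    proof (rule circle_integral_error[OF \<rho>])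
      show "continuous_on (sphere 0 \<rho>) (\<lambda>u. (if k < 0 then 0 else \<phi> u) - F N u * H u)"
        by (cases "k < 0") (auto intro!: continuous_intros Hc \<phi>c)
      show "continuous_on (sphere 0 \<rho>) \<psi>"
        unfolding \<psi>_def by (cases "k < 0") (auto intro!: continuous_intros \<phi>c)
      fix u assume u: "cmod u = \<rho>"
      have "F N u * contour_integral W (\<lambda>w. G N w / (w - u)) = 2 * of_real pi * \<i> * (F N u * H u - F N u * G N u)"
        using WI u01[OF u] u by (subst res[OF u _ W]) (auto simp: wu[OF u] w0 w1 algebra_simps)
      also have "F N u * G N u = \<phi> u" using F_G u01[OF u] by blast
      finally have "cmod (F N u * contour_integral W (\<lambda>w. G N w / (w - u))) = 2 * pi * cmod (F N u * H u - \<phi> u)"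
        by (simp add: norm_mult)
      hence "2 * pi * cmod (F N u * H u - \<phi> u) \<le> e / (2 * \<rho>)" using elim u by metis
      moreover have "1 * cmod (F N u * H u - \<phi> u) \<le> 2 * pi * cmod (F N u * H u - \<phi> u)"
        using pi_gt3 by (intro mult_right_mono) auto
      moreover have "cmod ((if k < 0 then 0 else \<phi> u) - F N u * H u - \<psi> u) = cmod (F N u * H u - \<phi> u)"
        by (simp add: \<psi>_def norm_minus_commute)
      ultimately show "cmod ((if k < 0 then 0 else \<phi> u) - F N u * H u - \<psi> u) \<le> e / (2 * \<rho>)" by linarith
    qed (use e \<rho> in auto)
    thus "dist (K r \<epsilon> N) (1 / (2 * of_real pi * \<i>) * contour_integral (circlepath 0 \<rho>) \<psi>) < e"
      using e \<rho> by (simp add: dist_norm)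
  qed
qed

text \<open>The outer loop winds around 0, 1 and the points of the circle, the inner one around 0
  alone. In the difference the residue at 0 drops out and \<open>H\<close> remains, so that
  \<open>F * H\<close> tends to 0.\<close>

lemma limit_between:
  assumes r: "0 < r" "r < 1" "0 < \<epsilon>" "\<epsilon> < 1 - r" and \<rho>: "\<rho> > 0"
    and V0: "\<forall>u. cmod u = \<rho> \<longrightarrow> V u \<le> V0" "V0 > 0" "V0 < V1"
    and g: "upper_path p1 p2 g" "path_image g \<subseteq> {w. cmod w \<noteq> \<rho> \<and> V w > V1}"
    and p: "p1 < -\<rho>" "1 < p2" "\<rho> < p2"
    and h: "upper_path q1 q2 h" "path_image h \<subseteq> {w. cmod w \<noteq> \<rho> \<and> V w > V1}"
    and q: "-\<rho> < q1" "q1 < 0" "0 < q2" "q2 < 1" "q2 < \<rho>"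
  shows "K r \<epsilon> \<longlonglongrightarrow> 1 / (2 * of_real pi * \<i>) *
           contour_integral (circlepath 0 \<rho>) (\<lambda>u. if k < 0 then 0 else \<phi> u)"
proof (rule tendstoI)
  fix e :: real assume e: "e > 0"
  define W where "W = sym_loop g"
  define W' where "W' = sym_loop h"
  define \<psi> where "\<psi> = (\<lambda>u. if k < 0 then 0 else \<phi> u)"
  have V1: "V1 > 0" using V0 by linarith
  have W: "valid_path W" "pathfinish W = pathstart W" using sym_loop_props[OF g(1)] by (auto simp: W_def)
  have W': "valid_path W'" "pathfinish W' = pathstart W'" using sym_loop_props[OF h(1)] by (auto simp: W'_def)
  have WI: "path_image W \<subseteq> {w. w \<noteq> 0 \<and> w \<noteq> 1 \<and> cmod w \<noteq> \<rho> \<and> V w > V1}"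
    unfolding W_def using sym_loop_region[OF g(2,1) _ _ V1] p \<rho> by auto
  have WI': "path_image W' \<subseteq> {w. w \<noteq> 0 \<and> w \<noteq> 1 \<and> cmod w \<noteq> \<rho> \<and> V w > V1}"
    unfolding W'_def using sym_loop_region[OF h(2,1) _ _ V1] q by auto
  have w0: "winding_number W 0 = 1" using winding_sym_loop_real[OF g(1), of 0] p \<rho> by (simp add: W_def)
  have w1: "winding_number W 1 = 1" using winding_sym_loop_real[OF g(1), of 1] p \<rho> by (simp add: W_def)
  have w0': "winding_number W' 0 = 1" using winding_sym_loop_real[OF h(1), of 0] q by (simp add: W'_def)
  have w1': "winding_number W' 1 = 0" using winding_sym_loop_real[OF h(1), of 1] q by (simp add: W'_def)
  have disj: "sphere 0 \<rho> \<inter> path_image W = {}" "sphere 0 \<rho> \<inter> path_image W' = {}" using WI WI' by auto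
  have wu: "winding_number W u = 1" if "cmod u = \<rho>" for u
    using winding_sym_loop[OF g(1), of \<rho> "sphere 0 \<rho>" u] p \<rho> that disj connected_sphere_complex
    by (auto simp: W_def)
  have wu': "winding_number W' u = 0" if "cmod u = \<rho>" for u
    using winding_sym_loop[OF h(1), of \<rho> "sphere 0 \<rho>" u] q \<rho> that disj connected_sphere_complex
    by (auto simp: W'_def)
  have \<phi>c: "continuous_on (sphere 0 \<rho>) \<phi>" if "k \<ge> 0"
    using \<rho> that by (intro holomorphic_on_imp_continuous_on beta_integrand_holomorphic) auto
  have d: "e / (4 * \<rho>) > 0" using e \<rho> by simp
  from far_bound_times_F[OF W(1) WI \<rho> V0 d]
    far_bound_times_F[OF W'(1) WI' \<rho> V0 d]
  show "\<forall>\<^sub>F N in sequentially. dist (K r \<epsilon> N) (1 / (2 * of_real pi * \<i>) *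
           contour_integral (circlepath 0 \<rho>) (\<lambda>u. if k < 0 then 0 else \<phi> u)) < e"
    unfolding \<psi>_def[symmetric]
  proof eventually_elim
    case (elim N)
    obtain H where H: "regular_part_on \<rho> (G N) H"
      and KN: "K r \<epsilon> N = 1 / (2 * of_real pi * \<i>) *
         contour_integral (circlepath 0 \<rho>) (\<lambda>u. (if k < 0 then 0 else \<phi> u) - F N u * H u)"
      using kernel_circle[OF r \<rho>, of N] by blast
    note Hc = regular_part_onD(1)[OF H] continuous_on_F[OF \<rho>] and res = regular_part_onD(2)[OF H]
    have "cmod (K r \<epsilon> N - 1 / (2 * of_real pi * \<i>) * contour_integral (circlepath 0 \<rho>) \<psi>) \<le> e / (2 * \<rho>) * \<rho>"
      unfolding KN
    proof (rule circle_integral_error[OF \<rho>])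
      show "continuous_on (sphere 0 \<rho>) (\<lambda>u. (if k < 0 then 0 else \<phi> u) - F N u * H u)"
        by (cases "k < 0") (auto intro!: continuous_intros Hc \<phi>c)
      show "continuous_on (sphere 0 \<rho>) \<psi>"
        unfolding \<psi>_def by (cases "k < 0") (auto intro!: continuous_intros \<phi>c)
      fix u assume u: "cmod u = \<rho>"
      have "cmod (F N u * H u) \<le> e / (2 * \<rho>)"
      proof (cases "u = 1")
        case True
        hence "F N u = 0" using kernel_num_eq_0_iff[of u "n N"] n_pos[of N] by simp
        thus ?thesis using e \<rho> by simp
      next
        case False
        let ?I = "F N u * contour_integral W (\<lambda>w. G N w / (w - u))"
        let ?J = "F N u * contour_integral W' (\<lambda>w. G N w / (w - u))"
        have "contour_integral W (\<lambda>w. G N w / (w - u)) - contour_integral W' (\<lambda>w. G N w / (w - u))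
            = 2 * of_real pi * \<i> * H u"
        proof -
          have "path_image W \<subseteq> - {0, 1, u}" "path_image W' \<subseteq> - {0, 1, u}" using WI WI' u by auto
          note R = res[OF u False W this(1)] res[OF u False W' this(2)]
          show ?thesis unfolding R wu[OF u] wu'[OF u] w0 w1 w0' w1' by (simp add: algebra_simps)
        qed
        hence eq: "2 * of_real pi * \<i> * (F N u * H u) = ?I - ?J"
          by (simp only: right_diff_distrib[symmetric] mult.left_commute[of "F N u"])
        have "2 * pi * cmod (F N u * H u) = cmod (2 * of_real pi * \<i> * (F N u * H u))"
          by (simp add: norm_mult)
        also have "\<dots> \<le> cmod ?I + cmod ?J" unfolding eq by (rule norm_triangle_ineq4)
        also have "\<dots> \<le> e / (4 * \<rho>) + e / (4 * \<rho>)" using elim u by (intro add_mono) auto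
        finally have "2 * pi * cmod (F N u * H u) \<le> e / (2 * \<rho>)" by simp
        moreover have "1 * cmod (F N u * H u) \<le> 2 * pi * cmod (F N u * H u)"
          using pi_gt3 by (intro mult_right_mono) auto
        ultimately show ?thesis by linarith
      qed
      thus "cmod ((if k < 0 then 0 else \<phi> u) - F N u * H u - \<psi> u) \<le> e / (2 * \<rho>)" by (simp add: \<psi>_def)
    qed (use e \<rho> in auto)
    thus "dist (K r \<epsilon> N) (1 / (2 * of_real pi * \<i>) * contour_integral (circlepath 0 \<rho>) \<psi>) < e"
      using e \<rho> by (simp add: dist_norm)
  qed
qed

end

section \<open>Real saddle points\<close>

text \<open>With \<open>t = Re u\<close>, the logarithm of the squared modulus is
  \<open>2 * B * t + ln (1 - 2 * t + s^2)\<close> up to a constant, which is concave; the assumption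
  says that its derivative at the right end \<open>t = s\<close> is nonnegative. The inequality
  \<open>1 + y \<le> exp y\<close> is the tangent bound in multiplicative form.\<close>

lemma saddle_mod_circle_max_pos:
  assumes s: "s > 0" "s \<noteq> 1" "(b + a / s\<^sup>2) * (1 - s)\<^sup>2 \<ge> 1" and u: "cmod u = s"
  shows "saddle_mod a b c u \<le> saddle_mod a b c (of_real s)"
proof -
  define B where "B = b + a / s\<^sup>2"
  have t: "Re u \<le> s" using u complex_Re_le_cmod[of u] by simp
  have y0: "(1 - s)\<^sup>2 > 0" using s by simp
  have Bge: "1 / (1 - s)\<^sup>2 \<le> B" using s(3) y0 by (simp add: B_def field_simps)
  have sq: "(saddle_mod a b c v)\<^sup>2 = exp (2 * B * Re v) * s powr (2 * c) * (1 - 2 * Re v + s\<^sup>2)"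
    if "cmod v = s" for v
    using that s saddle_mod_sq[of v a b c] by (auto simp: B_def cmod_one_minus_sq)
  have "1 - 2 * Re u + s\<^sup>2 = (1 - s)\<^sup>2 + 2 * (s - Re u)"
    by (simp add: power2_eq_square algebra_simps)
  also have "\<dots> = (1 - s)\<^sup>2 * (1 + 2 * (s - Re u) * (1 / (1 - s)\<^sup>2))"
    using y0 by (simp only: distrib_left) simp
  also have "\<dots> \<le> (1 - s)\<^sup>2 * (1 + 2 * (s - Re u) * B)"
    using Bge t by (intro mult_left_mono add_left_mono) auto
  also have "\<dots> \<le> (1 - s)\<^sup>2 * exp (2 * (s - Re u) * B)"
    using exp_ge_add_one_self[of "2 * (s - Re u) * B"] by (intro mult_left_mono) auto
  finally have "exp (2 * B * Re u) * (1 - 2 * Re u + s\<^sup>2) \<le> exp (2 * B * Re u) * ((1 - s)\<^sup>2 * exp (2 * (s - Re u) * B))"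
    by (intro mult_left_mono) auto
  also have "\<dots> = exp (2 * B * Re u + (2 * (s - Re u) * B)) * (1 - s)\<^sup>2"
    unfolding exp_add by (simp only: mult_ac)
  also have "2 * B * Re u + (2 * (s - Re u) * B) = 2 * B * s" by (simp add: algebra_simps)
  also have "(1 - s)\<^sup>2 = 1 - 2 * s + s\<^sup>2" by (simp add: power2_eq_square algebra_simps)
  finally have "(saddle_mod a b c u)\<^sup>2 \<le> (saddle_mod a b c (of_real s))\<^sup>2"
    using sq[OF u] sq[of "of_real s"] s mult_left_mono[of "exp (2 * B * Re u) * (1 - 2 * Re u + s\<^sup>2)" "exp (2 * B * s) * (1 - 2 * s + s\<^sup>2)" "s powr (2 * c)"]
    by (simp add: mult_ac)
  thus ?thesis by (rule power2_le_imp_le) simp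
qed

text \<open>The same concave function; now its derivative at the left end \<open>t = - s\<close> is
  nonpositive.\<close>

lemma saddle_mod_circle_max_neg:
  assumes s: "s > 0" "(b + a / s\<^sup>2) * (1 + s)\<^sup>2 \<le> 1" and u: "cmod u = s"
  shows "saddle_mod a b c u \<le> saddle_mod a b c (of_real (- s))"
proof -
  define B where "B = b + a / s\<^sup>2"
  have t: "- s \<le> Re u" using u abs_Re_le_cmod[of u] by simp
  have y0: "(1 + s)\<^sup>2 > 0" using s by simp
  have Bge: "B \<le> 1 / (1 + s)\<^sup>2" using s(2) y0 by (simp add: B_def field_simps)
  have sq: "(saddle_mod a b c v)\<^sup>2 = exp (2 * B * Re v) * s powr (2 * c) * (1 - 2 * Re v + s\<^sup>2)"
    if "cmod v = s" for v
    using that s saddle_mod_sq[of v a b c] by (auto simp: B_def cmod_one_minus_sq)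
  have "1 - 2 * Re u + s\<^sup>2 = (1 + s)\<^sup>2 + - (2 * (s + Re u))"
    by (simp add: power2_eq_square algebra_simps)
  also have "\<dots> = (1 + s)\<^sup>2 * (1 + - (2 * (s + Re u)) * (1 / (1 + s)\<^sup>2))"
    using y0 by (simp only: distrib_left) simp
  also have "\<dots> \<le> (1 + s)\<^sup>2 * (1 + - (2 * (s + Re u)) * B)"
    using Bge t by (intro mult_left_mono add_left_mono mult_left_mono_neg) auto
  also have "\<dots> \<le> (1 + s)\<^sup>2 * exp (- (2 * (s + Re u)) * B)"
    using exp_ge_add_one_self[of "- (2 * (s + Re u)) * B"] by (intro mult_left_mono) auto
  finally have "exp (2 * B * Re u) * (1 - 2 * Re u + s\<^sup>2) \<le> exp (2 * B * Re u) * ((1 + s)\<^sup>2 * exp (- (2 * (s + Re u)) * B))"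
    by (intro mult_left_mono) auto
  also have "\<dots> = exp (2 * B * Re u + (- (2 * (s + Re u)) * B)) * (1 + s)\<^sup>2"
    unfolding exp_add by (simp only: mult_ac)
  also have "2 * B * Re u + (- (2 * (s + Re u)) * B) = 2 * B * (- s)" by (simp add: algebra_simps)
  also have "(1 + s)\<^sup>2 = 1 + 2 * s + s\<^sup>2" by (simp add: power2_eq_square algebra_simps)
  finally have "(saddle_mod a b c u)\<^sup>2 \<le> (saddle_mod a b c (of_real (- s)))\<^sup>2"
    using sq[OF u] sq[of "of_real (- s)"] s mult_left_mono[of "exp (2 * B * Re u) * (1 - 2 * Re u + s\<^sup>2)" "exp (2 * B * (-s)) * (1 + 2 * s + s\<^sup>2)" "s powr (2 * c)"]
    by (simp add: mult_ac)
  thus ?thesis by (rule power2_le_imp_le) simp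
qed

text \<open>Logarithms of squares make one formula differentiable on all three intervals cut out by
  0 and 1.\<close>

definition real_action :: "real \<Rightarrow> real \<Rightarrow> real \<Rightarrow> real \<Rightarrow> real" where
  "real_action a b c s = b * s + a / s + c / 2 * ln (s\<^sup>2) + ln ((1 - s)\<^sup>2) / 2"

lemma saddle_mod_of_real:
  assumes "s \<noteq> 0" "s \<noteq> 1"
  shows "saddle_mod a b c (of_real s) = exp (real_action a b c s)"
proof -
  have l: "ln (t\<^sup>2) = 2 * ln \<bar>t\<bar>" if "t \<noteq> 0" for t :: real
    using that ln_realpow[of "\<bar>t\<bar>" 2] by simp
  have "cmod (1 - of_real s) = \<bar>1 - s\<bar>" by (metis norm_of_real of_real_1 of_real_diff)
  moreover have "Re (inverse (complex_of_real s)) = a' / s" if "a' = 1" for a'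
    using that by (metis Re_complex_of_real inverse_eq_divide of_real_inverse)
  moreover have "\<bar>s\<bar> powr c = exp (c * ln \<bar>s\<bar>)" "\<bar>1 - s\<bar> = exp (ln \<bar>1 - s\<bar>)"
    using assms by (auto simp: powr_def)
  ultimately have "saddle_mod a b c (of_real s) = exp (b * s + a * (1 / s)) * exp (c * ln \<bar>s\<bar>) * exp (ln \<bar>1 - s\<bar>)"
    by (simp only: saddle_mod_def Re_complex_of_real norm_of_real)
  also have "\<dots> = exp (real_action a b c s)"
  proof -
    have "real_action a b c s = b * s + a * (1 / s) + c * ln \<bar>s\<bar> + ln \<bar>1 - s\<bar>"
      unfolding real_action_def using l[of s] l[of "1 - s"] assms by simp
    thus ?thesis by (simp only: exp_add)
  qed
  finally show ?thesis .
qed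

lemma real_action_deriv:
  assumes "s \<noteq> 0" "s \<noteq> 1"
  shows "(real_action a b c has_real_derivative real_cubic a b c s / (s\<^sup>2 * (1 - s))) (at s)"
proof -
  have p: "s\<^sup>2 > 0" "(1 - s)\<^sup>2 > 0" using assms by auto
  have d2: "((\<lambda>s. a / s) has_real_derivative - (a / s\<^sup>2)) (at s)"
    using assms by (auto intro!: derivative_eq_intros simp: power2_eq_square)
  have d3: "((\<lambda>s. ln (s\<^sup>2)) has_real_derivative 2 / s) (at s)"
    using p assms by (auto intro!: derivative_eq_intros simp: power2_eq_square)
  have d4: "((\<lambda>s. ln ((1 - s)\<^sup>2)) has_real_derivative - (2 / (1 - s))) (at s)"
    using p assms by (auto intro!: derivative_eq_intros simp: power2_eq_square divide_simps)
  have "(real_action a b c has_real_derivative b * 1 + - (a / s\<^sup>2) + c / 2 * (2 / s) + - (2 / (1 - s)) / 2) (at s)"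
    unfolding real_action_def[abs_def]
    by (intro DERIV_add d2 DERIV_cmult d3 DERIV_cdivide d4 DERIV_ident)
  also have "b * 1 + - (a / s\<^sup>2) + c / 2 * (2 / s) + - (2 / (1 - s)) / 2 = b - a / s\<^sup>2 + c / s - 1 / (1 - s)"
  proof -
    have "- (2 / t) / 2 = - (1 / t)" "c / 2 * (2 / t) = c / t" for t :: real by simp_all
    note t = this(1)[of "1 - s"] this(2)[of s]
    show ?thesis unfolding t by simp
  qed
  also have "\<dots> = real_cubic a b c s / (s\<^sup>2 * (1 - s))"
  proof -
    have "a / s\<^sup>2 * s\<^sup>2 = a" "c / s * s\<^sup>2 = c * s" "1 / (1 - s) * (1 - s) = 1"
      using assms by (auto simp: power2_eq_square)
    moreover have "(b - A + C - J) * (s\<^sup>2 * (1 - s)) = b * s\<^sup>2 * (1 - s) - (A * s\<^sup>2) * (1 - s) + (C * s\<^sup>2) * (1 - s) - (J * (1 - s)) * s\<^sup>2"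
      for A C J by (simp add: algebra_simps)
    ultimately have "(b - a / s\<^sup>2 + c / s - 1 / (1 - s)) * (s\<^sup>2 * (1 - s)) = real_cubic a b c s"
      unfolding real_cubic_def by (simp only:) (simp add: algebra_simps power2_eq_square power3_eq_cube)
    thus ?thesis using assms by (simp add: eq_divide_eq)
  qed
  finally show ?thesis .
qed

lemma saddle_mod_real_less:
  assumes "p < q" "0 \<notin> {p..q}" "1 \<notin> {p..q}"
    and "\<And>s. p < s \<Longrightarrow> s < q \<Longrightarrow> real_cubic a b c s * (1 - s) > 0"
  shows "saddle_mod a b c (of_real p) < saddle_mod a b c (of_real q)"
proof -
  have ne: "s \<noteq> 0" "s \<noteq> 1" if "s \<in> {p..q}" for s using that assms by auto
  have "real_action a b c p < real_action a b c q"
  proof (rule DERIV_pos_imp_increasing_open[OF assms(1)])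
    fix s assume s: "p < s" "s < q"
    hence n: "s \<noteq> 0" "s \<noteq> 1" using ne by auto
    have "real_cubic a b c s / (s\<^sup>2 * (1 - s)) > 0"
    proof -
      have "real_cubic a b c s / (s\<^sup>2 * (1 - s)) = real_cubic a b c s * (1 - s) / (s * (1 - s))\<^sup>2"
        using n by (simp add: power2_eq_square)
      thus ?thesis using assms(4)[OF s] n by simp
    qed
    thus "\<exists>y. (real_action a b c has_real_derivative y) (at s) \<and> y > 0"
      using real_action_deriv[OF n] by blast
  next
    show "continuous_on {p..q} (real_action a b c)"
      using ne real_action_deriv by (meson DERIV_isCont continuous_at_imp_continuous_on)
  qed
  moreover have "p \<in> {p..q}" "q \<in> {p..q}" using assms by auto
  ultimately show ?thesis using ne by (simp add: saddle_mod_of_real)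
qed

lemma saddle_mod_real_greater:
  assumes "p < q" "0 \<notin> {p..q}" "1 \<notin> {p..q}"
    and "\<And>s. p < s \<Longrightarrow> s < q \<Longrightarrow> real_cubic a b c s * (1 - s) < 0"
  shows "saddle_mod a b c (of_real q) < saddle_mod a b c (of_real p)"
proof -
  have ne: "s \<noteq> 0" "s \<noteq> 1" if "s \<in> {p..q}" for s using that assms by auto
  have "real_action a b c q < real_action a b c p"
  proof (rule DERIV_neg_imp_decreasing_open[OF assms(1)])
    fix s assume s: "p < s" "s < q"
    hence n: "s \<noteq> 0" "s \<noteq> 1" using ne by auto
    have "real_cubic a b c s / (s\<^sup>2 * (1 - s)) < 0"
    proof -
      have "real_cubic a b c s / (s\<^sup>2 * (1 - s)) = real_cubic a b c s * (1 - s) / (s * (1 - s))\<^sup>2"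
        using n by (simp add: power2_eq_square)
      thus ?thesis using assms(4)[OF s] n by (simp add: divide_neg_pos)
    qed
    thus "\<exists>y. (real_action a b c has_real_derivative y) (at s) \<and> y < 0"
      using real_action_deriv[OF n] by blast
  next
    show "continuous_on {p..q} (real_action a b c)"
      using ne real_action_deriv by (meson DERIV_isCont continuous_at_imp_continuous_on)
  qed
  moreover have "p \<in> {p..q}" "q \<in> {p..q}" using assms by auto
  ultimately show ?thesis using ne by (simp add: saddle_mod_of_real)
qed

section \<open>Paths inside the superlevel region\<close>

definition upper_region :: "real \<Rightarrow> real \<Rightarrow> real \<Rightarrow> real set \<Rightarrow> real \<Rightarrow> complex set" where
  "upper_region a b c T V = {w. cmod w \<in> T \<and> Im w > 0 \<and> saddle_mod a b c w > V}"

text \<open>The conditions on the radii under which the upper superlevel region is open and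
  connected: every circle must meet it.\<close>

definition full_radii :: "real \<Rightarrow> real \<Rightarrow> real \<Rightarrow> real set \<Rightarrow> real \<Rightarrow> bool" where
  "full_radii a b c T V \<longleftrightarrow> connected T \<and> open T \<and> V > 0 \<and>
     (\<forall>s\<in>T. s > 0 \<and> (\<exists>w. cmod w = s \<and> saddle_mod a b c w > V))"

lemma open_superlevel:
  assumes "open T" "\<And>s. s \<in> T \<Longrightarrow> s > 0"
  shows "open {w. cmod w \<in> T \<and> saddle_mod a b c w > V}"
proof -
  have "open ((- {0}) \<inter> saddle_mod a b c -` {V<..})"
    by (intro continuous_open_preimage continuous_on_saddle_mod) auto
  moreover have "open (cmod -` T)" by (intro open_vimage assms continuous_intros)
  ultimately have "open (((- {0}) \<inter> saddle_mod a b c -` {V<..}) \<inter> cmod -` T)" by blast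
  also have "((- {0}) \<inter> saddle_mod a b c -` {V<..}) \<inter> cmod -` T = {w. cmod w \<in> T \<and> saddle_mod a b c w > V}"
    using assms(2) by force
  finally show ?thesis .
qed

lemma real_point_to_region:
  assumes T: "full_radii a b c T V" and p: "\<bar>p\<bar> \<in> T" "saddle_mod a b c (of_real p) > V"
  obtains A where "A \<in> upper_region a b c T V"
    "path_image (linepath (of_real p) A) \<subseteq> insert (of_real p) (upper_region a b c T V)"
proof -
  have op: "open {w. cmod w \<in> T \<and> saddle_mod a b c w > V}"
    using T by (intro open_superlevel) (auto simp: full_radii_def)
  have "of_real p \<in> {w. cmod w \<in> T \<and> saddle_mod a b c w > V}" using p by simp
  then obtain e where e: "e > 0" "ball (of_real p) e \<subseteq> {w. cmod w \<in> T \<and> saddle_mod a b c w > V}"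
    using op by (meson openE)
  define A where "A = of_real p + \<i> * of_real (e/2)"
  have Aball: "A \<in> ball (of_real p) e" using e by (simp add: A_def dist_norm norm_mult)
  have sub: "path_image (linepath (of_real p) A) \<subseteq> insert (of_real p) (upper_region a b c T V)"
  proof
    fix w assume "w \<in> path_image (linepath (of_real p) A)"
    hence w: "w \<in> closed_segment (of_real p) A" by simp
    moreover have "closed_segment (of_real p) A \<subseteq> ball (of_real p) e"
      using Aball e by (intro closed_segment_subset) auto
    ultimately have wb: "w \<in> ball (of_real p) e" by blast
    obtain t where t: "0 \<le> t" "w = (1 - t) *\<^sub>R of_real p + t *\<^sub>R A"
      using w by (auto simp: closed_segment_def)
    show "w \<in> insert (of_real p) (upper_region a b c T V)"
    proof (cases "t = 0")
      case False
      hence "Im w > 0" using t e by (simp add: A_def)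
      thus ?thesis using wb e(2) by (auto simp: upper_region_def)
    qed (use t in simp)
  qed
  have "Im A > 0" using e by (simp add: A_def)
  hence "A \<in> upper_region a b c T V" using Aball e(2) by (auto simp: upper_region_def)
  thus ?thesis using sub by (rule that)
qed

lemma region_path:
  assumes T: "full_radii a b c T V" and A: "A \<in> upper_region a b c T V" "B \<in> upper_region a b c T V"
  obtains g where "valid_path g" "pathstart g = A" "pathfinish g = B" "path_image g \<subseteq> upper_region a b c T V"
proof -
  have "connected (upper_region a b c T V)" "open (upper_region a b c T V)"
    unfolding upper_region_def using T by (intro connected_superlevel; simp add: full_radii_def)+
  from connected_open_polynomial_connected[OF this(2,1) A] show ?thesis
    using that valid_path_polynomial_function by blast
qed

lemma region_path_to_real:
  assumes T: "full_radii a b c T V" and A: "A \<in> upper_region a b c T V"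
    and p: "\<bar>p\<bar> \<in> T" "saddle_mod a b c (of_real p) > V"
  obtains g where "valid_path g" "pathstart g = A" "pathfinish g = of_real p"
    "path_image g \<subseteq> insert (of_real p) (upper_region a b c T V)"
proof -
  obtain B where B: "B \<in> upper_region a b c T V"
    "path_image (linepath (of_real p) B) \<subseteq> insert (of_real p) (upper_region a b c T V)"
    using real_point_to_region[OF T p] .
  obtain g where g: "valid_path g" "pathstart g = A" "pathfinish g = B" "path_image g \<subseteq> upper_region a b c T V"
    using region_path[OF T A B(1)] .
  show ?thesis
  proof (rule that[of "g +++ linepath B (of_real p)"])
    show "path_image (g +++ linepath B (of_real p)) \<subseteq> insert (of_real p) (upper_region a b c T V)"
      using g B by (auto simp: path_image_join closed_segment_commute)
  qed (use g in auto)
qed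

lemma region_path_real_real:
  assumes T: "full_radii a b c T V"
    and p: "\<bar>p\<bar> \<in> T" "saddle_mod a b c (of_real p) > V"
    and q: "\<bar>q\<bar> \<in> T" "saddle_mod a b c (of_real q) > V"
  shows "\<exists>g. upper_path p q g \<and> path_image g \<subseteq> {w. cmod w \<in> T \<and> saddle_mod a b c w > V}"
proof -
  obtain B where B: "B \<in> upper_region a b c T V"
    "path_image (linepath (of_real p) B) \<subseteq> insert (of_real p) (upper_region a b c T V)"
    using real_point_to_region[OF T p] .
  obtain g where g: "valid_path g" "pathstart g = B" "pathfinish g = of_real q"
    "path_image g \<subseteq> insert (of_real q) (upper_region a b c T V)"
    using region_path_to_real[OF T B(1) q] .
  have im: "path_image (linepath (of_real p) B +++ g) \<subseteq> {of_real p, of_real q} \<union> upper_region a b c T V"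
    using g B by (auto simp: path_image_join)
  show ?thesis
  proof (intro exI conjI)
    show "upper_path p q (linepath (of_real p) B +++ g)"
      using g im by (auto simp: upper_path_def upper_region_def intro!: valid_path_join)
    show "path_image (linepath (of_real p) B +++ g) \<subseteq> {w. cmod w \<in> T \<and> saddle_mod a b c w > V}"
      using im p q by (force simp: upper_region_def)
  qed
qed

text \<open>For radii slightly below that of \<open>w0\<close>, the radial projection of
  \<open>w0\<close> is still in the superlevel set. For larger radii, a circle missing the set would
  bound, together with the circle of radius \<rho>, an annulus that contains \<open>w0\<close> and
  on whose boundary the modulus is at most \<open>V\<close>, against the maximum principle.\<close>

lemma full_radii_outer:
  assumes b: "b \<noteq> 0" and \<rho>: "\<rho> > 0" and V: "V > 0" "\<And>u. cmod u = \<rho> \<Longrightarrow> saddle_mod a b c u \<le> V"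
    and w0: "cmod w0 > \<rho>" "saddle_mod a b c w0 > V"
  obtains s0 where "\<rho> \<le> s0" "s0 < cmod w0" "full_radii a b c {s0<..} V"
proof -
  have op: "open {w. cmod w \<in> {\<rho><..} \<and> saddle_mod a b c w > V}"
    using \<rho> by (intro open_superlevel) auto
  then obtain e where e: "e > 0" "ball w0 e \<subseteq> {w. cmod w \<in> {\<rho><..} \<and> saddle_mod a b c w > V}"
    using w0 by (metis (mono_tags, lifting) greaterThan_iff mem_Collect_eq openE)
  define s0 where "s0 = max \<rho> (cmod w0 - e / 2)"
  have s0: "\<rho> \<le> s0" "s0 < cmod w0" using e w0 by (auto simp: s0_def)
  have "\<exists>w. cmod w = s \<and> saddle_mod a b c w > V" if s: "s > s0" for s
  proof (cases "s \<le> cmod w0")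
    case True
    define w where "w = of_real (s / cmod w0) * w0"
    have w0n: "cmod w0 > 0" using w0 \<rho> by linarith
    have sp: "s > 0" using s s0 \<rho> by linarith
    have ws: "cmod w = s" using w0n sp by (simp add: w_def norm_mult norm_divide)
    have "w0 - w = of_real (1 - s / cmod w0) * w0" by (simp add: w_def algebra_simps)
    hence "cmod (w0 - w) = \<bar>1 - s / cmod w0\<bar> * cmod w0" by (simp only: norm_mult norm_of_real)
    moreover have "1 - s / cmod w0 \<ge> 0" using True w0n by simp
    ultimately have "cmod (w0 - w) = cmod w0 - s" using w0n by (simp add: left_diff_distrib)
    hence "w \<in> ball w0 e" using s e by (simp add: dist_norm s0_def)
    thus ?thesis using e(2) ws by blast
  next
    case False
    show ?thesis
    proof (rule ccontr)
      assume "\<not> ?thesis"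
      hence V': "\<forall>u. cmod u = s \<longrightarrow> saddle_mod a b c u \<le> V" by (metis not_less)
      have "saddle_mod a b c w0 \<le> V"
      proof (rule saddle_mod_annulus_max[OF b \<rho>])
        show "\<rho> \<le> cmod w0" "cmod w0 \<le> s" using w0 False by auto
      qed (use V(2) V' in blast)+
      thus False using w0 by linarith
    qed
  qed
  hence "full_radii a b c {s0<..} V"
    unfolding full_radii_def using V(1) s0(1) \<rho> by auto
  thus ?thesis using that[OF s0] by blast
qed

text \<open>As for the outer radii, with the annulus between the circles of radius \<open>s\<close>
  and \<open>\<rho>\<close>.\<close>

lemma full_radii_inner:
  assumes b: "b \<noteq> 0" and V: "V > 0" "\<And>u. cmod u = \<rho> \<Longrightarrow> saddle_mod a b c u \<le> V"
    and w0: "w0 \<noteq> 0" "cmod w0 < \<rho>" "saddle_mod a b c w0 > V"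
  obtains s0 where "cmod w0 < s0" "s0 \<le> \<rho>" "full_radii a b c {0<..<s0} V"
proof -
  have op: "open {w. cmod w \<in> {0<..<\<rho>} \<and> saddle_mod a b c w > V}"
    by (intro open_superlevel) auto
  moreover have "w0 \<in> {w. cmod w \<in> {0<..<\<rho>} \<and> saddle_mod a b c w > V}" using w0 by simp
  ultimately obtain e where e: "e > 0" "ball w0 e \<subseteq> {w. cmod w \<in> {0<..<\<rho>} \<and> saddle_mod a b c w > V}"
    by (meson openE)
  define s0 where "s0 = min \<rho> (cmod w0 + e / 2)"
  have s0: "s0 \<le> \<rho>" "cmod w0 < s0" using e w0 by (auto simp: s0_def)
  have "\<exists>w. cmod w = s \<and> saddle_mod a b c w > V" if s: "s < s0" "0 < s" for s
  proof (cases "s \<ge> cmod w0")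
    case True
    define w where "w = of_real (s / cmod w0) * w0"
    have w0n: "cmod w0 > 0" using w0 by simp
    have ws: "cmod w = s" using w0n s by (simp add: w_def norm_mult norm_divide)
    have "w0 - w = of_real (1 - s / cmod w0) * w0" by (simp add: w_def algebra_simps)
    hence "cmod (w0 - w) = \<bar>1 - s / cmod w0\<bar> * cmod w0" by (simp only: norm_mult norm_of_real)
    moreover have "1 - s / cmod w0 \<le> 0" using True w0n by simp
    ultimately have "cmod (w0 - w) = s - cmod w0" using w0n by (simp add: left_diff_distrib)
    hence "w \<in> ball w0 e" using s e by (simp add: dist_norm s0_def)
    thus ?thesis using e(2) ws by blast
  next
    case False
    show ?thesis
    proof (rule ccontr)
      assume "\<not> ?thesis"
      hence V': "\<forall>u. cmod u = s \<longrightarrow> saddle_mod a b c u \<le> V" by (metis not_less)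
      have "saddle_mod a b c w0 \<le> V"
      proof (rule saddle_mod_annulus_max[OF b s(2)])
        show "s \<le> cmod w0" "cmod w0 \<le> \<rho>" using w0 False by auto
      qed (use V(2) V' in blast)+
      thus False using w0 by linarith
    qed
  qed
  hence "full_radii a b c {0<..<s0} V"
    unfolding full_radii_def using V(1) by auto
  thus ?thesis using that[OF s0(2,1)] by blast
qed

text \<open>For \<open>p > 2 + 1 / b\<close> already \<open>b * (1 - p)^2 \<ge> 1\<close>, so the
  circle of radius \<open>p\<close> has its maximum at \<open>p\<close> itself; far out, the
  positive axis lies in the superlevel set.\<close>

lemma full_radii_large_real:
  assumes T: "full_radii a b c {s0<..} V" and ab: "a > 0" "b > 0"
  obtains p where "p > M" "p > s0" "p > 1" "saddle_mod a b c (of_real p) > V"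
proof -
  define p where "p = max (max M s0) (2 + 1 / b) + 1"
  have p: "p > M" "p > s0" "p > 2 + 1 / b" by (auto simp: p_def)
  have p1: "p > 1" using p(3) ab by (smt (verit) zero_less_divide_1_iff)
  have b1: "1 / b > 0" using ab by simp
  have "1 / b \<le> (p - 1) * 1" using p(3) by simp
  also have "\<dots> \<le> (p - 1) * (p - 1)" using p(3) b1 by (intro mult_left_mono) linarith+
  finally have "1 \<le> b * (1 - p)\<^sup>2" using ab by (simp add: field_simps power2_eq_square)
  also have "\<dots> \<le> (b + a / p\<^sup>2) * (1 - p)\<^sup>2" using ab by (intro mult_right_mono) auto
  finally have B: "(b + a / p\<^sup>2) * (1 - p)\<^sup>2 \<ge> 1" .
  obtain w where w: "cmod w = p" "saddle_mod a b c w > V"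
    using T p(2) by (auto simp: full_radii_def)
  have "saddle_mod a b c w \<le> saddle_mod a b c (of_real p)"
    using saddle_mod_circle_max_pos[OF _ _ B w(1)] p1 by simp
  thus ?thesis using that[of p] p p1 w(2) by simp
qed

text \<open>\<open>p \<le> sqrt a / 2\<close> gives \<open>a / p^2 \<ge> 4\<close> and
  \<open>p \<le> 1/2\<close> gives \<open>(1 - p)^2 \<ge> 1/4\<close>, so that again the circle has
  its maximum at \<open>p\<close>.\<close>

lemma full_radii_small_real:
  assumes T: "full_radii a b c {0<..<s0} V" and ab: "a > 0" "b > 0" and s0: "s0 > 0" and M: "M > 0"
  obtains p where "0 < p" "p < M" "p < s0" "p < 1" "saddle_mod a b c (of_real p) > V"
proof -
  define p where "p = min (min (M / 2) (s0 / 2)) (min (1/2) (sqrt a / 2))"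
  have p: "p > 0" "p < M" "p < s0" "p \<le> 1/2" "p \<le> sqrt a / 2"
    using ab s0 M by (auto simp: p_def min_less_iff_disj)
  have "p\<^sup>2 \<le> (sqrt a / 2)\<^sup>2" using p by (intro power_mono) auto
  hence "4 * p\<^sup>2 \<le> a" using ab by (simp add: power_divide)
  hence "4 \<le> a / p\<^sup>2" using p by (simp add: field_simps)
  hence B4: "4 \<le> b + a / p\<^sup>2" using ab by linarith
  have "(1/2)\<^sup>2 \<le> (1 - p)\<^sup>2" using p by (intro power_mono) auto
  hence "4 * (1/2)\<^sup>2 \<le> (b + a / p\<^sup>2) * (1 - p)\<^sup>2" using B4 by (intro mult_mono) auto
  hence B: "(b + a / p\<^sup>2) * (1 - p)\<^sup>2 \<ge> 1" by (simp add: power2_eq_square)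
  obtain w where w: "cmod w = p" "saddle_mod a b c w > V"
  proof -
    have "p \<in> {0<..<s0}" using p by simp
    thus ?thesis using T that unfolding full_radii_def by blast
  qed
  have "saddle_mod a b c w \<le> saddle_mod a b c (of_real p)"
    using saddle_mod_circle_max_pos[OF _ _ B w(1)] p by simp
  thus ?thesis using that[of p] p w(2) by simp
qed

lemma superlevel_gap:
  assumes "compact S" "S \<subseteq> {w. saddle_mod a b c w > V}" "0 \<notin> S"
  obtains V1 where "V1 > V" "S \<subseteq> {w. saddle_mod a b c w > V1}"
proof (cases "S = {}")
  case True
  thus ?thesis using that[of "V + 1"] by simp
next
  case False
  then obtain w where w: "w \<in> S" "\<And>v. v \<in> S \<Longrightarrow> saddle_mod a b c w \<le> saddle_mod a b c v"
    using continuous_attains_inf[OF assms(1) _ continuous_on_saddle_mod[OF assms(3)]] by blast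
  have "V < saddle_mod a b c w" using w assms by auto
  thus ?thesis using that[of "(V + saddle_mod a b c w) / 2"] w(2) by force
qed

section \<open>Limits of one kernel entry for real critical points\<close>

lemma vieta3_swap: "vieta3 a b c x y z \<Longrightarrow> vieta3 a b c x z y"
  by (simp add: vieta3_def algebra_simps)

text \<open>Reads off from the order of the roots whether the circle through \<open>y\<close> has
  its maximum at \<open>y\<close>. The 1 on the left is replaced by
  \<open>b * (1 - x) * (1 - y) * (1 - z)\<close>, by \<open>vieta3_at_1\<close>.\<close>

lemma vieta3_circle_condition:
  assumes v: "vieta3 a b c x y z" and y: "y \<noteq> 0"
  shows "(b + a / y\<^sup>2) * (1 - y)\<^sup>2 - 1 = b * (1 - y) * ((y - x) * (z - y)) / y"
proof -
  have a: "a = - b * (x * y * z)" using v by (simp add: vieta3_def)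
  have B: "b + a / y\<^sup>2 = b * (1 - x * z / y)"
    unfolding a using y by (simp add: power2_eq_square field_simps)
  have "(b + a / y\<^sup>2) * (1 - y)\<^sup>2 - 1 = b * (1 - y) * ((1 - x * z / y) * (1 - y) - (1 - x) * (1 - z))"
  proof -
    have "b * (1 - W) * (1 - y)\<^sup>2 - b * ((1 - x) * (1 - y) * (1 - z))
        = b * (1 - y) * ((1 - W) * (1 - y) - (1 - x) * (1 - z))" for W
      by (simp add: power2_eq_square algebra_simps)
    thus ?thesis unfolding B using vieta3_at_1[OF v] by simp
  qed
  also have "(1 - x * z / y) * (1 - y) - (1 - x) * (1 - z) = (y - x) * (z - y) / y"
    using y by (simp add: field_simps)
  finally show ?thesis by simp
qed

lemma circle_integral_powi:
  assumes "\<rho> > 0"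
  shows "1 / (2 * of_real pi * \<i>) * contour_integral (circlepath 0 \<rho>) (\<lambda>u. u powi (- l - 1)) = (if l = 0 then 1 else 0)"
proof (cases "l = 0")
  case True
  have "(\<lambda>u::complex. u powi (- l - 1)) = (\<lambda>u. 1 / (u - 0))"
    using True by (simp add: power_int_minus divide_inverse)
  thus ?thesis using contour_integral_circlepath[OF assms, of 0] True by simp
next
  case False
  have "((\<lambda>u. u powi (- l - 1)) has_contour_integral
      (\<lambda>u. u powi (- l) / of_int (- l)) (pathfinish (circlepath 0 \<rho>)) - (\<lambda>u. u powi (- l) / of_int (- l)) (pathstart (circlepath 0 \<rho>))) (circlepath 0 \<rho>)"
  proof (rule contour_integral_primitive[of "- {0}"])
    fix u :: complex assume "u \<in> - {0}"
    thus "((\<lambda>u. u powi (- l) / of_int (- l)) has_field_derivative u powi (- l - 1)) (at u within - {0})"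
      using False by (auto intro!: derivative_eq_intros)
  qed (use assms in auto)
  thus ?thesis using False by (simp add: contour_integral_unique)
qed

context kernel_scaling
begin

lemma path_superlevel_gap:
  assumes "upper_path p q g" "path_image g \<subseteq> {w. cmod w \<in> T \<and> V w > V0}" "0 \<notin> T"
  obtains V1 where "V1 > V0" "path_image g \<subseteq> {w. cmod w \<in> T \<and> V w > V1}"
proof -
  have "compact (path_image g)" using assms(1) by (auto simp: upper_path_def intro: compact_valid_path_image)
  moreover have "path_image g \<subseteq> {w. V w > V0}" "0 \<notin> path_image g" using assms by auto
  ultimately obtain V1 where "V1 > V0" "path_image g \<subseteq> {w. V w > V1}" by (rule superlevel_gap)
  thus ?thesis using that assms(2) by blast
qed

text \<open>The circle passes through \<open>x2\<close>, its maximum. On the way to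
  \<open>x3\<close> the modulus increases, so a loop about 1 can cross the axis at \<open>x3\<close>
  and far to the right, staying outside the circle.\<close>

lemma limit_type_A:
  assumes r: "0 < r" "r < 1" "0 < \<epsilon>" "\<epsilon> < 1 - r"
    and v: "vieta3 a b c x1 x2 x3" "x1 < 0" "0 < x2" "x2 < x3" "x3 < 1"
  shows "\<exists>L. K r \<epsilon> \<longlonglongrightarrow> L \<and> (k \<ge> 0 \<longrightarrow> L = 0)"
proof -
  define V0 where "V0 = V (of_real x2)"
  have b0: "b \<noteq> 0" using b_pos by simp
  have "b * (1 - x2) * ((x2 - x1) * (x3 - x2)) / x2 \<ge> 0" using v b_pos by simp
  hence "(b + a / x2\<^sup>2) * (1 - x2)\<^sup>2 \<ge> 1" using vieta3_circle_condition[OF v(1)] v(3) by simp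
  hence V0: "\<And>u. cmod u = x2 \<Longrightarrow> V u \<le> V0"
    unfolding V0_def using saddle_mod_circle_max_pos v by simp
  have V0p: "V0 > 0" unfolding V0_def by (rule saddle_mod_pos) (use v in auto)
  have x3: "V (of_real x3) > V0" unfolding V0_def
  proof (rule saddle_mod_real_less)
    fix s assume "x2 < s" "s < x3"
    thus "real_cubic a b c s * (1 - s) > 0"
      unfolding vieta3_cubic[OF v(1)] using v b_pos by (simp add: mult_less_0_iff zero_less_mult_iff)
  qed (use v in auto)
  obtain s0 where s0: "x2 \<le> s0" "s0 < cmod (of_real x3)" "full_radii a b c {s0<..} V0"
    using full_radii_outer[OF b0 v(3) V0p V0, of "of_real x3"] x3 v by auto
  obtain p where p: "p > s0" "p > 1" "V (of_real p) > V0"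
    using full_radii_large_real[OF s0(3) a_pos b_pos] by blast
  obtain g where g: "upper_path x3 p g" "path_image g \<subseteq> {w. cmod w \<in> {s0<..} \<and> V w > V0}"
    using region_path_real_real[OF s0(3), of x3 p] x3 p s0 v by auto
  obtain V1 where V1: "V1 > V0" "path_image g \<subseteq> {w. cmod w \<in> {s0<..} \<and> V w > V1}"
    using path_superlevel_gap[OF g] s0 v by auto
  have "path_image g \<subseteq> {w. cmod w \<noteq> x2 \<and> V w > V1}" using V1(2) s0(1) by auto
  from limit_outside[OF r v(3) _ V0p V1(1) g(1) this] V0 v p
  have "K r \<epsilon> \<longlonglongrightarrow> 1 / (2 * of_real pi * \<i>) *
           contour_integral (circlepath 0 x2) (\<lambda>u. if k < 0 then - \<phi> u else 0)" by auto
  thus ?thesis by (intro exI conjI) auto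
qed

text \<open>The circle passes through \<open>x3\<close>, its maximum. The modulus is larger at
  \<open>x2\<close>, and the loop about 1 crosses the axis there and near 0, staying inside the
  circle.\<close>

lemma limit_type_B:
  assumes r: "0 < r" "r < 1" "0 < \<epsilon>" "\<epsilon> < 1 - r"
    and v: "vieta3 a b c x1 x2 x3" "x1 < 0" "1 < x2" "x2 < x3"
  shows "\<exists>L. K r \<epsilon> \<longlonglongrightarrow> L \<and> (k \<ge> 0 \<longrightarrow> L = 0)"
proof -
  define V0 where "V0 = V (of_real x3)"
  have b0: "b \<noteq> 0" using b_pos by simp
  have x3p: "x3 > 0" using v by linarith
  have "b * (1 - x3) * ((x3 - x1) * (x2 - x3)) / x3 \<ge> 0"
    using v b_pos by (intro divide_nonneg_nonneg mult_nonpos_nonpos) (auto simp: mult_le_0_iff)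
  hence "(b + a / x3\<^sup>2) * (1 - x3)\<^sup>2 \<ge> 1" using vieta3_circle_condition[OF vieta3_swap[OF v(1)]] x3p by simp
  hence V0: "\<And>u. cmod u = x3 \<Longrightarrow> V u \<le> V0"
    unfolding V0_def using saddle_mod_circle_max_pos v by simp
  have V0p: "V0 > 0" unfolding V0_def by (rule saddle_mod_pos) (use v in auto)
  have x2: "V (of_real x2) > V0" unfolding V0_def
  proof (rule saddle_mod_real_greater)
    fix s assume "x2 < s" "s < x3"
    thus "real_cubic a b c s * (1 - s) < 0"
      unfolding vieta3_cubic[OF v(1)] using v b_pos by (simp add: mult_less_0_iff zero_less_mult_iff)
  qed (use v in auto)
  obtain s0 where s0: "cmod (of_real x2) < s0" "s0 \<le> x3" "full_radii a b c {0<..<s0} V0"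
    using full_radii_inner[where \<rho> = "x3" and ?w0.0 = "of_real x2", OF b0 V0p V0] x2 v by auto
  have s0p: "s0 > 0" using s0 v by simp
  obtain p where p: "0 < p" "p < s0" "p < 1" "V (of_real p) > V0"
    using full_radii_small_real[OF s0(3) a_pos b_pos s0p zero_less_one] by blast
  obtain g where g: "upper_path p x2 g" "path_image g \<subseteq> {w. cmod w \<in> {0<..<s0} \<and> V w > V0}"
    using region_path_real_real[OF s0(3), of p x2] x2 p s0 v by auto
  obtain V1 where V1: "V1 > V0" "path_image g \<subseteq> {w. cmod w \<in> {0<..<s0} \<and> V w > V1}"
    using path_superlevel_gap[OF g] s0 v by auto
  have "path_image g \<subseteq> {w. cmod w \<noteq> x3 \<and> V w > V1}" using V1(2) s0 by auto
  from limit_outside[OF r x3p _ V0p V1(1) g(1) this] V0 v p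
  have "K r \<epsilon> \<longlonglongrightarrow> 1 / (2 * of_real pi * \<i>) *
           contour_integral (circlepath 0 x3) (\<lambda>u. if k < 0 then - \<phi> u else 0)" by auto
  thus ?thesis by (intro exI conjI) auto
qed

text \<open>The circle passes through \<open>x2\<close>, its maximum. The modulus is larger at both
  \<open>x1\<close> and \<open>x3\<close>, where a loop outside and one inside the circle begin;
  they cross the positive axis far out and near 0. For \<open>k = 0\<close> the limit is the
  integral of \<open>u powi (- l - 1)\<close>.\<close>

lemma limit_type_C:
  assumes r: "0 < r" "r < 1" "0 < \<epsilon>" "\<epsilon> < 1 - r"
    and v: "vieta3 a b c x1 x2 x3" "x1 < x2" "x2 < x3" "x3 < 0"
  shows "\<exists>L. K r \<epsilon> \<longlonglongrightarrow> L \<and> (k < 0 \<longrightarrow> L = 0) \<and> (k = 0 \<longrightarrow> L = (if l = 0 then 1 else 0))"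
proof -
  define \<rho> where "\<rho> = - x2"
  define V0 where "V0 = V (of_real x2)"
  have b0: "b \<noteq> 0" using b_pos by simp
  have \<rho>: "\<rho> > 0" using v by (simp add: \<rho>_def)
  have "b * (1 - x2) * ((x2 - x1) * (x3 - x2)) / x2 \<le> 0"
    using v b_pos by (intro divide_nonneg_neg) auto
  hence "(b + a / x2\<^sup>2) * (1 - x2)\<^sup>2 \<le> 1" using vieta3_circle_condition[OF v(1)] v by simp
  hence "(b + a / \<rho>\<^sup>2) * (1 + \<rho>)\<^sup>2 \<le> 1" by (simp add: \<rho>_def)
  hence V0: "\<And>u. cmod u = \<rho> \<Longrightarrow> V u \<le> V0"
    unfolding V0_def using saddle_mod_circle_max_neg[OF \<rho>] by (simp add: \<rho>_def)
  have V0p: "V0 > 0" unfolding V0_def by (rule saddle_mod_pos) (use v in auto)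
  have x1: "V (of_real x1) > V0" unfolding V0_def
  proof (rule saddle_mod_real_greater)
    fix s assume "x1 < s" "s < x2"
    thus "real_cubic a b c s * (1 - s) < 0"
      unfolding vieta3_cubic[OF v(1)] using v b_pos by (simp add: mult_less_0_iff zero_less_mult_iff)
  qed (use v in auto)
  have x3: "V (of_real x3) > V0" unfolding V0_def
  proof (rule saddle_mod_real_less)
    fix s assume "x2 < s" "s < x3"
    thus "real_cubic a b c s * (1 - s) > 0"
      unfolding vieta3_cubic[OF v(1)] using v b_pos by (simp add: mult_less_0_iff zero_less_mult_iff)
  qed (use v in auto)
  obtain s0 where s0: "\<rho> \<le> s0" "s0 < cmod (of_real x1)" "full_radii a b c {s0<..} V0"
    using full_radii_outer[OF b0 \<rho> V0p V0, of "of_real x1"] x1 v by (auto simp: \<rho>_def)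
  obtain p where p: "p > s0" "p > 1" "V (of_real p) > V0"
    using full_radii_large_real[OF s0(3) a_pos b_pos] by blast
  obtain g where g: "upper_path x1 p g" "path_image g \<subseteq> {w. cmod w \<in> {s0<..} \<and> V w > V0}"
    using region_path_real_real[OF s0(3), of x1 p] x1 p s0 v by auto
  obtain V1 where V1: "V1 > V0" "path_image g \<subseteq> {w. cmod w \<in> {s0<..} \<and> V w > V1}"
    using path_superlevel_gap[OF g] s0 \<rho> by auto
  obtain s1 where s1: "cmod (of_real x3) < s1" "s1 \<le> \<rho>" "full_radii a b c {0<..<s1} V0"
    using full_radii_inner[where \<rho> = \<rho> and ?w0.0 = "of_real x3", OF b0 V0p V0] x3 v by (auto simp: \<rho>_def)
  have s1p: "s1 > 0" using s1 v by simp
  obtain q where q: "0 < q" "q < s1" "q < 1" "V (of_real q) > V0"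
    using full_radii_small_real[OF s1(3) a_pos b_pos s1p zero_less_one] by blast
  obtain h where h: "upper_path x3 q h" "path_image h \<subseteq> {w. cmod w \<in> {0<..<s1} \<and> V w > V0}"
    using region_path_real_real[OF s1(3), of x3 q] x3 q s1 v by auto
  obtain V2 where V2: "V2 > V0" "path_image h \<subseteq> {w. cmod w \<in> {0<..<s1} \<and> V w > V2}"
    using path_superlevel_gap[OF h] by auto
  define V3 where "V3 = min V1 V2"
  have V3: "V3 > V0" using V1 V2 by (simp add: V3_def)
  have gi: "path_image g \<subseteq> {w. cmod w \<noteq> \<rho> \<and> V w > V3}" using V1(2) s0(1) by (auto simp: V3_def)
  have hi: "path_image h \<subseteq> {w. cmod w \<noteq> \<rho> \<and> V w > V3}" using V2(2) s1 by (auto simp: V3_def)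
  have V0': "\<forall>u. cmod u = \<rho> \<longrightarrow> V u \<le> V0" using V0 by blast
  have "K r \<epsilon> \<longlonglongrightarrow> 1 / (2 * of_real pi * \<i>) *
           contour_integral (circlepath 0 \<rho>) (\<lambda>u. if k < 0 then 0 else \<phi> u)"
    by (rule limit_between[OF r \<rho> V0' V0p V3 g(1) gi _ _ _ h(1) hi])
       (use v p q s0 s1 in \<open>auto simp: \<rho>_def\<close>)
  moreover have "1 / (2 * of_real pi * \<i>) * contour_integral (circlepath 0 \<rho>) (\<lambda>u. if k < 0 then 0 else \<phi> u)
      = (if l = 0 then 1 else 0)" if "k = 0"
    using circle_integral_powi[OF \<rho>, of l] that by (simp add: beta_integrand_def)
  ultimately show ?thesis by (intro exI conjI) auto
qed

end

section \<open>Nonreal saddle points\<close>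

text \<open>The imaginary and the real part of \<open>z * S' z = 0\<close>: the derivatives of
  \<open>|exp S|\<close> along the circle and along the ray vanish.\<close>

lemma R_poly_zero_nonreal:
  assumes R: "R_poly a b c z = 0" and z: "Im z \<noteq> 0"
  defines "X \<equiv> Re z" and "P \<equiv> (cmod z)\<^sup>2" and "Y \<equiv> (cmod (1 - z))\<^sup>2"
  shows "b + a / P = 1 / Y" "b * X - a * X / P + c + (P - X) / Y = 0"
proof -
  have z0: "z \<noteq> 0" "1 - z \<noteq> 0" using z by auto
  have P: "P > 0" and Y: "Y > 0" using z0 by (auto simp: P_def Y_def)
  have "z * (of_real b * z * (1 - z) - of_real a * (1 - z) / z + of_real c * (1 - z) - z) = R_poly a b c z"
    using z0 by (simp add: R_poly_def field_simps power2_eq_square power3_eq_cube)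
  hence "of_real b * z * (1 - z) - of_real a * (1 - z) / z + of_real c * (1 - z) - z = 0" using R z0 by simp
  moreover have "(of_real b * z - of_real a * inverse z + of_real c - q) * (1 - z)
      = of_real b * z * (1 - z) - of_real a * (1 - z) / z + of_real c * (1 - z) - q * (1 - z)" for q
    by (simp add: algebra_simps divide_inverse)
  moreover have "z / (1 - z) * (1 - z) = z" using z0 by simp
  ultimately have "(of_real b * z - of_real a * inverse z + of_real c - z / (1 - z)) * (1 - z) = 0" by simp
  hence E: "of_real b * z - of_real a * inverse z + of_real c - z / (1 - z) = 0"
    using z0 by simp
  have inv: "Re (inverse z) = X / P" "Im (inverse z) = - Im z / P"
    by (simp_all add: X_def P_def cmod_power2)
  have "z / (1 - z) = z * cnj (1 - z) / of_real Y"
    unfolding Y_def complex_norm_square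
    by (rule mult_divide_mult_cancel_right[symmetric]) (use z0 in auto)
  then have q: "Re (z / (1 - z)) = (X - P) / Y" "Im (z / (1 - z)) = Im z / Y"
  proof -
    assume quot: "z / (1 - z) = z * cnj (1 - z) / of_real Y"
    have "z * cnj (1 - z) = z - of_real P"
      unfolding P_def complex_norm_square by (simp add: algebra_simps)
    hence "z / (1 - z) = (z - of_real P) / of_real Y" using quot by simp
    thus "Re (z / (1 - z)) = (X - P) / Y" "Im (z / (1 - z)) = Im z / Y"
      by (simp_all add: X_def)
  qed
  have "Re (of_real b * z - of_real a * inverse z + of_real c - z / (1 - z)) = 0"
    "Im (of_real b * z - of_real a * inverse z + of_real c - z / (1 - z)) = 0" unfolding E by simp_all
  hence e: "b * X - a * (X / P) + c - (X - P) / Y = 0" "b * Im z + a * (Im z / P) - Im z / Y = 0"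
    by (simp_all add: inv q X_def del: inverse_complex.simps Re_divide Im_divide)
  have "(b + a / P - 1 / Y) * Im z = 0" using e(2) by (simp add: algebra_simps)
  thus "b + a / P = 1 / Y" using z by simp
  have "(X - P) / Y = - ((P - X) / Y)" by (simp add: diff_divide_distrib)
  thus "b * X - a * X / P + c + (P - X) / Y = 0" using e(1) by simp
qed

text \<open>Strict concavity of \<open>ln\<close> at 1 in quantitative form; the tangent line alone
  would show the maximum at the critical point but no decay away from it.\<close>

lemma ln_quadratic_bound:
  fixes r R :: real
  assumes "0 < r" "r \<le> R" "1 \<le> R"
  shows "ln r \<le> (r - 1) - (r - 1)\<^sup>2 / (2 * R)"
proof -
  define f where "f = (\<lambda>r::real. (r - 1) - (r - 1)\<^sup>2 / (2 * R) - ln r)"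
  have d: "(f has_real_derivative (x - 1) * (1 / x - 1 / R)) (at x)" if "x > 0" for x
    unfolding f_def using that assms
    by (auto intro!: derivative_eq_intros simp: field_simps power2_eq_square)
  have "f 1 \<le> f r"
  proof (cases "r \<ge> 1")
    case True
    show ?thesis
    proof (rule DERIV_nonneg_imp_nondecreasing[OF True])
      fix x assume x: "1 \<le> x" "x \<le> r"
      have "(x - 1) * (1 / x - 1 / R) \<ge> 0" using x assms by (intro mult_nonneg_nonneg) (auto simp: frac_le)
      thus "\<exists>y. (f has_real_derivative y) (at x) \<and> 0 \<le> y" using d[of x] x by auto
    qed
  next
    case False
    hence "r \<le> 1" by simp
    thus ?thesis
    proof (rule DERIV_nonpos_imp_nonincreasing)
      fix x assume x: "r \<le> x" "x \<le> 1"
      have "1 / R \<le> 1 / x" using x assms by (intro divide_left_mono) auto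
      hence "(x - 1) * (1 / x - 1 / R) \<le> 0" using x by (intro mult_nonpos_nonneg) auto
      thus "\<exists>y. (f has_real_derivative y) (at x) \<and> y \<le> 0" using d[of x] x assms by auto
    qed
  qed
  thus ?thesis by (simp add: f_def)
qed

text \<open>Turns a bound in terms of \<open>Re u\<close> into one in terms of the distances from
  the two critical points.\<close>

lemma dist_product_circle:
  assumes "cmod u = cmod z"
  shows "(cmod (u - z) * cmod (u - cnj z))\<^sup>2 = 4 * (cmod z)\<^sup>2 * (Re u - Re z)\<^sup>2"
proof -
  have e: "(Im u)\<^sup>2 = (Re z)\<^sup>2 + (Im z)\<^sup>2 - (Re u)\<^sup>2"
    using assms cmod_power2[of u] cmod_power2[of z] by simp
  have "(cmod (u - z) * cmod (u - cnj z))\<^sup>2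
      = ((Re u - Re z)\<^sup>2 + (Im u - Im z)\<^sup>2) * ((Re u - Re z)\<^sup>2 + (Im u + Im z)\<^sup>2)"
    unfolding power_mult_distrib cmod_power2 by simp
  also have "\<dots> = ((Re u - Re z)\<^sup>2)\<^sup>2 + (Re u - Re z)\<^sup>2 * (2 * (Im u)\<^sup>2 + 2 * (Im z)\<^sup>2) + ((Im u)\<^sup>2 - (Im z)\<^sup>2)\<^sup>2"
    by (simp add: power2_eq_square algebra_simps)
  also have "\<dots> = 4 * ((Re z)\<^sup>2 + (Im z)\<^sup>2) * (Re u - Re z)\<^sup>2"
    unfolding e by (simp add: power2_eq_square algebra_simps)
  finally show ?thesis by (simp add: cmod_power2)
qed

text \<open>As \<open>B = 1 / Y\<close>, the function
  \<open>2 * B * t + ln (1 - 2 * t + s^2)\<close> is critical at \<open>t = Re z\<close>; up to a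
  constant it is \<open>ln r - (r - 1)\<close> with \<open>r = y / Y\<close>. The factor
  \<open>(1 + cmod z) ^ 4\<close> comes from bounding \<open>y\<close> and \<open>Y\<close> by
  \<open>Q\<close>.\<close>

lemma saddle_mod_circle_decay:
  assumes R: "R_poly a b c z = 0" and z: "Im z \<noteq> 0" and u: "cmod u = cmod z"
  shows "saddle_mod a b c u \<le> saddle_mod a b c z *
    exp (- ((cmod (u - z) * cmod (u - cnj z))\<^sup>2 / (4 * (cmod z)\<^sup>2 * (1 + cmod z) ^ 4)))"
proof -
  define s where "s = cmod z"
  define Y where "Y = (cmod (1 - z))\<^sup>2"
  define y where "y = (cmod (1 - u))\<^sup>2"
  define B where "B = b + a / s\<^sup>2"
  define Q where "Q = (1 + s)\<^sup>2"
  have z0: "z \<noteq> 0" "z \<noteq> 1" using z by auto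
  hence u0: "u \<noteq> 0" using u by auto
  have s: "s > 0" using z0 by (simp add: s_def)
  have Y: "Y > 0" using z0 by (simp add: Y_def)
  have B: "B = 1 / Y" using R_poly_zero_nonreal(1)[OF R z] by (simp add: B_def s_def Y_def)
  have Q: "y \<le> Q" "Y \<le> Q"
    unfolding y_def Y_def Q_def s_def using norm_triangle_ineq4[of 1 u] norm_triangle_ineq4[of 1 z] u
    by (auto intro!: power_mono)
  have Yz: "Y = 1 - 2 * Re z + s\<^sup>2" "y = 1 - 2 * Re u + s\<^sup>2"
    using cmod_one_minus_sq[of z] cmod_one_minus_sq[of u] u by (auto simp: Y_def y_def s_def)
  define r where "r = y / Y"
  define D where "D = (cmod (u - z) * cmod (u - cnj z))\<^sup>2 / (4 * (cmod z)\<^sup>2 * (1 + cmod z) ^ 4)"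
  have y0: "y \<ge> 0" by (simp add: y_def)
  have main: "exp (2 * B * Re u) * y \<le> exp (2 * B * Re z) * Y * exp (- (2 * D))"
  proof (cases "y = 0")
    case True
    thus ?thesis using Y by simp
  next
    case False
    hence r: "r > 0" "r \<le> Q / Y" "1 \<le> Q / Y" using Y Q y0 by (auto simp: r_def divide_right_mono)
    have r1: "r - 1 = - 2 * (Re u - Re z) / Y" using Y by (simp add: r_def Yz field_simps) 
    hence rsq: "(r - 1)\<^sup>2 = 4 * (Re u - Re z)\<^sup>2 / Y\<^sup>2" by (simp only: power_divide power_mult_distrib) simp
    have A: "4 * A / Y\<^sup>2 / (2 * (Q / Y)) = 2 * A / (Y * Q)" for A
      using Y by (simp add: power2_eq_square field_simps)
    have "(r - 1)\<^sup>2 / (2 * (Q / Y)) = 2 * (Re u - Re z)\<^sup>2 / (Y * Q)" unfolding rsq by (rule A)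
    also have "\<dots> \<ge> 2 * (Re u - Re z)\<^sup>2 / (Q * Q)"
      using Q Y by (intro divide_left_mono mult_right_mono) auto
    also have "2 * (Re u - Re z)\<^sup>2 / (Q * Q) = 2 * D"
    proof -
      have "Q * Q = (1 + s) ^ 4" by (simp add: Q_def power4_eq_xxxx power2_eq_square)
      thus ?thesis using s unfolding D_def dist_product_circle[OF u] s_def[symmetric] by (simp add: field_simps)
    qed
    finally have "ln r \<le> (r - 1) - 2 * D" using ln_quadratic_bound[OF r] by linarith
    hence "r \<le> exp ((r - 1) - 2 * D)" using r(1) by (metis exp_ln exp_le_cancel_iff)
    hence "exp (2 * B * Re u) * (r * Y) \<le> exp (2 * B * Re u) * (exp ((r - 1) - 2 * D) * Y)"
      using Y by (intro mult_left_mono mult_right_mono) auto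
    also have "\<dots> = exp (2 * B * Re u + ((r - 1) - 2 * D)) * Y" by (simp add: exp_add)
    also have "2 * B * Re u + ((r - 1) - 2 * D) = 2 * B * Re z + - (2 * D)"
    proof -
      have "r - 1 = 2 * (1 / Y) * Re z - 2 * (1 / Y) * Re u"
        unfolding r1 by (simp add: diff_divide_distrib right_diff_distrib)
      thus ?thesis unfolding B by linarith
    qed
    also have "exp \<dots> * Y = exp (2 * B * Re z) * Y * exp (- (2 * D))" by (simp only: exp_add mult_ac)
    finally show ?thesis using Y by (simp add: r_def)
  qed
  have "(saddle_mod a b c u)\<^sup>2 = s powr (2 * c) * (exp (2 * B * Re u) * y)"
    using saddle_mod_sq[OF u0, of a b c] u by (simp add: B_def s_def y_def)
  also have "\<dots> \<le> s powr (2 * c) * (exp (2 * B * Re z) * Y * exp (- (2 * D)))"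
    by (rule mult_left_mono[OF main]) simp
  also have "\<dots> = (saddle_mod a b c z * exp (- D))\<^sup>2"
    using saddle_mod_sq[OF z0(1), of a b c]
    by (simp add: power_mult_distrib exp_double[symmetric] B_def s_def Y_def)
  finally show ?thesis unfolding D_def[symmetric] by (rule power2_le_imp_le) simp
qed

text \<open>The derivative in \<open>t\<close> of \<open>t * d/dt log |exp S(t z)|\<close>, where \<open>X = Re z\<close> and \<open>P = |z|\<^sup>2\<close>; the
  inner function vanishes at \<open>t = 1\<close> if \<open>z\<close> is critical.\<close>

definition radial_convexity :: "real \<Rightarrow> real \<Rightarrow> real \<Rightarrow> real \<Rightarrow> real \<Rightarrow> real" where
  "radial_convexity a b X P t = X * (b + a / (P * t\<^sup>2)) + (2 * t * P - X - t\<^sup>2 * P * X) / (1 - 2 * t * X + t\<^sup>2 * P)\<^sup>2"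

text \<open>The logarithm of the modulus is harmonic, so concavity along the circle becomes
  convexity along the ray; the value works out as \<open>2 * (Im z)^2 / Y^2\<close>.\<close>

lemma radial_convexity_at_1:
  assumes "R_poly a b c z = 0" "Im z \<noteq> 0"
  shows "radial_convexity a b (Re z) ((cmod z)\<^sup>2) 1 > 0"
proof -
  define Y where "Y = (cmod (1 - z))\<^sup>2"
  have "1 - z \<noteq> 0" using assms(2) by auto
  hence Y1: "Y > 0" by (simp add: Y_def)
  have Y2: "Y = 1 - 2 * Re z + (cmod z)\<^sup>2" unfolding Y_def by (rule cmod_one_minus_sq)
  note Y = Y1 Y2
  have "radial_convexity a b (Re z) ((cmod z)\<^sup>2) 1 = Re z * (1 / Y) + (2 * (cmod z)\<^sup>2 - Re z - (cmod z)\<^sup>2 * Re z) / Y\<^sup>2"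
    using R_poly_zero_nonreal(1)[OF assms] by (simp add: radial_convexity_def Y_def cmod_one_minus_sq)
  also have "\<dots> = (Re z * Y + (2 * (cmod z)\<^sup>2 - Re z - (cmod z)\<^sup>2 * Re z)) / Y\<^sup>2"
    using Y(1) by (simp add: add_divide_distrib power2_eq_square)
  also have "Re z * Y + (2 * (cmod z)\<^sup>2 - Re z - (cmod z)\<^sup>2 * Re z) = 2 * (Im z)\<^sup>2"
    unfolding Y(2) cmod_power2 by (simp add: power2_eq_square algebra_simps)
  finally show ?thesis using Y assms(2) by simp
qed

text \<open>\<open>q\<close> is \<open>t\<close> times the derivative of \<open>f\<close>; it
  vanishes at 1 and increases by \<open>conv\<close>, so \<open>f\<close> decreases before 1 and
  increases after it.\<close>

lemma saddle_mod_radial_min: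
  assumes R: "R_poly a b c z = 0" and z: "Im z \<noteq> 0" and \<delta>: "0 < \<delta>" "\<delta> < 1"
    and conv: "\<And>t. \<bar>t - 1\<bar> \<le> \<delta> \<Longrightarrow> radial_convexity a b (Re z) ((cmod z)\<^sup>2) t > 0"
    and t: "\<bar>t - 1\<bar> \<le> \<delta>" "t \<noteq> 1"
  shows "saddle_mod a b c (of_real t * z) > saddle_mod a b c z"
proof -
  define X where "X = Re z"
  define P where "P = (cmod z)\<^sup>2"
  have z0: "z \<noteq> 0" using z by auto
  have P: "P > 0" using z0 by (simp add: P_def)
  define Y where "Y = (\<lambda>t. 1 - 2 * t * X + t\<^sup>2 * P)"
  have Yeq: "(cmod (1 - of_real t * z))\<^sup>2 = Y t" for t
    by (simp add: cmod_one_minus_sq Y_def X_def P_def norm_mult power_mult_distrib)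
  have Y: "Y t > 0" if "t \<noteq> 0" for t
  proof -
    have "1 - of_real t * z \<noteq> 0" using z that by (auto simp: complex_eq_iff)
    thus ?thesis unfolding Yeq[symmetric] by simp
  qed
  define q where "q = (\<lambda>t. b * X * t - a * X / (P * t) + c + (t\<^sup>2 * P - X * t) / Y t)"
  define f where "f = (\<lambda>t. b * X * t + a * X / (P * t) + c * ln t + ln (Y t) / 2)"
  have dY: "(Y has_real_derivative (- 2 * X + 2 * t * P)) (at t)" for t
    unfolding Y_def by (auto intro!: derivative_eq_intros)
  have dinv: "((\<lambda>t. a * X / (P * t)) has_real_derivative - (a * X / (P * t\<^sup>2))) (at t)" if "t > 0" for t
    using that P by (auto intro!: derivative_eq_intros simp: power2_eq_square field_simps)
  have dq: "(q has_real_derivative radial_convexity a b X P t) (at t)" if "t > 0" for t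
  proof -
    have Yt: "Y t \<noteq> 0" using Y[of t] that by auto
    have "(q has_real_derivative b * X - - (a * X / (P * t\<^sup>2)) + 0
       + ((2 * t * P - X) * Y t - (t\<^sup>2 * P - X * t) * (- 2 * X + 2 * t * P)) / (Y t * Y t)) (at t)"
      unfolding q_def using Yt
      by (intro DERIV_add DERIV_diff dinv that DERIV_const DERIV_divide dY)
         (auto intro!: derivative_eq_intros)
    moreover have "(2 * t * P - X) * Y t - (t\<^sup>2 * P - X * t) * (- 2 * X + 2 * t * P) = 2 * t * P - X - t\<^sup>2 * P * X"
      by (simp add: Y_def power2_eq_square algebra_simps)
    moreover have "radial_convexity a b X P t = b * X - - (a * X / (P * t\<^sup>2)) + 0
       + (2 * t * P - X - t\<^sup>2 * P * X) / (Y t * Y t)"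
      unfolding radial_convexity_def Y_def[symmetric] power2_eq_square[of "Y t", symmetric]
      by (simp add: Y_def algebra_simps)
    ultimately show ?thesis by (simp only:)
  qed
  have df: "(f has_real_derivative q t / t) (at t)" if "t > 0" for t
  proof -
    have Yt: "Y t > 0" using Y[of t] that by auto
    have "(f has_real_derivative b * X + - (a * X / (P * t\<^sup>2)) + c * (1 / t) + ((- 2 * X + 2 * t * P) / Y t) / 2) (at t)"
      unfolding f_def using Yt that
      by (intro DERIV_add dinv DERIV_cmult DERIV_cdivide)
         (auto intro!: derivative_eq_intros dY)
    moreover have "b * X + - (a * X / (P * t\<^sup>2)) + c * (1 / t) + ((- 2 * X + 2 * t * P) / Y t) / 2 = q t / t"
      using that Yt P by (simp add: q_def field_simps power2_eq_square)
    ultimately show ?thesis by simp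
  qed
  have Vf: "saddle_mod a b c (of_real t * z) = exp (f t) * cmod z powr c" if "t > 0" for t
  proof -
    have "Re (inverse (of_real t * z)) = X / (P * t)"
      unfolding Re_inverse using that z0 by (simp add: norm_mult power_mult_distrib X_def P_def power2_eq_square)
    moreover have "cmod (1 - of_real t * z) = exp (ln (Y t) / 2)"
    proof -
      have "cmod (1 - of_real t * z) = sqrt (Y t)" using Yeq[of t] by (metis norm_ge_zero real_sqrt_unique)
      thus ?thesis using Y[of t] that by (simp add: powr_half_sqrt[symmetric] powr_def)
    qed
    moreover have "cmod (of_real t * z) powr c = exp (c * ln t) * cmod z powr c"
      using that by (simp add: norm_mult powr_mult) (simp add: powr_def)
    ultimately show ?thesis
      unfolding saddle_mod_def f_def exp_add by (simp add: X_def mult_ac)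
  qed
  have q1: "q 1 = 0"
    using R_poly_zero_nonreal(2)[OF R z] by (simp add: q_def X_def P_def Y_def cmod_one_minus_sq)
  have tpos: "s > 0" if "\<bar>s - 1\<bar> \<le> \<delta>" for s using that \<delta> by linarith
  have "f 1 < f t"
  proof (cases "t > 1")
    case True
    show ?thesis
    proof (rule DERIV_pos_imp_increasing_open[OF True])
      fix s assume s: "1 < s" "s < t"
      have "q 1 < q s"
      proof (rule DERIV_pos_imp_increasing[OF s(1)])
        fix v assume "1 \<le> v" "v \<le> s"
        thus "\<exists>y. (q has_real_derivative y) (at v) \<and> 0 < y"
          using dq[of v] conv[of v] s t unfolding X_def P_def by (intro exI conjI) auto
      qed
      thus "\<exists>y. (f has_real_derivative y) (at s) \<and> 0 < y" using df[of s] s q1 by (intro exI[of _ "q s / s"]) auto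
    next
      show "continuous_on {1..t} f"
        by (intro continuous_at_imp_continuous_on ballI DERIV_isCont[OF df]) auto
    qed
  next
    case False
    hence t1: "t < 1" using t by simp
    show ?thesis
    proof (rule DERIV_neg_imp_decreasing_open[OF t1])
      fix s assume s: "t < s" "s < 1"
      have "q s < q 1"
      proof (rule DERIV_pos_imp_increasing[OF s(2)])
        fix v assume v: "s \<le> v" "v \<le> 1"
        have "\<bar>v - 1\<bar> \<le> \<delta>" using v s t by linarith
        thus "\<exists>y. (q has_real_derivative y) (at v) \<and> 0 < y"
          using dq[of v] conv[of v] tpos[of v] unfolding X_def P_def by (intro exI conjI) auto
      qed
      hence "q s / s < 0" using q1 tpos[of s] s t by (intro divide_neg_pos) linarith+
      thus "\<exists>y. (f has_real_derivative y) (at s) \<and> y < 0" using df[of s] tpos[of s] s t by (intro exI[of _ "q s / s"]) auto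
    next
      show "continuous_on {t..1} f"
        by (intro continuous_at_imp_continuous_on ballI DERIV_isCont[OF df]) (use tpos[OF t(1)] in auto)
    qed
  qed
  thus ?thesis using Vf[OF tpos[OF t(1)]] Vf[of 1] z0 by simp
qed

text \<open>The product of the distances from \<open>z\<close> to the three perturbed roots is the
  modulus of the perturbed polynomial at \<open>z\<close> divided by \<open>bN N\<close>, hence
  tends to 0; it bounds the cube of the least distance.\<close>

lemma R_poly_roots_converge:
  fixes aN bN cN :: "nat \<Rightarrow> real"
  assumes lim: "aN \<longlonglongrightarrow> a" "bN \<longlonglongrightarrow> b" "cN \<longlonglongrightarrow> c" and b: "b > 0" and R: "R_poly a b c z = 0"
  obtains zN where "zN \<longlonglongrightarrow> z" "\<forall>\<^sub>F N in sequentially. R_poly (aN N) (bN N) (cN N) (zN N) = 0"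
proof -
  have "\<exists>w. bN N > 0 \<longrightarrow> R_poly (aN N) (bN N) (cN N) w = 0 \<and> bN N * cmod (z - w) ^ 3 \<le> cmod (R_poly (aN N) (bN N) (cN N) z)" for N
  proof (cases "bN N > 0")
    case True
    hence b0: "bN N \<noteq> 0" by simp
    obtain z1 z2 z3 where f: "\<And>z. R_poly (aN N) (bN N) (cN N) z = - of_real (bN N) * ((z - z1) * (z - z2) * (z - z3))"
      by (rule R_poly_factor[OF b0, of "aN N" "cN N"]) (rule that)
    have n: "cmod (R_poly (aN N) (bN N) (cN N) z) = bN N * (cmod (z - z1) * cmod (z - z2) * cmod (z - z3))"
      unfolding f using True by (simp add: norm_mult)
    define m where "m = Min {cmod (z - z1), cmod (z - z2), cmod (z - z3)}"
    have m: "m \<le> cmod (z - z1)" "m \<le> cmod (z - z2)" "m \<le> cmod (z - z3)" by (auto simp: m_def)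
    have "m \<in> {cmod (z - z1), cmod (z - z2), cmod (z - z3)}" unfolding m_def by (rule Min_in) auto
    then obtain w where w: "w \<in> {z1, z2, z3}" "m = cmod (z - w)" by auto
    have m0: "m \<ge> 0" using w by simp
    have "m ^ 3 \<le> cmod (z - z1) * cmod (z - z2) * cmod (z - z3)"
      unfolding power3_eq_cube using m m0 by (intro mult_mono) auto
    hence "bN N * cmod (z - w) ^ 3 \<le> cmod (R_poly (aN N) (bN N) (cN N) z)"
      unfolding n w(2)[symmetric] using True by (intro mult_left_mono) auto
    moreover have "R_poly (aN N) (bN N) (cN N) w = 0" using w f by auto
    ultimately show ?thesis by blast
  qed auto
  then obtain zN where zN: "\<And>N. bN N > 0 \<Longrightarrow> R_poly (aN N) (bN N) (cN N) (zN N) = 0"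
    "\<And>N. bN N > 0 \<Longrightarrow> bN N * cmod (z - zN N) ^ 3 \<le> cmod (R_poly (aN N) (bN N) (cN N) z)" by metis
  have ev: "\<forall>\<^sub>F N in sequentially. bN N > 0" using lim(2) b by (rule order_tendstoD(1))
  have "(\<lambda>N. cmod (R_poly (aN N) (bN N) (cN N) z) / bN N) \<longlonglongrightarrow> cmod (R_poly a b c z) / b"
    unfolding R_poly_def using b by (intro tendsto_intros lim) auto
  hence l0: "(\<lambda>N. cmod (R_poly (aN N) (bN N) (cN N) z) / bN N) \<longlonglongrightarrow> 0" using R by simp
  have "(\<lambda>N. cmod (z - zN N) ^ 3) \<longlonglongrightarrow> 0"
  proof (rule tendsto_sandwich[OF _ _ tendsto_const l0])
    show "\<forall>\<^sub>F N in sequentially. cmod (z - zN N) ^ 3 \<le> cmod (R_poly (aN N) (bN N) (cN N) z) / bN N"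
      using ev by eventually_elim (use zN(2) in \<open>simp add: field_simps\<close>)
  qed simp
  hence "(\<lambda>N. root 3 (cmod (z - zN N) ^ 3)) \<longlonglongrightarrow> root 3 0" by (rule tendsto_real_root)
  hence "(\<lambda>N. cmod (z - zN N)) \<longlonglongrightarrow> 0" by (simp add: real_root_power_cancel)
  hence "(\<lambda>N. dist (zN N) z) \<longlonglongrightarrow> 0" by (simp add: dist_norm norm_minus_commute)
  hence "zN \<longlonglongrightarrow> z" by (subst tendsto_dist_iff)
  moreover have "\<forall>\<^sub>F N in sequentially. R_poly (aN N) (bN N) (cN N) (zN N) = 0"
    using ev by eventually_elim (use zN(1) in auto)
  ultimately show ?thesis by (rule that)
qed

section \<open>Elementary estimates for the singular integrals\<close>

lemma sin_ge_third:
  fixes x :: real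
  assumes "0 \<le> x" "x \<le> 2" shows "x / 3 \<le> sin x"
proof -
  have "\<bar>sin x - (\<Sum>m<3. sin_coeff m * x ^ m)\<bar> \<le> inverse (fact 3) * \<bar>x\<bar> ^ 3"
    by (rule Maclaurin_sin_bound)
  moreover have "(\<Sum>m<3. sin_coeff m * x ^ m) = x"
    by (simp add: numeral_3_eq_3 sin_coeff_def)
  ultimately have "\<bar>sin x - x\<bar> * 6 \<le> x ^ 3" using assms by (simp add: fact_numeral)
  moreover have "x - sin x \<le> \<bar>sin x - x\<bar>" by simp
  ultimately have "(x - sin x) * 6 \<le> x ^ 3"
    by (meson mult_right_mono order_trans zero_le_numeral)
  hence "x - x ^ 3 / 6 \<le> sin x" by (simp add: field_simps)
  \<comment> \<open>The range up to 2 serves half of an angular difference of at most 4.\<close>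
  moreover have "x ^ 3 \<le> 4 * x"
    using assms mult_mono[of x 2 x 2] by (simp add: power3_eq_cube mult_right_mono)
  ultimately show ?thesis by linarith
qed

lemma cis_dist_ge:
  assumes "\<bar>s - t\<bar> \<le> 4" shows "\<bar>s - t\<bar> / 3 \<le> cmod (cis s - cis t)"
proof -
  have "cis s - cis t = cis t * (exp (\<i> * of_real (s - t)) - 1)"
  proof -
    have "exp (\<i> * of_real (s - t)) = cis (s - t)" by (simp add: cis_conv_exp)
    thus ?thesis by (simp add: right_diff_distrib cis_mult)
  qed
  hence n: "cmod (cis s - cis t) = 2 * \<bar>sin ((s - t) / 2)\<bar>"
    by (simp only: norm_mult norm_cis dist_exp_i_1 mult_1)
  have y: "0 \<le> \<bar>(s - t) / 2\<bar>" "\<bar>(s - t) / 2\<bar> \<le> 2" using assms by auto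
  have "sin \<bar>(s - t) / 2\<bar> \<le> \<bar>sin ((s - t) / 2)\<bar>" by (cases "s \<ge> t") (simp_all add: abs_if)
  hence "\<bar>(s - t) / 2\<bar> / 3 \<le> \<bar>sin ((s - t) / 2)\<bar>" using sin_ge_third[OF y] by (rule order_trans[rotated])
  thus ?thesis unfolding n by (simp add: abs_divide)
qed

text \<open>The exponent balances two needs: for \<open>y\<close> of size \<open>n * m^2\<close> it
  leaves a decaying factor \<open>n powr (- 1/8)\<close>, while the cost
  \<open>m powr (- 1/4)\<close>, together with \<open>m powr (- 1/2)\<close> from the inner
  integral, stays integrable in \<open>m\<close>.\<close>

lemma exp_minus_le_powr:
  fixes y :: real
  assumes "y > 0" shows "exp (- y) \<le> y powr (- (1/8))"
proof -
  have "ln y \<le> y - 1" using assms by (rule ln_le_minus_one)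
  hence "- y \<le> - (1/8) * ln y" using assms by linarith
  thus ?thesis using assms by (simp add: powr_def)
qed

lemma singular_integral_bound:
  fixes f :: "real \<Rightarrow> complex"
  assumes ab: "\<alpha> \<le> \<beta>" and f: "f integrable_on {\<alpha>..\<beta>}" and X: "finite X" and C: "C \<ge> 0"
    and \<theta>: "\<theta> = \<alpha> \<or> \<theta> = \<beta>"
    and le: "\<And>t. t \<in> {\<alpha>..\<beta>} - X \<Longrightarrow> cmod (f t) \<le> C * \<bar>t - \<theta>\<bar> powr (- (3/4))"
  shows "cmod (integral {\<alpha>..\<beta>} f) \<le> C * (4 * (\<beta> - \<alpha>) powr (1/4))"
proof -
  have "((\<lambda>t. \<bar>t - \<theta>\<bar> powr (- (3/4))) has_integral 4 * (\<beta> - \<alpha>) powr (1/4)) {\<alpha>..\<beta>}"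
  proof (cases "\<theta> = \<alpha>")
    case True
    have "((\<lambda>t. \<bar>t - \<theta>\<bar> powr (- (3/4))) has_integral
        4 * (\<beta> - \<alpha>) powr (1/4) - 4 * (\<alpha> - \<alpha>) powr (1/4)) {\<alpha>..\<beta>}"
    proof (rule fundamental_theorem_of_calculus_interior[OF ab])
      show "continuous_on {\<alpha>..\<beta>} (\<lambda>t. 4 * (t - \<alpha>) powr (1/4))"
        by (intro continuous_intros continuous_on_powr') auto
      fix t assume "t \<in> {\<alpha><..<\<beta>}"
      hence t: "t - \<alpha> > 0" by simp
      have "((\<lambda>t. 4 * (t - \<alpha>) powr (1/4)) has_real_derivative 4 * ((1/4) * (t - \<alpha>) powr (1/4 - 1) * 1)) (at t)"
        using t by (auto intro!: derivative_eq_intros)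
      thus "((\<lambda>t. 4 * (t - \<alpha>) powr (1/4)) has_vector_derivative \<bar>t - \<theta>\<bar> powr (- (3/4))) (at t)"
        using t True by (simp add: has_real_derivative_iff_has_vector_derivative)
    qed
    thus ?thesis by simp
  next
    case False
    hence T: "\<theta> = \<beta>" using \<theta> by simp
    have "((\<lambda>t. \<bar>t - \<theta>\<bar> powr (- (3/4))) has_integral
        - 4 * (\<beta> - \<beta>) powr (1/4) - - 4 * (\<beta> - \<alpha>) powr (1/4)) {\<alpha>..\<beta>}"
    proof (rule fundamental_theorem_of_calculus_interior[OF ab])
      show "continuous_on {\<alpha>..\<beta>} (\<lambda>t. - 4 * (\<beta> - t) powr (1/4))"
        by (intro continuous_intros continuous_on_powr') auto
      fix t assume "t \<in> {\<alpha><..<\<beta>}"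
      hence t: "\<beta> - t > 0" by simp
      have "((\<lambda>t. - 4 * (\<beta> - t) powr (1/4)) has_real_derivative - 4 * ((1/4) * (\<beta> - t) powr (1/4 - 1) * (0 - 1))) (at t)"
        using t by (auto intro!: derivative_eq_intros)
      thus "((\<lambda>t. - 4 * (\<beta> - t) powr (1/4)) has_vector_derivative \<bar>t - \<theta>\<bar> powr (- (3/4))) (at t)"
        using t T by (simp add: has_real_derivative_iff_has_vector_derivative abs_minus_commute)
    qed
    thus ?thesis by simp
  qed
  hence g: "((\<lambda>t. C * \<bar>t - \<theta>\<bar> powr (- (3/4))) has_integral C * (4 * (\<beta> - \<alpha>) powr (1/4))) {\<alpha>..\<beta>}"
    by (rule has_integral_mult_right)
  define f' where "f' = (\<lambda>t. if t \<in> X then 0 else f t)"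
  have "integral {\<alpha>..\<beta>} f = integral {\<alpha>..\<beta>} f'"
    by (rule integral_spike[of X]) (use X in \<open>auto simp: f'_def\<close>)
  moreover have "f' integrable_on {\<alpha>..\<beta>}"
    by (rule integrable_spike_finite[OF X _ f]) (auto simp: f'_def)
  hence "cmod (integral {\<alpha>..\<beta>} f') \<le> integral {\<alpha>..\<beta>} (\<lambda>t. C * \<bar>t - \<theta>\<bar> powr (- (3/4)))"
    by (rule integral_norm_bound_integral[OF _ has_integral_integrable[OF g]])
       (use le C in \<open>auto simp: f'_def\<close>)
  ultimately show ?thesis unfolding integral_unique[OF g] by simp
qed

lemma ln_one_plus_le_sqrt:
  assumes "x \<ge> 0" shows "ln (1 + x) \<le> 2 * sqrt (x::real)"
proof -
  have "ln (1 + x) = 2 * ln (sqrt (1 + x))" using assms by (simp add: ln_sqrt)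
  also have "ln (sqrt (1 + x)) \<le> sqrt (1 + x) - 1" using assms by (intro ln_le_minus_one) auto
  also have "sqrt (1 + x) \<le> 1 + sqrt x" using sqrt_add_le_add_sqrt[of 1 x] assms by simp
  finally show ?thesis by simp
qed

text \<open>The integral of \<open>1 / (\<kappa> * x + d)\<close> is logarithmic in
  \<open>d\<close>; it is weakened to a square root so that powers of \<open>d\<close> can be
  combined later.\<close>

lemma radial_segment_bound:
  assumes z: "z \<noteq> 0" "\<tau> \<noteq> 1" and d: "d > 0" and B: "B \<ge> 0"
    and f: "continuous_on (closed_segment z (of_real \<tau> * z)) f"
    and le: "\<And>x. 0 \<le> x \<Longrightarrow> x \<le> 1 \<Longrightarrow>
      cmod (f (linepath z (of_real \<tau> * z) x)) \<le> B / (\<bar>\<tau> - 1\<bar> * cmod z * x + d)"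
  shows "cmod (contour_integral (linepath z (of_real \<tau> * z)) f) \<le> B * (2 * sqrt (\<bar>\<tau> - 1\<bar> * cmod z / d))"
proof -
  define \<kappa> where "\<kappa> = \<bar>\<tau> - 1\<bar> * cmod z"
  have \<kappa>: "\<kappa> > 0" using z by (simp add: \<kappa>_def)
  have n: "cmod (of_real \<tau> * z - z) = \<kappa>"
  proof -
    have "of_real \<tau> * z - z = of_real (\<tau> - 1) * z" by (simp add: algebra_simps)
    thus ?thesis by (simp only: norm_mult norm_of_real \<kappa>_def)
  qed
  have int: "f contour_integrable_on linepath z (of_real \<tau> * z)"
    using f by (intro contour_integrable_continuous_linepath)
  hence I: "((\<lambda>x. f (linepath z (of_real \<tau> * z) x) * (of_real \<tau> * z - z)) has_integral
      contour_integral (linepath z (of_real \<tau> * z)) f) {0..1}"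
    by (simp add: has_contour_integral_linepath[symmetric] has_contour_integral_integral)
  have g: "((\<lambda>x. B * (\<kappa> / (\<kappa> * x + d))) has_integral B * (ln (\<kappa> * 1 + d) - ln (\<kappa> * 0 + d))) {0..1}"
  proof (intro has_integral_mult_right fundamental_theorem_of_calculus)
    fix x :: real assume x: "x \<in> {0..1}"
    hence p: "\<kappa> * x + d > 0" using \<kappa> d by (simp add: add_nonneg_pos)
    hence "((\<lambda>x. ln (\<kappa> * x + d)) has_real_derivative \<kappa> / (\<kappa> * x + d)) (at x within {0..1})"
      by (auto intro!: derivative_eq_intros)
    thus "((\<lambda>x. ln (\<kappa> * x + d)) has_vector_derivative \<kappa> / (\<kappa> * x + d)) (at x within {0..1})"
      by (simp add: has_real_derivative_iff_has_vector_derivative)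
  qed simp
  have "cmod (contour_integral (linepath z (of_real \<tau> * z)) f) \<le> B * (ln (\<kappa> * 1 + d) - ln (\<kappa> * 0 + d))"
    unfolding integral_unique[OF I, symmetric] integral_unique[OF g, symmetric]
  proof (rule integral_norm_bound_integral[OF has_integral_integrable[OF I] has_integral_integrable[OF g]])
    fix x :: real assume "x \<in> {0..1}"
    hence "cmod (f (linepath z (of_real \<tau> * z) x)) * \<kappa> \<le> B / (\<kappa> * x + d) * \<kappa>"
      using le[of x] \<kappa> unfolding \<kappa>_def by (intro mult_right_mono) auto
    thus "cmod (f (linepath z (of_real \<tau> * z) x) * (of_real \<tau> * z - z)) \<le> B * (\<kappa> / (\<kappa> * x + d))"
      by (simp add: norm_mult n)
  qed
  also have "ln (\<kappa> * 1 + d) - ln (\<kappa> * 0 + d) = ln (1 + \<kappa> / d)"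
  proof -
    have "\<kappa> * 1 + d = (1 + \<kappa> / d) * d" using d by (simp add: field_simps)
    moreover have "1 + \<kappa> / d > 0" using \<kappa> d by (simp add: add_pos_pos)
    ultimately show ?thesis using d by (simp add: ln_mult)
  qed
  also have "\<dots> \<le> 2 * sqrt (\<kappa> / d)" using \<kappa> d by (intro ln_one_plus_le_sqrt) simp
  finally show ?thesis using B by (simp add: \<kappa>_def mult_left_mono)
qed

section \<open>The \<open>w\<close>-contour through the moving critical point\<close>

lemma kernel_num_cnj: "kernel_num gp gm n x (cnj u) = cnj (kernel_num gp gm n x u)"
  by (simp add: kernel_num_def kernel_weight_def exp_cnj)

text \<open>For large \<open>N\<close>, \<open>zN N\<close> is critical for \<open>VN N\<close>. The
  bounds for \<open>F N\<close> on the circle and for \<open>G N\<close> on the contour are both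
  stated relative to its level \<open>VZ N\<close>, so that the powers cancel.\<close>

locale nonreal_saddle = kernel_scaling +
  fixes z :: complex and zN :: "nat \<Rightarrow> complex"
  assumes z_root: "R_poly a b c z = 0" and z_Im: "Im z > 0" and zN_lim: "zN \<longlonglongrightarrow> z"
    and zN_root: "\<forall>\<^sub>F N in sequentially. R_poly (gp N / n N) (gm N / n N) (x N / n N) (zN N) = 0"
begin

abbreviation \<rho> where "\<rho> N \<equiv> cmod (zN N)"
abbreviation VZ where "VZ N \<equiv> VN N (zN N)"

lemma z_nonzero: "z \<noteq> 0" using z_Im by auto

lemma \<rho>_lim: "\<rho> \<longlonglongrightarrow> cmod z"
  by (intro tendsto_norm zN_lim)

lemma VZ_lim: "VZ \<longlonglongrightarrow> V z"
  unfolding saddle_mod_def using z_nonzero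
  by (intro tendsto_intros a_lim b_lim c_lim zN_lim) auto

lemma zN_Im: "\<forall>\<^sub>F N in sequentially. Im (zN N) > Im z / 2"
  using tendsto_Im[OF zN_lim] z_Im by (intro order_tendstoD(1)) auto

lemma V_circle: "cmod u = cmod z \<Longrightarrow> V u \<le> V z"
proof -
  assume u: "cmod u = cmod z"
  have "V u \<le> V z * exp (- ((cmod (u - z) * cmod (u - cnj z))\<^sup>2 / (4 * (cmod z)\<^sup>2 * (1 + cmod z) ^ 4)))"
    by (rule saddle_mod_circle_decay[OF z_root _ u]) (use z_Im in simp)
  also have "\<dots> \<le> V z * 1" by (intro mult_left_mono) auto
  finally show ?thesis by simp
qed

text \<open>One \<delta> has to serve all large \<open>N\<close>: positivity of the convexity at 1
  spreads to a neighbourhood in \<open>N\<close> and \<open>t\<close> jointly, by continuity in all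
  parameters.\<close>

lemma radial_interval:
  obtains \<delta> where "0 < \<delta>" "\<delta> < 1" "\<And>t. \<bar>t - 1\<bar> \<le> \<delta> \<Longrightarrow> t \<noteq> 1 \<Longrightarrow> V (of_real t * z) > V z"
    "\<forall>\<^sub>F N in sequentially. \<forall>t. \<bar>t - 1\<bar> \<le> \<delta> \<longrightarrow> VN N (of_real t * zN N) \<ge> VZ N"
proof -
  define f where "f = (\<lambda>N t. radial_convexity (gp N / n N) (gm N / n N) (Re (zN N)) ((cmod (zN N))\<^sup>2) t)"
  have z1: "1 - 2 * 1 * Re z + 1\<^sup>2 * (cmod z)\<^sup>2 \<noteq> 0"
  proof -
    have "1 - z \<noteq> 0" using z_Im by auto
    thus ?thesis using cmod_one_minus_sq[of z] by auto
  qed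
  have nz: "(cmod z)\<^sup>2 * 1\<^sup>2 \<noteq> 0" "(1 - 2 * 1 * Re z + 1\<^sup>2 * (cmod z)\<^sup>2)\<^sup>2 \<noteq> 0" using z_nonzero z1 by auto
  have lim: "((\<lambda>p. radial_convexity (gp (fst p) / n (fst p)) (gm (fst p) / n (fst p)) (Re (zN (fst p))) ((cmod (zN (fst p)))\<^sup>2) (snd p))
      \<longlongrightarrow> radial_convexity a b (Re z) ((cmod z)\<^sup>2) 1) (sequentially \<times>\<^sub>F nhds 1)"
    unfolding radial_convexity_def
    by (intro tendsto_intros filterlim_compose[OF a_lim filterlim_fst] filterlim_compose[OF b_lim filterlim_fst]
         filterlim_compose[OF zN_lim filterlim_fst] filterlim_snd nz)
  have "\<forall>\<^sub>F p in sequentially \<times>\<^sub>F nhds 1. f (fst p) (snd p) > 0"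
    unfolding f_def using radial_convexity_at_1[OF z_root] z_Im
    by (intro order_tendstoD(1)[OF lim]) auto
  then obtain P Q where PQ: "eventually P sequentially" "eventually Q (nhds 1)" "\<And>N t. P N \<Longrightarrow> Q t \<Longrightarrow> f N t > 0"
    unfolding eventually_prod_filter by auto
  have lim1: "((\<lambda>t. radial_convexity a b (Re z) ((cmod z)\<^sup>2) t) \<longlongrightarrow> radial_convexity a b (Re z) ((cmod z)\<^sup>2) 1) (nhds 1)"
    unfolding radial_convexity_def by (intro tendsto_intros nz filterlim_ident)
  have "\<forall>\<^sub>F t in nhds 1. radial_convexity a b (Re z) ((cmod z)\<^sup>2) t > 0"
    using radial_convexity_at_1[OF z_root] z_Im by (intro order_tendstoD(1)[OF lim1]) auto
  with PQ(2) have "\<forall>\<^sub>F t in nhds 1. Q t \<and> radial_convexity a b (Re z) ((cmod z)\<^sup>2) t > 0" by eventually_elim simp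
  then obtain e where e: "e > 0" "\<And>t. dist t 1 < e \<Longrightarrow> Q t \<and> radial_convexity a b (Re z) ((cmod z)\<^sup>2) t > 0"
    unfolding eventually_nhds_metric by blast
  define \<delta> where "\<delta> = min (e / 2) (1/2)"
  have \<delta>: "0 < \<delta>" "\<delta> < 1" "\<delta> < e" using e by (auto simp: \<delta>_def)
  show ?thesis
  proof (rule that[OF \<delta>(1,2)])
    fix t :: real assume t: "\<bar>t - 1\<bar> \<le> \<delta>" "t \<noteq> 1"
    show "V (of_real t * z) > V z"
      by (rule saddle_mod_radial_min[OF z_root _ \<delta>(1,2) _ t])
         (use z_Im e(2) \<delta>(3) in \<open>auto simp: dist_real_def\<close>)
  next
    show "\<forall>\<^sub>F N in sequentially. \<forall>t. \<bar>t - 1\<bar> \<le> \<delta> \<longrightarrow> VN N (of_real t * zN N) \<ge> VZ N"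
      using PQ(1) zN_root zN_Im
    proof (eventually_elim, intro allI impI)
      case (elim N)
      fix t :: real assume t: "\<bar>t - 1\<bar> \<le> \<delta>"
      show "VN N (of_real t * zN N) \<ge> VZ N"
      proof (cases "t = 1")
        case False
        have "radial_convexity (gp N / n N) (gm N / n N) (Re (zN N)) ((cmod (zN N))\<^sup>2) s > 0" if "\<bar>s - 1\<bar> \<le> \<delta>" for s
          using PQ(3)[OF elim(1), of s] e(2)[of s] that \<delta>(3) by (auto simp: f_def dist_real_def)
        hence "VN N (of_real t * zN N) > VZ N"
          using elim(3) z_Im by (intro saddle_mod_radial_min[OF elim(2) _ \<delta>(1,2) _ t False]) auto
        thus ?thesis by simp
      qed simp
    qed
  qed
qed

lemma V_z_pos: "V z > 0"
  by (rule saddle_mod_pos) (use z_Im in auto)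

lemma VZ_pos: "\<forall>\<^sub>F N in sequentially. VZ N > 0"
  using VZ_lim V_z_pos by (rule order_tendstoD(1))

text \<open>The critical point \<open>zN N\<close> moves with \<open>N\<close>: the second segment joins the radial one to a path \<open>g\<close> that
  does not depend on \<open>N\<close>.\<close>

definition arm :: "real \<Rightarrow> (real \<Rightarrow> complex) \<Rightarrow> nat \<Rightarrow> real \<Rightarrow> complex" where
  "arm \<tau> g N = linepath (zN N) (of_real \<tau> * zN N) +++ (linepath (of_real \<tau> * zN N) (of_real \<tau> * z) +++ g)"

lemma arm_simps:
  assumes "valid_path g" "pathstart g = of_real \<tau> * z"
  shows "valid_path (arm \<tau> g N)" "pathstart (arm \<tau> g N) = zN N" "pathfinish (arm \<tau> g N) = pathfinish g"
    "path_image (arm \<tau> g N) = closed_segment (zN N) (of_real \<tau> * zN N) \<union>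
       (closed_segment (of_real \<tau> * zN N) (of_real \<tau> * z) \<union> path_image g)"
  using assms by (auto simp: arm_def path_image_join intro!: valid_path_join)

text \<open>On the radial segment \<open>VN N\<close> is at least \<open>VZ N\<close>, and the
  distance from \<open>w\<close> to \<open>u\<close> is at least a fixed multiple of
  \<open>|w - zN N| + d\<close> with \<open>d = |u - zN N|\<close>, which leaves a logarithmic
  singularity in \<open>d\<close>. The rest of the arm lies where \<open>V\<close> exceeds a level
  \<open>V1 > V z\<close>.\<close>

lemma arm_bound:
  assumes \<delta>: "\<delta> < 1" "\<bar>\<tau> - 1\<bar> \<le> \<delta>" "\<tau> \<noteq> 1"
    and rad: "\<forall>\<^sub>F N in sequentially. \<forall>t. \<bar>t - 1\<bar> \<le> \<delta> \<longrightarrow> VN N (of_real t * zN N) \<ge> VZ N"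
    and g: "valid_path g" "pathstart g = of_real \<tau> * z"
      "path_image g \<subseteq> {w. w \<noteq> 0 \<and> w \<noteq> 1 \<and> cmod w \<noteq> cmod z \<and> V w > V z}"
  shows "\<exists>C\<ge>0. \<forall>\<^sub>F N in sequentially. path_image (arm \<tau> g N) \<subseteq> {w. Im w > 0} \<union> path_image g \<and>
     (\<forall>u. cmod u = \<rho> N \<longrightarrow> u \<noteq> zN N \<longrightarrow> path_image (arm \<tau> g N) \<subseteq> - {0, 1, u} \<and>
       cmod (contour_integral (arm \<tau> g N) (\<lambda>w. G N w / (w - u))) \<le> C / (VZ N ^ n N * sqrt (cmod (u - zN N))))"
proof -
  have "compact (path_image g)" using g(1) by (rule compact_valid_path_image)
  moreover have "path_image g \<subseteq> {w. V w > V z}" "0 \<notin> path_image g" using g(3) by auto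
  ultimately obtain V1 where V1: "V1 > V z" "path_image g \<subseteq> {w. V w > V1}" by (rule superlevel_gap)
  have V1p: "V1 > 0" using V1 V_z_pos by linarith
  have gV1: "path_image g \<subseteq> {w. w \<noteq> 0 \<and> w \<noteq> 1 \<and> cmod w \<noteq> cmod z \<and> V w > V1}" using g(3) V1(2) by auto
  define R where "R = cmod z + 1"
  have R: "R > 0" by (simp add: R_def add_nonneg_pos)
  have \<tau>0: "\<tau> > 0" "\<tau> \<le> 2" using \<delta> by linarith+
  define A where "A = {w. w \<noteq> 0 \<and> w \<noteq> 1 \<and> cmod w \<noteq> cmod z \<and> V w > V1} \<inter> {w. Im w > 0}"
  have "open A" unfolding A_def
    by (intro open_Int open_far_set open_Collect_less continuous_intros)
  moreover have "of_real \<tau> * z \<in> path_image g" using g(2) by (metis pathstart_in_path_image)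
  hence "of_real \<tau> * z \<in> A" using gV1 z_Im \<tau>0 by (auto simp: A_def)
  ultimately obtain e where e: "e > 0" "cball (of_real \<tau> * z) e \<subseteq> A" by (meson open_contains_cball)
  obtain C1 where C1: "C1 \<ge> 0" "\<forall>\<^sub>F N in sequentially. \<forall>u. cmod u = \<rho> N \<longrightarrow>
           cmod (contour_integral g (\<lambda>w. G N w / (w - u))) \<le> C1 / V1 ^ n N"
    using far_bound[OF g(1) gV1 V1p \<rho>_lim] by blast
  obtain C3 where C3: "\<forall>\<^sub>F N in sequentially. \<forall>u. cmod u = \<rho> N \<longrightarrow>
           (\<forall>w\<in>path_image g. w \<noteq> u \<and> cmod (G N w / (w - u)) \<le> C3 / V1 ^ n N)"
    using far_pointwise[OF compact_valid_path_image[OF g(1)] gV1 path_image_nonempty V1p \<rho>_lim] by blast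
  have cb: "cball (of_real \<tau> * z) e \<subseteq> {w. w \<noteq> 0 \<and> w \<noteq> 1 \<and> cmod w \<noteq> cmod z \<and> V w > V1}"
    "cball (of_real \<tau> * z) e \<noteq> {}"
    using e unfolding A_def by auto
  obtain C2 where C2: "C2 \<ge> 0" "\<forall>\<^sub>F N in sequentially. \<forall>u. cmod u = \<rho> N \<longrightarrow>
           (\<forall>w\<in>cball (of_real \<tau> * z) e. w \<noteq> u \<and> cmod (G N w / (w - u)) \<le> C2 / V1 ^ n N)"
    using far_pointwise[OF compact_cball cb V1p \<rho>_lim] by blast
  \<comment> \<open>A compact set off the real axis that contains the radial segments for all large
    \<open>N\<close>, so that \<open>\<phi>\<close> is bounded along them.\<close>
  define K0 where "K0 = cball 0 (2 * R) \<inter> {w::complex. (1 - \<delta>) * (Im z / 2) \<le> Im w}"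
  have K0p: "0 < (1 - \<delta>) * (Im z / 2)" using \<delta> z_Im by simp
  have "compact K0" unfolding K0_def
    by (intro compact_Int_closed compact_cball closed_Collect_le continuous_intros)
  moreover have "continuous_on K0 \<phi>"
    by (intro holomorphic_on_imp_continuous_on beta_integrand_holomorphic) (use K0p in \<open>auto simp: K0_def\<close>)
  ultimately have "compact (\<phi> ` K0)" using compact_continuous_image by blast
  then obtain M where M: "M > 0" "\<And>w. w \<in> K0 \<Longrightarrow> cmod (\<phi> w) \<le> M"
    using compact_imp_bounded bounded_pos by (metis imageI)
  \<comment> \<open>The summands belong to the radial segment, the connecting one and
    \<open>g\<close>. As \<open>d \<le> 2 * R\<close>, the factor \<open>sqrt (2 * R)\<close> allows
    dividing the last two by \<open>sqrt d\<close> as well.\<close>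
  define C where "C = (4 * M + C2 + C1) * sqrt (2 * R)"
  have C0: "C \<ge> 0" using M(1) C1 C2 R by (simp add: C_def)
  have "(\<lambda>N. of_real \<tau> * zN N) \<longlonglongrightarrow> of_real \<tau> * z" by (intro tendsto_intros zN_lim)
  hence ev1: "\<forall>\<^sub>F N in sequentially. dist (of_real \<tau> * zN N) (of_real \<tau> * z) < min e 1"
    using e(1) by (intro tendstoD) auto
  have ev2: "\<forall>\<^sub>F N in sequentially. VZ N < V1" using VZ_lim V1(1) by (rule order_tendstoD(2))
  have ev3: "\<forall>\<^sub>F N in sequentially. \<rho> N < R" using \<rho>_lim by (rule order_tendstoD(2)) (simp add: R_def)
  from ev1 ev2 ev3 zN_Im VZ_pos rad C1(2) C2(2) C3
  have "\<forall>\<^sub>F N in sequentially. path_image (arm \<tau> g N) \<subseteq> {w. Im w > 0} \<union> path_image g \<and>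
     (\<forall>u. cmod u = \<rho> N \<longrightarrow> u \<noteq> zN N \<longrightarrow> path_image (arm \<tau> g N) \<subseteq> - {0, 1, u} \<and>
       cmod (contour_integral (arm \<tau> g N) (\<lambda>w. G N w / (w - u))) \<le> C / (VZ N ^ n N * sqrt (cmod (u - zN N))))"
  proof eventually_elim
    case (elim N)
    let ?z = "zN N"
    have Imz: "Im ?z > 0" using elim(4) z_Im by linarith
    have \<rho>p: "\<rho> N > 0" using Imz by (metis norm_eq_zero norm_ge_zero order_le_less zero_complex.sel(2) less_irrefl)
    have lp: "linepath ?z (of_real \<tau> * ?z) x = of_real (1 + x * (\<tau> - 1)) * ?z" for x
      by (simp add: linepath_def scaleR_conv_of_real algebra_simps)
    have seg1: "\<exists>x. 0 \<le> x \<and> x \<le> 1 \<and> w = of_real (1 + x * (\<tau> - 1)) * ?z" if "w \<in> closed_segment ?z (of_real \<tau> * ?z)" for w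
      using that lp unfolding path_image_linepath[symmetric] path_image_def by force
    have tb: "\<bar>1 + x * (\<tau> - 1) - 1\<bar> \<le> \<delta>" "1 + x * (\<tau> - 1) \<ge> 1 - \<delta>" "1 + x * (\<tau> - 1) \<le> 2" if "0 \<le> x" "x \<le> 1" for x
    proof -
      have "\<bar>x * (\<tau> - 1)\<bar> \<le> 1 * \<delta>" unfolding abs_mult using that \<delta> by (intro mult_mono) auto
      thus "\<bar>1 + x * (\<tau> - 1) - 1\<bar> \<le> \<delta>" "1 + x * (\<tau> - 1) \<ge> 1 - \<delta>" "1 + x * (\<tau> - 1) \<le> 2" using \<delta>(1) by linarith+
    qed
    have near: "w \<in> K0 \<and> VN N w \<ge> VZ N \<and> Im w > 0 \<and> cmod w = (1 + x * (\<tau> - 1)) * \<rho> N"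
      if x: "0 \<le> x" "x \<le> 1" and w: "w = of_real (1 + x * (\<tau> - 1)) * ?z" for w x
    proof -
      have tp: "1 + x * (\<tau> - 1) > 0" using tb[OF x] \<delta>(1) by linarith
      have im: "(1 - \<delta>) * (Im z / 2) \<le> (1 + x * (\<tau> - 1)) * Im ?z"
        using tb[OF x] elim(4) z_Im \<delta>(1) by (intro mult_mono) auto
      have cw: "cmod w = (1 + x * (\<tau> - 1)) * \<rho> N"
        unfolding w norm_mult norm_of_real using tp by simp
      also have "\<dots> \<le> 2 * R" using tb[OF x] elim(3) tp by (intro mult_mono) auto
      finally have "w \<in> K0" using im by (simp add: K0_def w)
      moreover have "VN N w \<ge> VZ N" using elim(6) tb[OF x] unfolding w by blast
      moreover have "Im w > 0" using im K0p unfolding w by simp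
      ultimately show ?thesis using cw by blast
    qed
    have conn: "closed_segment (of_real \<tau> * ?z) (of_real \<tau> * z) \<subseteq> cball (of_real \<tau> * z) e"
      using elim(1) e(1) by (intro closed_segment_subset) (auto simp: dist_commute)
    have upper: "path_image (arm \<tau> g N) \<subseteq> {w. Im w > 0} \<union> path_image g"
      unfolding arm_simps(4)[OF g(1,2)] using seg1 near conn e(2) unfolding A_def by blast
    show ?case
    proof (intro conjI upper allI impI)
      fix u assume u: "cmod u = \<rho> N" "u \<noteq> zN N"
      define d where "d = cmod (u - ?z)"
      have d: "d > 0" using u by (simp add: d_def)
      define f where "f = (\<lambda>w. G N w / (w - u))"
      have o: "open (- {0, 1, u})" by (intro open_Compl finite_imp_closed) auto
      have fh: "f holomorphic_on - {0, 1, u}" unfolding f_def by (intro holomorphic_intros G_holomorphic) auto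
      have s1: "closed_segment ?z (of_real \<tau> * ?z) \<subseteq> - {0, 1, u}"
      proof
        fix w assume "w \<in> closed_segment ?z (of_real \<tau> * ?z)"
        then obtain x where x: "0 \<le> x" "x \<le> 1" "w = of_real (1 + x * (\<tau> - 1)) * ?z" using seg1 by blast
        note nr = near[OF x]
        have "w \<noteq> u"
        proof
          assume "w = u"
          hence "(1 + x * (\<tau> - 1)) * \<rho> N = \<rho> N" using nr u by simp
          hence "1 + x * (\<tau> - 1) = 1" using \<rho>p by simp
          hence "w = ?z" using x(3) by simp
          thus False using \<open>w = u\<close> u by simp
        qed
        thus "w \<in> - {0, 1, u}" using nr by auto
      qed
      have s2: "closed_segment (of_real \<tau> * ?z) (of_real \<tau> * z) \<subseteq> - {0, 1, u}"
        using conn cb(1) elim(8) u(1) by blast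
      have s3: "path_image g \<subseteq> - {0, 1, u}" using gV1 elim(9) u(1) by blast
      show "path_image (arm \<tau> g N) \<subseteq> - {0, 1, u}"
        unfolding arm_simps(4)[OF g(1,2)] using s1 s2 s3 by blast
      have i1: "f contour_integrable_on linepath ?z (of_real \<tau> * ?z)"
        by (rule contour_integrable_holomorphic_simple[OF fh o]) (use s1 in auto)
      have i2: "f contour_integrable_on linepath (of_real \<tau> * ?z) (of_real \<tau> * z)"
        by (rule contour_integrable_holomorphic_simple[OF fh o]) (use s2 in auto)
      have i3: "f contour_integrable_on g"
        by (rule contour_integrable_holomorphic_simple[OF fh o g(1) s3])
      have sum: "contour_integral (arm \<tau> g N) f = contour_integral (linepath ?z (of_real \<tau> * ?z)) f
         + (contour_integral (linepath (of_real \<tau> * ?z) (of_real \<tau> * z)) f + contour_integral g f)"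
        unfolding arm_def using i1 i2 i3 g(1,2)
        by (subst contour_integral_join; (subst contour_integral_join)?) (auto intro!: contour_integrable_joinI valid_path_join)
      have d2: "d \<le> 2 * R"
      proof -
        have "d \<le> cmod u + cmod ?z" unfolding d_def by (rule norm_triangle_ineq4)
        thus ?thesis using u(1) elim(3) by linarith
      qed
      have far: "B / V1 ^ n N \<le> B * sqrt (2 * R) / (VZ N ^ n N * sqrt d)" if "B \<ge> 0" for B
      proof -
        have "B / V1 ^ n N \<le> B / VZ N ^ n N"
          using that elim(2,5) V1p by (intro divide_left_mono power_mono mult_pos_pos zero_less_power) auto
        moreover have "1 \<le> sqrt (2 * R) / sqrt d" using d d2 by simp
        hence "B / VZ N ^ n N * 1 \<le> B / VZ N ^ n N * (sqrt (2 * R) / sqrt d)"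
          using that elim(5) by (intro mult_left_mono) auto
        ultimately show ?thesis by simp
      qed
      have b3: "cmod (contour_integral g f) \<le> C1 * sqrt (2 * R) / (VZ N ^ n N * sqrt d)"
        using elim(7) u(1) far[OF C1(1)] unfolding f_def by (meson order_trans)
      have b2: "cmod (contour_integral (linepath (of_real \<tau> * ?z) (of_real \<tau> * z)) f) \<le> C2 * sqrt (2 * R) / (VZ N ^ n N * sqrt d)"
      proof -
        have "cmod (contour_integral (linepath (of_real \<tau> * ?z) (of_real \<tau> * z)) f)
            \<le> C2 / V1 ^ n N * cmod (of_real \<tau> * z - of_real \<tau> * ?z)"
          using i2 by (rule contour_integral_bound_linepath)
             (use C2(1) V1p elim(8) u(1) conn in \<open>auto simp: f_def\<close>)
        also have "\<dots> \<le> C2 / V1 ^ n N * 1"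
          using elim(1) C2(1) V1p by (intro mult_left_mono) (auto simp: dist_norm norm_minus_commute)
        finally show ?thesis using far[OF C2(1)] by linarith
      qed
      have b1: "cmod (contour_integral (linepath ?z (of_real \<tau> * ?z)) f) \<le> 4 * M * sqrt (2 * R) / (VZ N ^ n N * sqrt d)"
      proof -
        have "cmod (contour_integral (linepath ?z (of_real \<tau> * ?z)) f)
           \<le> (2 * M / VZ N ^ n N) * (2 * sqrt (\<bar>\<tau> - 1\<bar> * cmod ?z / (d / 2)))"
        proof (rule radial_segment_bound)
          show "continuous_on (closed_segment ?z (of_real \<tau> * ?z)) f"
            using fh s1 holomorphic_on_imp_continuous_on holomorphic_on_subset by blast
          fix x :: real assume x: "0 \<le> x" "x \<le> 1"
          define w where "w = of_real (1 + x * (\<tau> - 1)) * ?z"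
          note nr = near[OF x w_def]
          have w01: "w \<noteq> 0" "w \<noteq> 1" using nr by auto
          have wu: "w \<noteq> u"
          proof -
            have "w \<in> closed_segment ?z (of_real \<tau> * ?z)"
              unfolding path_image_linepath[symmetric] path_image_def w_def lp[symmetric] using x by auto
            thus ?thesis using s1 by blast
          qed
          have "w - ?z = of_real (x * (\<tau> - 1)) * ?z" by (simp add: w_def algebra_simps)
          hence wz: "cmod (w - ?z) = x * \<bar>\<tau> - 1\<bar> * \<rho> N" using x by (simp only: norm_mult norm_of_real abs_mult abs_of_nonneg)
          \<comment> \<open>On the ray through \<open>zN N\<close> the distance to
            \<open>zN N\<close> is a difference of moduli, hence at most the distance to any point
            \<open>u\<close> of the circle.\<close>
          have "cmod w - cmod u = x * (\<tau> - 1) * \<rho> N" using nr u by (simp add: algebra_simps)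
          hence "cmod (w - ?z) = \<bar>cmod w - cmod u\<bar>" unfolding wz using x \<rho>p by (simp add: abs_mult)
          also have "\<dots> \<le> cmod (w - u)" by (rule norm_triangle_ineq3)
          finally have le1: "cmod (w - ?z) \<le> cmod (w - u)" .
          have "d \<le> cmod (w - u) + cmod (w - ?z)"
            unfolding d_def using norm_triangle_ineq4[of "w - ?z" "w - u"] by simp
          hence "\<bar>\<tau> - 1\<bar> * cmod ?z * x + d / 2 \<le> 2 * cmod (w - u)" using le1 wz by (simp add: mult_ac)
          moreover have dp: "\<bar>\<tau> - 1\<bar> * cmod ?z * x + d / 2 > 0" using x d by (intro add_nonneg_pos) auto
          ultimately have q: "1 / cmod (w - u) \<le> 2 / (\<bar>\<tau> - 1\<bar> * cmod ?z * x + d / 2)"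
            using wu by (simp add: field_simps)
          have "cmod (f w) = cmod (\<phi> w) / VN N w ^ n N * (1 / cmod (w - u))"
            unfolding f_def norm_divide norm_G[OF w01] by simp
          also have "\<dots> \<le> M / VZ N ^ n N * (2 / (\<bar>\<tau> - 1\<bar> * cmod ?z * x + d / 2))"
          proof (rule mult_mono[OF _ q])
            show "cmod (\<phi> w) / VN N w ^ n N \<le> M / VZ N ^ n N"
              using M nr elim(5) by (intro frac_le power_mono) auto
          qed (use M elim(5) in auto)
          finally show "cmod (f (linepath ?z (of_real \<tau> * ?z) x)) \<le> 2 * M / VZ N ^ n N / (\<bar>\<tau> - 1\<bar> * cmod ?z * x + d / 2)"
            unfolding lp w_def[symmetric] by (simp add: mult.commute)
        qed (use \<rho>p \<delta>(3) d M(1) elim(5) in auto)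
        also have "sqrt (\<bar>\<tau> - 1\<bar> * cmod ?z / (d / 2)) \<le> sqrt (2 * R) / sqrt d"
        proof -
          have "\<bar>\<tau> - 1\<bar> * cmod ?z \<le> 1 * R" using \<delta> elim(3) R by (intro mult_mono) auto
          hence "\<bar>\<tau> - 1\<bar> * cmod ?z / (d / 2) \<le> R / (d / 2)" using d by (intro divide_right_mono) auto
          also have "R / (d / 2) = 2 * R / d" by simp
          finally show ?thesis unfolding real_sqrt_divide[symmetric] by (rule real_sqrt_le_mono)
        qed
        hence "(2 * M / VZ N ^ n N) * (2 * sqrt (\<bar>\<tau> - 1\<bar> * cmod ?z / (d / 2))) \<le> (2 * M / VZ N ^ n N) * (2 * (sqrt (2 * R) / sqrt d))"
          using M(1) elim(5) by (intro mult_left_mono) auto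
        finally show ?thesis by simp
      qed
      have "cmod (contour_integral (arm \<tau> g N) f) \<le> 4 * M * sqrt (2 * R) / (VZ N ^ n N * sqrt d)
         + (C2 * sqrt (2 * R) / (VZ N ^ n N * sqrt d) + C1 * sqrt (2 * R) / (VZ N ^ n N * sqrt d))"
        unfolding sum using b1 b2 b3 by (intro order_trans[OF norm_triangle_ineq] add_mono)
      also have "\<dots> = C / (VZ N ^ n N * sqrt d)" by (simp add: C_def add_divide_distrib distrib_right)
      finally show "cmod (contour_integral (arm \<tau> g N) (\<lambda>w. G N w / (w - u))) \<le> C / (VZ N ^ n N * sqrt (cmod (u - zN N)))"
        unfolding f_def d_def .
    qed
  qed
  with C0 show ?thesis by blast
qed

end

section \<open>Arcs of the circle and the pointwise limit of the integrand\<close>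

lemma connected_circle_arc_right:
  assumes "\<rho> > 0" shows "connected {u. cmod u = \<rho> \<and> Re u > X}"
proof -
  define I where "I = {t. \<bar>t\<bar> \<le> pi \<and> \<rho> * cos t > X}"
  \<comment> \<open>\<open>cos\<close> decreases in \<open>\<bar>t\<bar>\<close>, so the admissible
    angles form an interval around 0.\<close>
  have mem: "s \<in> I" if "t \<in> I" "\<bar>s\<bar> \<le> \<bar>t\<bar>" for s t
  proof -
    have "cos \<bar>t\<bar> \<le> cos \<bar>s\<bar>" using that by (intro cos_monotone_0_pi_le) (auto simp: I_def)
    hence "\<rho> * cos t \<le> \<rho> * cos s" using assms by simp
    thus ?thesis using that by (simp add: I_def)
  qed
  have "is_interval I"
    unfolding is_interval_1
  proof (intro ballI allI impI)
    fix a b x assume *: "a \<in> I" "b \<in> I" "a \<le> x \<and> x \<le> b"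
    hence "\<bar>x\<bar> \<le> \<bar>a\<bar> \<or> \<bar>x\<bar> \<le> \<bar>b\<bar>" by linarith
    thus "x \<in> I" using mem * by blast
  qed
  hence "connected I" by (rule is_interval_connected)
  hence "connected ((\<lambda>t. of_real \<rho> * cis t) ` I)"
    by (intro connected_continuous_image continuous_intros)
  also have "(\<lambda>t. of_real \<rho> * cis t) ` I = {u. cmod u = \<rho> \<and> Re u > X}"
  proof (intro equalityI subsetI)
    fix u assume "u \<in> {u. cmod u = \<rho> \<and> Re u > X}"
    hence u: "cmod u = \<rho>" "Re u > X" by auto
    have "u \<noteq> 0" using u assms by auto
    have eq: "u = of_real \<rho> * cis (Arg u)"
      using rcis_cmod_Arg[of u] u(1) by (simp add: rcis_def)
    have "Re u = \<rho> * cos (Arg u)" using arg_cong[OF eq, of Re] by simp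
    moreover have "\<bar>Arg u\<bar> \<le> pi" using mpi_less_Arg[of u] Arg_le_pi[of u] by linarith
    ultimately have "Arg u \<in> I" using u(2) by (simp add: I_def)
    thus "u \<in> (\<lambda>t. of_real \<rho> * cis t) ` I" using eq by blast
  qed (use assms in \<open>auto simp: I_def norm_mult\<close>)
  finally show ?thesis .
qed

lemma connected_circle_arc_left:
  assumes "\<rho> > 0" shows "connected {u. cmod u = \<rho> \<and> Re u < X}"
proof -
  have "connected (uminus ` {u. cmod u = \<rho> \<and> Re u > - X})"
    by (intro connected_continuous_image connected_circle_arc_right assms continuous_intros)
  also have "uminus ` {u. cmod u = \<rho> \<and> Re u > - X} = {u. cmod u = \<rho> \<and> Re u < X}"
  proof (intro equalityI subsetI)
    fix u assume "u \<in> {u. cmod u = \<rho> \<and> Re u < X}"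
    thus "u \<in> uminus ` {u. cmod u = \<rho> \<and> Re u > - X}" by (intro image_eqI[of _ _ "- u"]) auto
  qed auto
  finally show ?thesis .
qed

context nonreal_saddle
begin

text \<open>The inner arm, run backwards, leads from \<open>p1\<close> to \<open>zN N\<close>, the
  outer one on to \<open>p2\<close>; the path meets the circle only at \<open>zN N\<close>.\<close>

lemma saddle_loop:
  obtains \<gamma> p1 p2 C where "C \<ge> 0" "0 < p1" "p1 < 1" "1 < p2"
    "\<forall>\<^sub>F N in sequentially. upper_path p1 p2 (\<gamma> N) \<and> p1 < \<rho> N \<and> \<rho> N < p2 \<and>
      (\<forall>u. cmod u = \<rho> N \<longrightarrow> u \<noteq> zN N \<longrightarrow> path_image (\<gamma> N) \<subseteq> - {0, 1, u} \<and>
       cmod (contour_integral (\<gamma> N) (\<lambda>w. G N w / (w - u))) \<le> C / (VZ N ^ n N * sqrt (cmod (u - zN N))))"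
proof -
  obtain \<delta> where \<delta>: "0 < \<delta>" "\<delta> < 1" "\<And>t. \<bar>t - 1\<bar> \<le> \<delta> \<Longrightarrow> t \<noteq> 1 \<Longrightarrow> V (of_real t * z) > V z"
    "\<forall>\<^sub>F N in sequentially. \<forall>t. \<bar>t - 1\<bar> \<le> \<delta> \<longrightarrow> VN N (of_real t * zN N) \<ge> VZ N"
    by (rule radial_interval, rule that; assumption)
  define \<tau>1 where "\<tau>1 = 1 + \<delta>"
  define \<tau>2 where "\<tau>2 = 1 - \<delta>"
  have \<tau>: "\<bar>\<tau>1 - 1\<bar> \<le> \<delta>" "\<tau>1 \<noteq> 1" "\<bar>\<tau>2 - 1\<bar> \<le> \<delta>" "\<tau>2 \<noteq> 1" "\<tau>1 > 1" "0 < \<tau>2" "\<tau>2 < 1"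
    using \<delta>(1,2) by (auto simp: \<tau>1_def \<tau>2_def)
  have zp: "cmod z > 0" using z_nonzero by simp
  have b0: "b \<noteq> 0" using b_pos by simp
  have V1: "V (of_real \<tau>1 * z) > V z" and V2: "V (of_real \<tau>2 * z) > V z" using \<delta>(3) \<tau> by auto
  have c1: "cmod (of_real \<tau>1 * z) > cmod z" "cmod (of_real \<tau>2 * z) < cmod z" "of_real \<tau>2 * z \<noteq> 0"
    using \<tau> zp z_nonzero by (auto simp: norm_mult)
  have Im12: "Im (of_real \<tau>1 * z) > 0" "Im (of_real \<tau>2 * z) > 0" using \<tau> z_Im by auto
  have V10: "V 1 = 0" by (simp add: saddle_mod_def)
  obtain s0 where s0: "cmod z \<le> s0" "s0 < cmod (of_real \<tau>1 * z)" "full_radii a b c {s0<..} (V z)"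
    using full_radii_outer[where \<rho> = "cmod z" and ?w0.0 = "of_real \<tau>1 * z", OF b0 zp V_z_pos V_circle c1(1) V1] by blast
  obtain s1 where s1: "cmod (of_real \<tau>2 * z) < s1" "s1 \<le> cmod z" "full_radii a b c {0<..<s1} (V z)"
    using full_radii_inner[where \<rho> = "cmod z" and ?w0.0 = "of_real \<tau>2 * z", OF b0 V_z_pos V_circle c1(3,2) V2] by blast
  have s1p: "s1 > 0" using s1(1) norm_ge_zero[of "of_real \<tau>2 * z"] by linarith
  obtain p2 where p2: "p2 > s0" "p2 > 1" "V (of_real p2) > V z"
    using full_radii_large_real[OF s0(3) a_pos b_pos] by blast
  obtain p1 where p1: "0 < p1" "p1 < s1" "p1 < 1" "V (of_real p1) > V z"
    using full_radii_small_real[OF s1(3) a_pos b_pos s1p zero_less_one] by blast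
  have "of_real \<tau>1 * z \<in> upper_region a b c {s0<..} (V z)" using s0 Im12 V1 by (simp add: upper_region_def)
  moreover have "\<bar>p2\<bar> \<in> {s0<..}" using p2 by auto
  ultimately obtain g1 where g1: "valid_path g1" "pathstart g1 = of_real \<tau>1 * z" "pathfinish g1 = of_real p2"
    "path_image g1 \<subseteq> insert (of_real p2) (upper_region a b c {s0<..} (V z))"
    using region_path_to_real[OF s0(3) _ _ p2(3)] by blast
  have "of_real \<tau>2 * z \<in> upper_region a b c {0<..<s1} (V z)" using s1 Im12 V2 c1(3) by (simp add: upper_region_def)
  moreover have "\<bar>p1\<bar> \<in> {0<..<s1}" using p1 by auto
  ultimately obtain g2 where g2: "valid_path g2" "pathstart g2 = of_real \<tau>2 * z" "pathfinish g2 = of_real p1"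
    "path_image g2 \<subseteq> insert (of_real p1) (upper_region a b c {0<..<s1} (V z))"
    using region_path_to_real[OF s1(3) _ _ p1(4)] by blast
  have i1: "path_image g1 \<subseteq> {w. w \<noteq> 0 \<and> w \<noteq> 1 \<and> cmod w \<noteq> cmod z \<and> V w > V z}"
    using g1(4) p2 s0(1) zp V10 V_z_pos by (auto simp: upper_region_def subset_iff)
  have i2: "path_image g2 \<subseteq> {w. w \<noteq> 0 \<and> w \<noteq> 1 \<and> cmod w \<noteq> cmod z \<and> V w > V z}"
    using g2(4) p1 s1(2) zp V10 V_z_pos by (auto simp: upper_region_def subset_iff)
  obtain C1 where C1: "C1 \<ge> 0" "\<forall>\<^sub>F N in sequentially. path_image (arm \<tau>1 g1 N) \<subseteq> {w. Im w > 0} \<union> path_image g1 \<and>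
     (\<forall>u. cmod u = \<rho> N \<longrightarrow> u \<noteq> zN N \<longrightarrow> path_image (arm \<tau>1 g1 N) \<subseteq> - {0, 1, u} \<and>
       cmod (contour_integral (arm \<tau>1 g1 N) (\<lambda>w. G N w / (w - u))) \<le> C1 / (VZ N ^ n N * sqrt (cmod (u - zN N))))"
    using arm_bound[OF \<delta>(2) \<tau>(1,2) \<delta>(4) g1(1,2) i1] by blast
  obtain C2 where C2: "C2 \<ge> 0" "\<forall>\<^sub>F N in sequentially. path_image (arm \<tau>2 g2 N) \<subseteq> {w. Im w > 0} \<union> path_image g2 \<and>
     (\<forall>u. cmod u = \<rho> N \<longrightarrow> u \<noteq> zN N \<longrightarrow> path_image (arm \<tau>2 g2 N) \<subseteq> - {0, 1, u} \<and>
       cmod (contour_integral (arm \<tau>2 g2 N) (\<lambda>w. G N w / (w - u))) \<le> C2 / (VZ N ^ n N * sqrt (cmod (u - zN N))))"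
    using arm_bound[OF \<delta>(2) \<tau>(3,4) \<delta>(4) g2(1,2) i2] by blast
  define \<gamma> where "\<gamma> = (\<lambda>N. reversepath (arm \<tau>2 g2 N) +++ arm \<tau>1 g1 N)"
  note arm1 = arm_simps[OF g1(1,2)] and arm2 = arm_simps[OF g2(1,2)]
  have ev1: "\<forall>\<^sub>F N in sequentially. p1 < \<rho> N" using \<rho>_lim by (rule order_tendstoD(1)) (use p1 s1 in linarith)
  have ev2: "\<forall>\<^sub>F N in sequentially. \<rho> N < p2" using \<rho>_lim by (rule order_tendstoD(2)) (use p2 s0 in linarith)
  show ?thesis
  proof (rule that[of "C1 + C2" p1 p2 \<gamma>])
    show "\<forall>\<^sub>F N in sequentially. upper_path p1 p2 (\<gamma> N) \<and> p1 < \<rho> N \<and> \<rho> N < p2 \<and>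
      (\<forall>u. cmod u = \<rho> N \<longrightarrow> u \<noteq> zN N \<longrightarrow> path_image (\<gamma> N) \<subseteq> - {0, 1, u} \<and>
       cmod (contour_integral (\<gamma> N) (\<lambda>w. G N w / (w - u))) \<le> (C1 + C2) / (VZ N ^ n N * sqrt (cmod (u - zN N))))"
      using C1(2) C2(2) ev1 ev2
    proof eventually_elim
      case (elim N)
      have pi: "path_image (\<gamma> N) = path_image (arm \<tau>2 g2 N) \<union> path_image (arm \<tau>1 g1 N)"
        unfolding \<gamma>_def using arm1 arm2 by (simp add: path_image_join)
      have "path_image (\<gamma> N) \<subseteq> {w. Im w > 0} \<union> (path_image g2 \<union> path_image g1)"
        unfolding pi using elim(1,2) by blast
      also have "\<dots> \<subseteq> {w. Im w > 0} \<union> {of_real p1, of_real p2}"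
        using g1(4) g2(4) by (auto simp: upper_region_def)
      finally have up: "upper_path p1 p2 (\<gamma> N)"
        unfolding upper_path_def \<gamma>_def using arm1 arm2 g1(3) g2(3) by (auto intro!: valid_path_join)
      have "path_image (\<gamma> N) \<subseteq> - {0, 1, u} \<and>
       cmod (contour_integral (\<gamma> N) (\<lambda>w. G N w / (w - u))) \<le> (C1 + C2) / (VZ N ^ n N * sqrt (cmod (u - zN N)))"
        if u: "cmod u = \<rho> N" "u \<noteq> zN N" for u
      proof -
        have a1: "path_image (arm \<tau>1 g1 N) \<subseteq> - {0, 1, u}"
          "cmod (contour_integral (arm \<tau>1 g1 N) (\<lambda>w. G N w / (w - u))) \<le> C1 / (VZ N ^ n N * sqrt (cmod (u - zN N)))"
          using elim(1) u by blast+
        have a2: "path_image (arm \<tau>2 g2 N) \<subseteq> - {0, 1, u}"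
          "cmod (contour_integral (arm \<tau>2 g2 N) (\<lambda>w. G N w / (w - u))) \<le> C2 / (VZ N ^ n N * sqrt (cmod (u - zN N)))"
          using elim(2) u by blast+
        have o: "open (- {0, 1, u})" by (intro open_Compl finite_imp_closed) auto
        have fh: "(\<lambda>w. G N w / (w - u)) holomorphic_on - {0, 1, u}"
          by (intro holomorphic_intros G_holomorphic) auto
        have i: "(\<lambda>w. G N w / (w - u)) contour_integrable_on arm \<tau>1 g1 N"
          "(\<lambda>w. G N w / (w - u)) contour_integrable_on arm \<tau>2 g2 N"
          using contour_integrable_holomorphic_simple[OF fh o] arm1(1) arm2(1) a1(1) a2(1) by blast+
        have "contour_integral (\<gamma> N) (\<lambda>w. G N w / (w - u))
            = - contour_integral (arm \<tau>2 g2 N) (\<lambda>w. G N w / (w - u)) + contour_integral (arm \<tau>1 g1 N) (\<lambda>w. G N w / (w - u))"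
          unfolding \<gamma>_def using i arm1 arm2
          by (subst contour_integral_join) (auto simp: contour_integral_reversepath contour_integrable_reversepath)
        hence "cmod (contour_integral (\<gamma> N) (\<lambda>w. G N w / (w - u)))
            \<le> cmod (contour_integral (arm \<tau>2 g2 N) (\<lambda>w. G N w / (w - u))) + cmod (contour_integral (arm \<tau>1 g1 N) (\<lambda>w. G N w / (w - u)))"
          by (metis norm_minus_cancel norm_triangle_ineq)
        also have "\<dots> \<le> C2 / (VZ N ^ n N * sqrt (cmod (u - zN N))) + C1 / (VZ N ^ n N * sqrt (cmod (u - zN N)))"
          by (intro add_mono a1 a2)
        also have "\<dots> = (C1 + C2) / (VZ N ^ n N * sqrt (cmod (u - zN N)))" by (simp add: add_divide_distrib)
        finally show ?thesis using pi a1(1) a2(1) by blast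
      qed
      thus ?case using up elim(3,4) by blast
    qed
  qed (use C1 C2 p1 p2 in auto)
qed

lemma G_cnj: "G N (cnj w) = cnj (G N w)"
  by (simp add: G_def kernel_num_cnj)

text \<open>Together with its mirror image the contour meets the circle only at \<open>zN N\<close>
  and its conjugate, so its winding number is 1 on the arc to the right and 0 on the arc to the
  left. The residue theorem thus gives \<open>F * H\<close> on the right and
  \<open>F * H - \<phi>\<close> on the left; the bound sets the decay of \<open>F N\<close> along
  the circle against the square-root singularity of the contour integral.\<close>

lemma kernel_pointwise:
  assumes r: "0 < r" "r < 1" "0 < \<epsilon>" "\<epsilon> < 1 - r"
  shows "\<exists>C\<ge>0. \<forall>\<^sub>F N in sequentially. \<exists>H. regular_part_on (\<rho> N) (G N) H \<and>
    K r \<epsilon> N = 1 / (2 * of_real pi * \<i>) *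
       contour_integral (circlepath 0 (\<rho> N)) (\<lambda>u. (if k < 0 then 0 else \<phi> u) - F N u * H u) \<and>
    (\<forall>u. cmod u = \<rho> N \<longrightarrow> u \<noteq> 1 \<longrightarrow> u \<noteq> zN N \<longrightarrow> u \<noteq> cnj (zN N) \<longrightarrow>
       cmod ((if Re u > Re (zN N) then 0 else \<phi> u) - F N u * H u) \<le>
         C * real (n N) powr (- (1/8)) * min (cmod (u - zN N)) (cmod (u - cnj (zN N))) powr (- (3/4)))"
proof -
  obtain \<gamma> p1 p2 C where L: "C \<ge> 0" "0 < p1" "p1 < 1" "1 < p2"
    "\<forall>\<^sub>F N in sequentially. upper_path p1 p2 (\<gamma> N) \<and> p1 < \<rho> N \<and> \<rho> N < p2 \<and>
      (\<forall>u. cmod u = \<rho> N \<longrightarrow> u \<noteq> zN N \<longrightarrow> path_image (\<gamma> N) \<subseteq> - {0, 1, u} \<and>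
       cmod (contour_integral (\<gamma> N) (\<lambda>w. G N w / (w - u))) \<le> C / (VZ N ^ n N * sqrt (cmod (u - zN N))))"
    by (rule saddle_loop, rule that; assumption)
  define R where "R = cmod z + 1"
  \<comment> \<open>Of the two critical points the farther one is at distance at least
    \<open>Im z / 2\<close> from \<open>u\<close>, and \<open>R\<close> bounds the radius.\<close>
  define \<kappa> where "\<kappa> = (Im z / 2)\<^sup>2 / (4 * R\<^sup>2 * (1 + R) ^ 4)"
  have R: "R > 0" by (simp add: R_def add_nonneg_pos)
  have \<kappa>: "\<kappa> > 0" using R z_Im by (simp add: \<kappa>_def)
  have ev3: "\<forall>\<^sub>F N in sequentially. \<rho> N < R" using \<rho>_lim by (rule order_tendstoD(2)) (simp add: R_def)
  define C' where "C' = C * \<kappa> powr (- (1/8))"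
  have "C' \<ge> 0" using L(1) by (simp add: C'_def)
  moreover have "\<forall>\<^sub>F N in sequentially. \<exists>H. regular_part_on (\<rho> N) (G N) H \<and>
    K r \<epsilon> N = 1 / (2 * of_real pi * \<i>) *
       contour_integral (circlepath 0 (\<rho> N)) (\<lambda>u. (if k < 0 then 0 else \<phi> u) - F N u * H u) \<and>
    (\<forall>u. cmod u = \<rho> N \<longrightarrow> u \<noteq> 1 \<longrightarrow> u \<noteq> zN N \<longrightarrow> u \<noteq> cnj (zN N) \<longrightarrow>
       cmod ((if Re u > Re (zN N) then 0 else \<phi> u) - F N u * H u) \<le>
         C' * real (n N) powr (- (1/8)) * min (cmod (u - zN N)) (cmod (u - cnj (zN N))) powr (- (3/4)))"
    using L(5) ev3 zN_Im zN_root VZ_pos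
  proof eventually_elim
    case (elim N)
    let ?z = "zN N"
    have up: "upper_path p1 p2 (\<gamma> N)" and p\<rho>: "p1 < \<rho> N" "\<rho> N < p2" using elim(1) by auto
    have \<rho>p: "\<rho> N > 0" using p\<rho> L(2) by linarith
    obtain H where H: "regular_part_on (\<rho> N) (G N) H" "K r \<epsilon> N = 1 / (2 * of_real pi * \<i>) *
       contour_integral (circlepath 0 (\<rho> N)) (\<lambda>u. (if k < 0 then 0 else \<phi> u) - F N u * H u)"
      using kernel_circle[OF r \<rho>p] by blast
    have Imz: "Im ?z > 0" using elim(3) z_Im by linarith
    define W where "W = sym_loop (\<gamma> N)"
    note Wp = sym_loop_props[OF up, folded W_def]
    have p12: "p1 < p2" using L by linarith
    have w0: "winding_number W 0 = 0" using winding_sym_loop_real[OF up p12, of 0] L by (simp add: W_def)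
    have w1: "winding_number W 1 = 1" using winding_sym_loop_real[OF up p12, of 1] L by (simp add: W_def)
    have Winside: "path_image W \<subseteq> - {0, 1, u}" if u: "cmod u = \<rho> N" "u \<noteq> ?z" "u \<noteq> cnj ?z" for u
    proof -
      have "cmod (cnj u) = \<rho> N" "cnj u \<noteq> ?z" using u by (auto dest: arg_cong[of "cnj u" _ cnj])
      hence "path_image (\<gamma> N) \<subseteq> - {0, 1, cnj u}" "path_image (\<gamma> N) \<subseteq> - {0, 1, u}" using elim(1) u by blast+
      thus ?thesis unfolding Wp(3) by (force simp: complex_cnj_cancel_iff)
    qed
    have ReX: "\<bar>Re ?z\<bar> < \<rho> N"
    proof -
      have "(Re ?z)\<^sup>2 < (\<rho> N)\<^sup>2" using Imz by (simp add: cmod_power2)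
      thus ?thesis using \<rho>p by (metis abs_le_square_iff abs_of_pos not_less)
    qed
    have wr: "winding_number W u = 1" if u: "cmod u = \<rho> N" "Re u > Re ?z" for u
    proof -
      have "{u. cmod u = \<rho> N \<and> Re u > Re ?z} \<inter> path_image (sym_loop (\<gamma> N)) = {}"
        using Winside unfolding W_def by force
      thus ?thesis
        using winding_sym_loop[OF up p12, of "\<rho> N" "{u. cmod u = \<rho> N \<and> Re u > Re ?z}" u]
          connected_circle_arc_right[OF \<rho>p] u ReX p\<rho> \<rho>p by (simp add: W_def)
    qed
    have wl: "winding_number W u = 0" if u: "cmod u = \<rho> N" "Re u < Re ?z" for u
    proof -
      have "{u. cmod u = \<rho> N \<and> Re u < Re ?z} \<inter> path_image (sym_loop (\<gamma> N)) = {}"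
        using Winside unfolding W_def by force
      thus ?thesis
        using winding_sym_loop[OF up p12, of "- \<rho> N" "{u. cmod u = \<rho> N \<and> Re u < Re ?z}" u]
          connected_circle_arc_left[OF \<rho>p] u ReX p\<rho> \<rho>p L(2) by (simp add: W_def)
    qed
    have "cmod ((if Re u > Re ?z then 0 else \<phi> u) - F N u * H u) \<le>
         C' * real (n N) powr (- (1/8)) * min (cmod (u - ?z)) (cmod (u - cnj ?z)) powr (- (3/4))"
      if u: "cmod u = \<rho> N" "u \<noteq> 1" "u \<noteq> ?z" "u \<noteq> cnj ?z" for u
    proof -
      have u0: "u \<noteq> 0" using u \<rho>p by auto
      define d where "d = cmod (u - ?z)"
      define d' where "d' = cmod (u - cnj ?z)"
      define m where "m = min d d'"
      have mp: "m > 0" using u by (simp add: m_def d_def d'_def)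
      \<comment> \<open>The vertical line through \<open>zN N\<close> meets the circle only at
        \<open>zN N\<close> and its conjugate.\<close>
      have Re_ne: "Re u \<noteq> Re ?z"
      proof
        assume "Re u = Re ?z"
        moreover have "(Re u)\<^sup>2 + (Im u)\<^sup>2 = (Re ?z)\<^sup>2 + (Im ?z)\<^sup>2" using u(1) by (simp add: cmod_power2[symmetric])
        ultimately have "Im u = Im ?z \<or> Im u = - Im ?z" by (simp add: power2_eq_iff)
        thus False using \<open>Re u = Re ?z\<close> u(3,4) by (auto simp: complex_eq_iff)
      qed
      define I where "I = contour_integral W (\<lambda>w. G N w / (w - u))"
      have res: "I = 2 * of_real pi * \<i> * (winding_number W u * G N u + (H u - G N u))"
        unfolding I_def using regular_part_onD(2)[OF H(1) u(1,2) Wp(1,2) Winside[OF u(1,3,4)]] by (simp add: w0 w1)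
      have "2 * of_real pi * \<i> * ((if Re u > Re ?z then 0 else \<phi> u) - F N u * H u) = - (F N u * I)"
      proof (cases "Re u > Re ?z")
        case True
        thus ?thesis unfolding res wr[OF u(1) True] by simp
      next
        case False
        hence "Re u < Re ?z" using Re_ne by linarith
        thus ?thesis unfolding res wl[OF u(1) \<open>Re u < Re ?z\<close>] F_G[OF u0 u(2), of N, symmetric] by (simp add: algebra_simps)
      qed
      hence "2 * pi * cmod ((if Re u > Re ?z then 0 else \<phi> u) - F N u * H u) = cmod (F N u) * cmod I"
        by (metis norm_minus_cancel norm_mult norm_ii norm_numeral norm_of_real abs_of_pos pi_gt_zero mult.right_neutral)
      moreover have "cmod I \<le> 2 * C / (VZ N ^ n N * sqrt m)"
      proof -
        have o: "open (- {0, 1, u})" by (intro open_Compl finite_imp_closed) auto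
        have fh: "(\<lambda>w. G N w / (w - u)) holomorphic_on - {0, 1, u}"
          by (intro holomorphic_intros G_holomorphic) auto
        have "I = cnj (contour_integral (\<gamma> N) (cnj \<circ> (\<lambda>w. G N w / (w - u)) \<circ> cnj)) - contour_integral (\<gamma> N) (\<lambda>w. G N w / (w - u))"
          unfolding I_def W_def
          by (rule contour_integral_sym_loop[OF up _ fh o])
             (use Winside[OF u(1,3,4)] fh in \<open>auto simp: W_def intro: holomorphic_on_imp_continuous_on holomorphic_on_subset\<close>)
        also have "cnj \<circ> (\<lambda>w. G N w / (w - u)) \<circ> cnj = (\<lambda>w. G N w / (w - cnj u))"
          by (auto simp: G_cnj)
        finally have "cmod I \<le> cmod (contour_integral (\<gamma> N) (\<lambda>w. G N w / (w - cnj u))) + cmod (contour_integral (\<gamma> N) (\<lambda>w. G N w / (w - u)))"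
          by (metis complex_mod_cnj norm_triangle_ineq4)
        also have "\<dots> \<le> C / (VZ N ^ n N * sqrt (cmod (cnj u - ?z))) + C / (VZ N ^ n N * sqrt d)"
        proof (rule add_mono)
          have "cmod (cnj u) = \<rho> N" "cnj u \<noteq> ?z" using u by (auto dest: arg_cong[of "cnj u" _ cnj])
          thus "cmod (contour_integral (\<gamma> N) (\<lambda>w. G N w / (w - cnj u))) \<le> C / (VZ N ^ n N * sqrt (cmod (cnj u - ?z)))"
            using elim(1) by blast
          show "cmod (contour_integral (\<gamma> N) (\<lambda>w. G N w / (w - u))) \<le> C / (VZ N ^ n N * sqrt d)"
            unfolding d_def using elim(1) u by blast
        qed
        also have "cmod (cnj u - ?z) = d'"
          unfolding d'_def by (metis complex_cnj_cnj complex_cnj_diff complex_mod_cnj)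
        also have "C / (VZ N ^ n N * sqrt d') + C / (VZ N ^ n N * sqrt d) \<le> C / (VZ N ^ n N * sqrt m) + C / (VZ N ^ n N * sqrt m)"
        proof -
          have "C / (VZ N ^ n N * sqrt x) \<le> C / (VZ N ^ n N * sqrt m)" if "m \<le> x" for x
            using that mp L(1) elim(5) by (intro divide_left_mono mult_left_mono mult_pos_pos) auto
          thus ?thesis by (intro add_mono) (auto simp: m_def)
        qed
        finally show ?thesis by (simp add: mult.commute)
      qed
      moreover have "cmod (F N u) \<le> VZ N ^ n N * exp (- (real (n N) * \<kappa> * m\<^sup>2))"
      proof -
        define D where "D = (d * d')\<^sup>2 / (4 * (\<rho> N)\<^sup>2 * (1 + \<rho> N) ^ 4)"
        have "VN N u \<le> VZ N * exp (- D)"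
          unfolding D_def d_def d'_def using elim(4) Imz u(1) by (intro saddle_mod_circle_decay) auto
        also have "\<dots> \<le> VZ N * exp (- (\<kappa> * m\<^sup>2))"
        proof -
          have "cmod (?z - cnj ?z) \<le> cmod (u - cnj ?z) + cmod (u - ?z)"
            using norm_triangle_ineq4[of "u - cnj ?z" "u - ?z"] by simp
          moreover have "cmod (?z - cnj ?z) = 2 * Im ?z"
          proof -
            have "?z - cnj ?z = of_real (2 * Im ?z) * \<i>" by (simp add: complex_eq_iff)
            thus ?thesis using Imz by (simp add: norm_mult)
          qed
          ultimately have "max d d' \<ge> Im z / 2" using elim(3) unfolding d_def d'_def by linarith
          hence "m * (Im z / 2) \<le> min d d' * max d d'" using mp unfolding m_def by (intro mult_left_mono) auto
          also have "min d d' * max d d' = d * d'" by (auto simp: min_def max_def)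
          finally have "(m * (Im z / 2))\<^sup>2 \<le> (d * d')\<^sup>2" using mp z_Im by (intro power_mono) auto
          hence "(m * (Im z / 2))\<^sup>2 / (4 * R\<^sup>2 * (1 + R) ^ 4) \<le> D"
            unfolding D_def
          proof (rule frac_le[rotated])
            show "0 < 4 * (\<rho> N)\<^sup>2 * (1 + \<rho> N) ^ 4" 
            proof -
              have P: "1 + \<rho> N > 0" using \<rho>p by linarith
              show ?thesis
                by (rule mult_pos_pos[OF mult_pos_pos[OF _ zero_less_power[OF \<rho>p]] zero_less_power[OF P]]) simp
            qed
            show "4 * (\<rho> N)\<^sup>2 * (1 + \<rho> N) ^ 4 \<le> 4 * R\<^sup>2 * (1 + R) ^ 4"
              using \<rho>p elim(2) R by (intro mult_mono power_mono) auto
          qed auto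
          moreover have "(m * (Im z / 2))\<^sup>2 / (4 * R\<^sup>2 * (1 + R) ^ 4) = \<kappa> * m\<^sup>2"
            unfolding \<kappa>_def by (simp only: power_mult_distrib[of m] times_divide_eq_left mult.commute[of "m\<^sup>2"])
          ultimately have "\<kappa> * m\<^sup>2 \<le> D" by (simp only:)
          thus ?thesis using elim(5) by (intro mult_left_mono) auto
        qed
        finally have "VN N u ^ n N \<le> (VZ N * exp (- (\<kappa> * m\<^sup>2))) ^ n N" by (intro power_mono) auto
        thus ?thesis unfolding norm_F[OF u0] power_mult_distrib exp_of_nat_mult[symmetric] by (simp add: mult.assoc)
      qed
      moreover have "cmod (F N u) * cmod I \<le> X * Y" if "cmod I \<le> Y" "cmod (F N u) \<le> X" for X Y
        using that by (intro mult_mono) (auto intro: order_trans[OF norm_ge_zero])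
      ultimately have "2 * pi * cmod ((if Re u > Re ?z then 0 else \<phi> u) - F N u * H u)
          \<le> (VZ N ^ n N * exp (- (real (n N) * \<kappa> * m\<^sup>2))) * (2 * C / (VZ N ^ n N * sqrt m))"
        by (simp only:)
      also have "\<dots> = 2 * C * exp (- (real (n N) * \<kappa> * m\<^sup>2)) / sqrt m" using elim(5) by simp
      also have "\<dots> \<le> 2 * C * (real (n N) * \<kappa> * m\<^sup>2) powr (- (1/8)) / sqrt m"
        using n_pos[of N] \<kappa> mp L(1)
        by (intro divide_right_mono mult_left_mono exp_minus_le_powr) auto
      also have "\<dots> = 2 * (C' * real (n N) powr (- (1/8)) * m powr (- (3/4)))"
      proof -
        have "(real (n N) * \<kappa> * m\<^sup>2) powr (- (1/8)) = real (n N) powr (- (1/8)) * \<kappa> powr (- (1/8)) * m powr (- (1/4))"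
        proof -
          have "(m\<^sup>2) powr (- (1/8)) = m powr (- (1/4))"
            using mp powr_realpow[of m 2] powr_powr[of m 2 "- (1/8)"] by simp
          thus ?thesis using \<kappa> mp by (simp add: powr_mult)
        qed
        moreover have "m powr (- (1/4)) / sqrt m = m powr (- (3/4))"
          using mp by (simp add: powr_half_sqrt[symmetric] powr_diff[symmetric])
        ultimately show ?thesis unfolding C'_def
          by (simp only: times_divide_eq_right[symmetric] mult.assoc) (simp only: mult.left_commute mult.commute)
      qed
      finally have "pi * cmod ((if Re u > Re ?z then 0 else \<phi> u) - F N u * H u) \<le> C' * real (n N) powr (- (1/8)) * m powr (- (3/4))"
        by simp
      moreover have "1 * cmod ((if Re u > Re ?z then 0 else \<phi> u) - F N u * H u) \<le> pi * cmod ((if Re u > Re ?z then 0 else \<phi> u) - F N u * H u)"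
        using pi_gt3 by (intro mult_right_mono) auto
      ultimately show ?thesis unfolding m_def d_def d'_def by linarith
    qed
    with H show ?case by blast
  qed
  ultimately show ?thesis by blast
qed

end

section \<open>The incomplete beta limit\<close>

text \<open>For \<open>k \<ge> 0\<close> the primitive is needed on the whole positive axis, beyond
  the crossing interval \<open>(0,1)\<close>, because the circle may have radius 1 or more; the
  integrand then has no pole at 1.\<close>

lemma incomplete_beta_primitive:
  obtains P where
    "\<And>u. Im u \<noteq> 0 \<or> (if k \<ge> 0 then Re u > 0 else Re u < 0) \<Longrightarrow> (P has_field_derivative beta_integrand k l u) (at u)"
    "\<And>z. Im z > 0 \<Longrightarrow> incomplete_beta z k l = 1 / (2 * of_real pi * \<i>) * (P z - P (cnj z))"
proof -
  define S where "S = {u::complex. Im u \<noteq> 0 \<or> (if k \<ge> 0 then Re u > 0 else Re u < 0)}"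
  define p :: real where "p = (if k \<ge> 0 then 1 else -1)"
  have Seq: "S = {u. Im u \<noteq> 0 \<or> p * Re u > 0}" by (auto simp: S_def p_def)
  have "open S" unfolding Seq by (intro open_Collect_disj open_Collect_neq open_Collect_less continuous_intros)
  have p0: "p * p > 0" by (simp add: p_def)
  have "starlike S"
    unfolding starlike_def
  proof (intro bexI ballI subsetI)
    fix x w assume x: "x \<in> S" and w: "w \<in> closed_segment (of_real p) x"
    then obtain t where t: "0 \<le> t" "t \<le> 1" "w = (1 - t) *\<^sub>R of_real p + t *\<^sub>R x"
      by (auto simp: closed_segment_def)
    show "w \<in> S"
    proof (cases "Im w = 0")
      case True
      with t have tx: "t = 0 \<or> Im x = 0" by auto
      have "Re w = (1 - t) * p + t * Re x" unfolding t(3) by simp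
      from arg_cong[OF this, of "\<lambda>y. p * y"] have "p * Re w = (1 - t) * (p * p) + t * (p * Re x)"
        by (simp add: algebra_simps)
      moreover have "\<dots> > 0"
      proof (cases "t = 0")
        case False
        hence "p * Re x > 0" using tx x by (auto simp: Seq)
        hence "t * (p * Re x) > 0" using t(1) False by simp
        moreover have "(1 - t) * (p * p) \<ge> 0" using t(2) p0 by simp
        ultimately show ?thesis by linarith
      qed (use p0 in simp)
      ultimately show ?thesis by (simp add: Seq)
    qed (simp add: Seq)
  qed (use p0 in \<open>simp add: Seq\<close>)
  have hol: "beta_integrand k l holomorphic_on S"
    by (rule beta_integrand_holomorphic) (auto simp: S_def)
  obtain P where P: "\<And>u. u \<in> S \<Longrightarrow> (P has_field_derivative beta_integrand k l u) (at u)"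
    using holomorphic_starlike_primitive[OF holomorphic_on_imp_continuous_on[OF hol]
            \<open>starlike S\<close> \<open>open S\<close> finite.emptyI] hol \<open>open S\<close>
    by (auto simp: holomorphic_on_open field_differentiable_def)
  show ?thesis
  proof (rule that[of P])
    show "(P has_field_derivative beta_integrand k l u) (at u)"
      if "Im u \<noteq> 0 \<or> (if k \<ge> 0 then Re u > 0 else Re u < 0)" for u
      using P that by (simp add: S_def)
    show "incomplete_beta z k l = 1 / (2 * of_real pi * \<i>) * (P z - P (cnj z))" if z: "Im z > 0" for z
    proof -
      obtain g where g: "beta_path k z g" using beta_path_exists[OF z] by blast
      have "path_image g \<subseteq> S"
      proof
        fix u assume u: "u \<in> path_image g"
        show "u \<in> S"
        proof (cases "u \<in> \<real>")
          case True
          with u g show ?thesis by (auto simp: beta_path_def S_def beta_crossing_def split: if_splits)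
        qed (auto simp: S_def complex_is_Real_iff)
      qed
      hence "(beta_integrand k l has_contour_integral (P (pathfinish g) - P (pathstart g))) g"
        using g P by (intro contour_integral_primitive[of S])
          (auto simp: beta_path_def intro: has_field_derivative_at_within)
      hence "contour_integral g (beta_integrand k l) = P z - P (cnj z)"
        using g by (simp add: beta_path_def contour_integral_unique)
      thus ?thesis using incomplete_beta_eq[OF z g, of l] by (simp add: beta_integrand_def[abs_def])
    qed
  qed
qed

text \<open>The main term is integrated exactly through \<open>P\<close>; only the error sees the
  singularity at the end \<theta> of the arc.\<close>

lemma arc_integral_error:
  fixes E M P :: "complex \<Rightarrow> complex"
  assumes \<rho>: "\<rho> > 0" and ab: "\<alpha> \<le> \<beta>" "\<beta> - \<alpha> \<le> pi" and E: "continuous_on (sphere 0 \<rho>) E"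
    and P: "\<And>t. \<alpha> \<le> t \<Longrightarrow> t \<le> \<beta> \<Longrightarrow> (P has_field_derivative M (of_real \<rho> * cis t)) (at (of_real \<rho> * cis t))"
    and X: "finite X" and B: "B \<ge> 0" and \<theta>: "\<theta> = \<alpha> \<or> \<theta> = \<beta>"
    and le: "\<And>t. \<alpha> \<le> t \<Longrightarrow> t \<le> \<beta> \<Longrightarrow> t \<notin> X \<Longrightarrow>
       cmod (E (of_real \<rho> * cis t) - M (of_real \<rho> * cis t)) \<le> B * \<bar>t - \<theta>\<bar> powr (- (3/4))"
  shows "cmod (integral {\<alpha>..\<beta>} (\<lambda>t. E (of_real \<rho> * cis t) * (of_real \<rho> * \<i> * cis t))
      - (P (of_real \<rho> * cis \<beta>) - P (of_real \<rho> * cis \<alpha>))) \<le> B * \<rho> * (4 * pi powr (1/4))"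
proof -
  define g where "g = (\<lambda>t. of_real \<rho> * cis t)"
  define g' where "g' = (\<lambda>t. of_real \<rho> * \<i> * cis t)"
  have gd: "(g has_vector_derivative g' t) (at t within A)" for t A
    unfolding g_def g'_def by (auto intro!: derivative_eq_intros simp: has_vector_derivative_def scaleR_conv_of_real)
  have main: "((\<lambda>t. M (g t) * g' t) has_integral P (g \<beta>) - P (g \<alpha>)) {\<alpha>..\<beta>}"
  proof (rule fundamental_theorem_of_calculus[OF ab(1)])
    fix t assume t: "t \<in> {\<alpha>..\<beta>}"
    have "(P has_field_derivative M (g t)) (at (g t) within g ` {\<alpha>..\<beta>})"
      using P[of t] t unfolding g_def by (auto intro: has_field_derivative_at_within)
    from field_vector_diff_chain_within[OF gd this]
    have "((P \<circ> g) has_vector_derivative g' t * M (g t)) (at t within {\<alpha>..\<beta>})" .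
    thus "((\<lambda>t. P (g t)) has_vector_derivative M (g t) * g' t) (at t within {\<alpha>..\<beta>})"
      by (simp add: o_def mult.commute)
  qed
  have "continuous_on {\<alpha>..\<beta>} (\<lambda>t. E (g t) * g' t)"
    unfolding g'_def g_def using \<rho>
    by (intro continuous_intros continuous_on_compose2[OF E]) (auto simp: norm_mult)
  hence ei: "(\<lambda>t. E (g t) * g' t) integrable_on {\<alpha>..\<beta>}" by (rule integrable_continuous_real)
  have di: "(\<lambda>t. E (g t) * g' t - M (g t) * g' t) integrable_on {\<alpha>..\<beta>}"
    using ei has_integral_integrable[OF main] by (rule integrable_diff)
  have "integral {\<alpha>..\<beta>} (\<lambda>t. E (g t) * g' t) - (P (g \<beta>) - P (g \<alpha>)) = integral {\<alpha>..\<beta>} (\<lambda>t. E (g t) * g' t - M (g t) * g' t)"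
    using integral_diff[OF ei has_integral_integrable[OF main]] integral_unique[OF main] by simp
  also have "cmod \<dots> \<le> (B * \<rho>) * (4 * (\<beta> - \<alpha>) powr (1/4))"
  proof (rule singular_integral_bound[OF ab(1) di X _ \<theta>])
    fix t assume t: "t \<in> {\<alpha>..\<beta>} - X"
    have "cmod (E (g t) * g' t - M (g t) * g' t) = cmod (E (g t) - M (g t)) * \<rho>"
      unfolding left_diff_distrib[symmetric] norm_mult using \<rho> by (simp add: g'_def norm_mult)
    also have "\<dots> \<le> (B * \<bar>t - \<theta>\<bar> powr (- (3/4))) * \<rho>"
      using le[of t] t \<rho> unfolding g_def by (intro mult_right_mono) auto
    finally show "cmod (E (g t) * g' t - M (g t) * g' t) \<le> B * \<rho> * \<bar>t - \<theta>\<bar> powr (- (3/4))" by (simp add: mult_ac)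
  qed (use B \<rho> in auto)
  also have "\<dots> \<le> (B * \<rho>) * (4 * pi powr (1/4))"
    using ab B \<rho> by (intro mult_left_mono powr_mono2) auto
  finally show ?thesis unfolding g_def g'_def .
qed

text \<open>Cut at angle \<open>pi\<close> and at the base point as well as at \<open>z\<close> and
  \<open>cnj z\<close>, the circle falls into four arcs with one singular end each. The right-hand
  arcs meet at angle 0, where the values of \<open>Pr\<close> cancel, the left-hand ones at
  \<open>pi\<close>, where those of \<open>Pl\<close> do.\<close>

lemma circle_integral_two_arcs:
  fixes E Mr Ml Pr Pl :: "complex \<Rightarrow> complex"
  assumes z: "Im z > 0" and E: "continuous_on (sphere 0 (cmod z)) E" and B: "B \<ge> 0"
    and Pr: "\<And>u. Im u \<noteq> 0 \<or> Re u > 0 \<Longrightarrow> (Pr has_field_derivative Mr u) (at u)"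
    and Pl: "\<And>u. Im u \<noteq> 0 \<or> Re u < 0 \<Longrightarrow> (Pl has_field_derivative Ml u) (at u)"
    and le: "\<And>u. cmod u = cmod z \<Longrightarrow> u \<noteq> 1 \<Longrightarrow> u \<noteq> z \<Longrightarrow> u \<noteq> cnj z \<Longrightarrow>
       cmod (E u - (if Re u > Re z then Mr u else Ml u)) \<le> B * min (cmod (u - z)) (cmod (u - cnj z)) powr (- (3/4))"
  shows "cmod (contour_integral (circlepath 0 (cmod z)) E - ((Pr z - Pr (cnj z)) - (Pl z - Pl (cnj z))))
           \<le> 4 * (B * (cmod z / 3) powr (- (3/4)) * cmod z * (4 * pi powr (1/4)))"
proof -
  define \<rho> where "\<rho> = cmod z"
  define \<theta> where "\<theta> = Arg z"
  have z0: "z \<noteq> 0" using z by auto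
  have \<rho>: "\<rho> > 0" using z0 by (simp add: \<rho>_def)
  have \<theta>: "0 < \<theta>" "\<theta> < pi" using Arg_lt_pi[of z] z unfolding \<theta>_def by auto
  define g where "g = (\<lambda>t. of_real \<rho> * cis t)"
  have zg: "z = g \<theta>" unfolding g_def \<rho>_def \<theta>_def using rcis_cmod_Arg[of z] by (simp add: rcis_def)
  have czg: "cnj z = g (2 * pi - \<theta>)" unfolding zg g_def by (simp add: complex_eq_iff cos_diff sin_diff)
  have Reg: "Re (g t) = \<rho> * cos t" "Im (g t) = \<rho> * sin t" "cmod (g t) = \<rho>" for t using \<rho> by (auto simp: g_def norm_mult)
  have Rez: "Re z = \<rho> * cos \<theta>" using zg Reg(1)[of \<theta>] by simp
  define e where "e = (\<lambda>t. E (of_real \<rho> * cis t) * (of_real \<rho> * \<i> * cis t))"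
  define B' where "B' = B * (\<rho> / 3) powr (- (3/4))"
  have B': "B' \<ge> 0" using B by (simp add: B'_def)
  have E': "continuous_on (sphere 0 \<rho>) E" using E by (simp add: \<rho>_def)
  have ei: "e integrable_on {0..2*pi}"
    unfolding e_def using \<rho>
    by (intro integrable_continuous_real continuous_intros continuous_on_compose2[OF E']) (auto simp: norm_mult)
  have ci: "contour_integral (circlepath 0 \<rho>) E = integral {0..2*pi} e"
    unfolding circlepath_def e_def by (subst contour_integral_part_circlepath_eq) (auto simp: mult.assoc)
  have sub: "e integrable_on {s..t}" if "0 \<le> s" "t \<le> 2 * pi" for s t
    by (rule integrable_subinterval_real[OF ei]) (use that in auto)
  have split: "integral {0..2*pi} e = integral {0..\<theta>} e + integral {\<theta>..pi} e + (integral {pi..2*pi-\<theta>} e + integral {2*pi-\<theta>..2*pi} e)"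
    using \<theta> by (simp add: Henstock_Kurzweil_Integration.integral_combine sub ei)
  \<comment> \<open>At angles 0 and \<open>2 * pi\<close> the point may be 1; at the other two it is
    \<open>z\<close> or \<open>cnj z\<close>.\<close>
  define X where "X = {0, \<theta>, 2 * pi - \<theta>, 2 * pi}"
  have X: "finite X" by (simp add: X_def)
  have closer: "cmod (u - z) \<le> cmod (u - cnj z)" if "Im u \<ge> 0" for u
  proof -
    have "(cmod (u - z))\<^sup>2 \<le> (cmod (u - cnj z))\<^sup>2"
      unfolding cmod_power2 using that z by (simp add: power2_eq_square algebra_simps)
    thus ?thesis by (rule power2_le_imp_le) simp
  qed
  have closer': "cmod (u - cnj z) \<le> cmod (u - z)" if "Im u \<le> 0" for u
    using closer[of "cnj u"] that by (metis complex_cnj_cnj complex_cnj_diff complex_mod_cnj complex_cnj neg_0_le_iff_le cnj.sel(2))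
  have scale: "B * (\<rho> / 3 * \<bar>t\<bar>) powr (- (3/4)) = B' * \<bar>t\<bar> powr (- (3/4))" for t
    unfolding B'_def mult.assoc by (subst powr_mult) (use \<rho> in auto)
  have up: "cmod (E (g t) - (if Re (g t) > Re z then Mr (g t) else Ml (g t))) \<le> B' * \<bar>t - \<theta>\<bar> powr (- (3/4))"
    if t: "0 \<le> t" "t \<le> pi" "t \<notin> X" for t
  proof -
    have im: "Im (g t) \<ge> 0" unfolding Reg using t \<rho> by (simp add: sin_ge_zero)
    have "\<rho> / 3 * \<bar>t - \<theta>\<bar> \<le> \<rho> * cmod (cis t - cis \<theta>)"
      using cis_dist_ge[of t \<theta>] t \<theta> pi_less_4 \<rho> mult_left_mono[of "\<bar>t - \<theta>\<bar> / 3" "cmod (cis t - cis \<theta>)" \<rho>] by simp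
    also have "\<dots> = cmod (g t - z)"
      unfolding zg g_def right_diff_distrib[symmetric] norm_mult using \<rho> by simp
    finally have d: "\<rho> / 3 * \<bar>t - \<theta>\<bar> \<le> cmod (g t - z)" .
    have tn: "\<bar>t - \<theta>\<bar> > 0" using t by (simp add: X_def)
    hence pos: "\<rho> / 3 * \<bar>t - \<theta>\<bar> > 0" using \<rho> by simp
    have "g t \<noteq> z" using d pos by auto
    moreover have "g t \<noteq> cnj z" using im z by auto
    moreover have "g t \<noteq> 1"
    proof
      assume "g t = 1"
      hence "\<rho> * sin t = 0" "\<rho> * cos t = 1" using Reg[of t] by auto
      moreover have "sin t > 0 \<or> t = pi" using t sin_gt_zero[of t] by (auto simp: X_def)
      ultimately show False using \<rho> by auto
    qed
    ultimately have "cmod (E (g t) - (if Re (g t) > Re z then Mr (g t) else Ml (g t)))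
        \<le> B * min (cmod (g t - z)) (cmod (g t - cnj z)) powr (- (3/4))"
      using Reg(3)[of t] by (intro le) (auto simp: \<rho>_def)
    also have "min (cmod (g t - z)) (cmod (g t - cnj z)) = cmod (g t - z)" using closer[OF im] by simp
    also have "B * cmod (g t - z) powr (- (3/4)) \<le> B * (\<rho> / 3 * \<bar>t - \<theta>\<bar>) powr (- (3/4))"
      using B d pos by (intro mult_left_mono powr_mono2') auto
    also have "\<dots> = B' * \<bar>t - \<theta>\<bar> powr (- (3/4))" by (rule scale)
    finally show ?thesis .
  qed
  have down: "cmod (E (g t) - (if Re (g t) > Re z then Mr (g t) else Ml (g t))) \<le> B' * \<bar>t - (2 * pi - \<theta>)\<bar> powr (- (3/4))"
    if t: "pi \<le> t" "t \<le> 2 * pi" "t \<notin> X" for t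
  proof -
    have "sin t \<le> 0" using sin_ge_zero[of "2 * pi - t"] t by (simp add: sin_diff)
    hence im: "Im (g t) \<le> 0" unfolding Reg using \<rho> by (simp add: mult_le_0_iff)
    have "\<rho> / 3 * \<bar>t - (2 * pi - \<theta>)\<bar> \<le> \<rho> * cmod (cis t - cis (2 * pi - \<theta>))"
      using cis_dist_ge[of t "2 * pi - \<theta>"] t \<theta> pi_less_4 \<rho>
        mult_left_mono[of "\<bar>t - (2 * pi - \<theta>)\<bar> / 3" "cmod (cis t - cis (2 * pi - \<theta>))" \<rho>] by simp
    also have "\<dots> = cmod (g t - cnj z)"
      unfolding czg g_def right_diff_distrib[symmetric] norm_mult using \<rho> by simp
    finally have d: "\<rho> / 3 * \<bar>t - (2 * pi - \<theta>)\<bar> \<le> cmod (g t - cnj z)" .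
    have tn: "\<bar>t - (2 * pi - \<theta>)\<bar> > 0" using t by (simp add: X_def)
    hence pos: "\<rho> / 3 * \<bar>t - (2 * pi - \<theta>)\<bar> > 0" using \<rho> by simp
    have "g t \<noteq> cnj z" using d pos by auto
    moreover have "g t \<noteq> z" using im z by auto
    moreover have "g t \<noteq> 1"
    proof
      assume "g t = 1"
      hence "\<rho> * sin t = 0" "\<rho> * cos t = 1" using Reg[of t] by auto
      moreover have "sin t < 0 \<or> t = pi" using t sin_gt_zero[of "2 * pi - t"] by (auto simp: X_def sin_diff)
      ultimately show False using \<rho> by auto
    qed
    ultimately have "cmod (E (g t) - (if Re (g t) > Re z then Mr (g t) else Ml (g t)))
        \<le> B * min (cmod (g t - z)) (cmod (g t - cnj z)) powr (- (3/4))"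
      using Reg(3)[of t] by (intro le) (auto simp: \<rho>_def)
    also have "min (cmod (g t - z)) (cmod (g t - cnj z)) = cmod (g t - cnj z)" using closer'[OF im] by simp
    also have "B * cmod (g t - cnj z) powr (- (3/4)) \<le> B * (\<rho> / 3 * \<bar>t - (2 * pi - \<theta>)\<bar>) powr (- (3/4))"
      using B d pos by (intro mult_left_mono powr_mono2') auto
    also have "\<dots> = B' * \<bar>t - (2 * pi - \<theta>)\<bar> powr (- (3/4))" by (rule scale)
    finally show ?thesis .
  qed
  have right: "Re (g t) > Re z" if "(0 \<le> t \<and> t < \<theta>) \<or> (2 * pi - \<theta> < t \<and> t \<le> 2 * pi)" for t
  proof -
    have "cos t > cos \<theta>"
    proof (cases "t < \<theta> \<and> 0 \<le> t")
      case True
      thus ?thesis using \<theta> by (intro cos_monotone_0_pi) auto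
    next
      case False
      hence "2 * pi - \<theta> < t" "t \<le> 2 * pi" using that by auto
      hence "cos (2 * pi - t) > cos \<theta>" using \<theta> by (intro cos_monotone_0_pi) auto
      thus ?thesis by (simp add: cos_diff)
    qed
    thus ?thesis unfolding Reg Rez using \<rho> by simp
  qed
  have left: "\<not> Re (g t) > Re z" if "\<theta> \<le> t" "t \<le> 2 * pi - \<theta>" for t
  proof -
    have "cos t \<le> cos \<theta>"
    proof (cases "t \<le> pi")
      case True
      thus ?thesis using \<theta> that by (intro cos_monotone_0_pi_le) auto
    next
      case False
      hence "cos (2 * pi - t) \<le> cos \<theta>" using \<theta> that by (intro cos_monotone_0_pi_le) auto
      thus ?thesis by (simp add: cos_diff)
    qed
    thus ?thesis unfolding Reg Rez using \<rho> by simp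
  qed
  have Rdom: "Im (g t) \<noteq> 0 \<or> Re (g t) > 0" if "(0 \<le> t \<and> t \<le> \<theta>) \<or> (2 * pi - \<theta> \<le> t \<and> t \<le> 2 * pi)" for t
  proof (cases "t = 0 \<or> t = 2 * pi")
    case False
    have "sin t \<noteq> 0"
    proof (cases "t \<le> \<theta> \<and> 0 \<le> t")
      case True
      thus ?thesis using sin_gt_zero[of t] \<theta> False by auto
    next
      case False2: False
      hence "sin (2 * pi - t) > 0" using that \<theta> False by (intro sin_gt_zero) auto
      thus ?thesis by (simp add: sin_diff)
    qed
    thus ?thesis unfolding Reg using \<rho> by simp
  qed (use \<rho> in \<open>auto simp: Reg\<close>)
  have Ldom: "Im (g t) \<noteq> 0 \<or> Re (g t) < 0" if "\<theta> \<le> t" "t \<le> 2 * pi - \<theta>" for t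
  proof (cases "t = pi")
    case False
    have "sin t \<noteq> 0"
    proof (cases "t < pi")
      case True
      thus ?thesis using sin_gt_zero[of t] \<theta> that by auto
    next
      case False2: False
      hence "sin (2 * pi - t) > 0" using that \<theta> False by (intro sin_gt_zero) auto
      thus ?thesis by (simp add: sin_diff)
    qed
    thus ?thesis unfolding Reg using \<rho> by simp
  qed (use \<rho> in \<open>simp add: Reg\<close>)
  define Q where "Q = B' * \<rho> * (4 * pi powr (1/4))"
  have i1: "cmod (integral {0..\<theta>} e - (Pr (g \<theta>) - Pr (g 0))) \<le> Q"
    unfolding e_def g_def Q_def
  proof (rule arc_integral_error[OF \<rho> _ _ E' _ X B', where \<theta> = \<theta> and M = Mr])
    fix t assume t: "0 \<le> t" "t \<le> \<theta>"
    show "(Pr has_field_derivative Mr (of_real \<rho> * cis t)) (at (of_real \<rho> * cis t))"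
      using Pr[OF Rdom[of t]] t unfolding g_def by blast
    assume tX: "t \<notin> X"
    hence "t < \<theta>" using t by (auto simp: X_def)
    thus "cmod (E (of_real \<rho> * cis t) - Mr (of_real \<rho> * cis t)) \<le> B' * \<bar>t - \<theta>\<bar> powr (- (3/4))"
      using up[of t] right[of t] t tX \<theta> by (simp add: g_def)
  qed (use \<theta> in auto)
  have i2: "cmod (integral {\<theta>..pi} e - (Pl (g pi) - Pl (g \<theta>))) \<le> Q"
    unfolding e_def g_def Q_def
  proof (rule arc_integral_error[OF \<rho> _ _ E' _ X B', where \<theta> = \<theta> and M = Ml])
    fix t assume t: "\<theta> \<le> t" "t \<le> pi"
    have t2: "t \<le> 2 * pi - \<theta>" using t \<theta> by linarith
    show "(Pl has_field_derivative Ml (of_real \<rho> * cis t)) (at (of_real \<rho> * cis t))"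
      using Pl[OF Ldom[of t]] t t2 unfolding g_def by blast
    assume tX: "t \<notin> X"
    show "cmod (E (of_real \<rho> * cis t) - Ml (of_real \<rho> * cis t)) \<le> B' * \<bar>t - \<theta>\<bar> powr (- (3/4))"
      using up[of t] left[of t] t t2 tX \<theta> by (simp add: g_def)
  qed (use \<theta> in auto)
  have i3: "cmod (integral {pi..2*pi-\<theta>} e - (Pl (g (2*pi-\<theta>)) - Pl (g pi))) \<le> Q"
    unfolding e_def g_def Q_def
  proof (rule arc_integral_error[OF \<rho> _ _ E' _ X B', where \<theta> = "2 * pi - \<theta>" and M = Ml])
    fix t assume t: "pi \<le> t" "t \<le> 2 * pi - \<theta>"
    have t2: "\<theta> \<le> t" "t \<le> 2 * pi" using t \<theta> by linarith+
    show "(Pl has_field_derivative Ml (of_real \<rho> * cis t)) (at (of_real \<rho> * cis t))"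
      using Pl[OF Ldom[of t]] t t2 unfolding g_def by blast
    assume tX: "t \<notin> X"
    show "cmod (E (of_real \<rho> * cis t) - Ml (of_real \<rho> * cis t)) \<le> B' * \<bar>t - (2 * pi - \<theta>)\<bar> powr (- (3/4))"
      using down[of t] left[of t] t t2 tX by (simp add: g_def)
  qed (use \<theta> in auto)
  have i4: "cmod (integral {2*pi-\<theta>..2*pi} e - (Pr (g (2*pi)) - Pr (g (2*pi-\<theta>)))) \<le> Q"
    unfolding e_def g_def Q_def
  proof (rule arc_integral_error[OF \<rho> _ _ E' _ X B', where \<theta> = "2 * pi - \<theta>" and M = Mr])
    fix t assume t: "2 * pi - \<theta> \<le> t" "t \<le> 2 * pi"
    have t2: "pi \<le> t" using t \<theta> by linarith
    show "(Pr has_field_derivative Mr (of_real \<rho> * cis t)) (at (of_real \<rho> * cis t))"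
      using Pr[OF Rdom[of t]] t unfolding g_def by blast
    assume tX: "t \<notin> X"
    hence "2 * pi - \<theta> < t" using t by (auto simp: X_def)
    thus "cmod (E (of_real \<rho> * cis t) - Mr (of_real \<rho> * cis t)) \<le> B' * \<bar>t - (2 * pi - \<theta>)\<bar> powr (- (3/4))"
      using down[of t] right[of t] t t2 tX by (simp add: g_def)
  qed (use \<theta> in auto)
  have g02: "g (2 * pi) = g 0" by (simp add: g_def)
  have "contour_integral (circlepath 0 \<rho>) E - ((Pr z - Pr (cnj z)) - (Pl z - Pl (cnj z)))
     = (integral {0..\<theta>} e - (Pr (g \<theta>) - Pr (g 0))) + (integral {\<theta>..pi} e - (Pl (g pi) - Pl (g \<theta>)))
      + ((integral {pi..2*pi-\<theta>} e - (Pl (g (2*pi-\<theta>)) - Pl (g pi)))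
        + (integral {2*pi-\<theta>..2*pi} e - (Pr (g (2*pi)) - Pr (g (2*pi-\<theta>)))))"
    unfolding ci split czg[symmetric] zg[symmetric] g02 by (simp add: algebra_simps)
  also have "cmod \<dots> \<le> (Q + Q) + (Q + Q)"
    by (intro order_trans[OF norm_triangle_ineq] add_mono i1 i2 i3 i4 order_refl)
  finally show ?thesis by (simp add: Q_def B'_def \<rho>_def mult_ac)
qed

context nonreal_saddle
begin

text \<open>For \<open>k \<ge> 0\<close> the right arc from \<open>cnj (zN N)\<close> to
  \<open>zN N\<close> contributes \<open>\<phi>\<close>, for \<open>k < 0\<close> the left arc from
  \<open>zN N\<close> to \<open>cnj (zN N)\<close> contributes \<open>- \<phi>\<close>; either way
  the integral is \<open>P (zN N) - P (cnj (zN N))\<close>. Continuity of \<open>P\<close> then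
  leads from \<open>zN N\<close> to \<open>z\<close>.\<close>

lemma limit_nonreal:
  assumes r: "0 < r" "r < 1" "0 < \<epsilon>" "\<epsilon> < 1 - r"
  shows "K r \<epsilon> \<longlonglongrightarrow> incomplete_beta z k l"
proof -
  obtain P where P: "\<And>u. Im u \<noteq> 0 \<or> (if k \<ge> 0 then Re u > 0 else Re u < 0) \<Longrightarrow> (P has_field_derivative \<phi> u) (at u)"
    "\<And>z. Im z > 0 \<Longrightarrow> incomplete_beta z k l = 1 / (2 * of_real pi * \<i>) * (P z - P (cnj z))"
    by (rule incomplete_beta_primitive, rule that; assumption)
  obtain C where C: "C \<ge> 0" "\<forall>\<^sub>F N in sequentially. \<exists>H. regular_part_on (\<rho> N) (G N) H \<and>
    K r \<epsilon> N = 1 / (2 * of_real pi * \<i>) *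
       contour_integral (circlepath 0 (\<rho> N)) (\<lambda>u. (if k < 0 then 0 else \<phi> u) - F N u * H u) \<and>
    (\<forall>u. cmod u = \<rho> N \<longrightarrow> u \<noteq> 1 \<longrightarrow> u \<noteq> zN N \<longrightarrow> u \<noteq> cnj (zN N) \<longrightarrow>
       cmod ((if Re u > Re (zN N) then 0 else \<phi> u) - F N u * H u) \<le>
         C * real (n N) powr (- (1/8)) * min (cmod (u - zN N)) (cmod (u - cnj (zN N))) powr (- (3/4)))"
    using kernel_pointwise[OF r] by blast
  define Q where "Q = (\<lambda>N. 4 * (C * real (n N) powr (- (1/8)) * (\<rho> N / 3) powr (- (3/4)) * \<rho> N * (4 * pi powr (1/4))))"
  have bound: "\<forall>\<^sub>F N in sequentially.
     cmod (2 * of_real pi * \<i> * K r \<epsilon> N - (P (zN N) - P (cnj (zN N)))) \<le> Q N"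
    using C(2) zN_Im
  proof eventually_elim
    case (elim N)
    then obtain H where H: "regular_part_on (\<rho> N) (G N) H"
      "K r \<epsilon> N = 1 / (2 * of_real pi * \<i>) *
         contour_integral (circlepath 0 (\<rho> N)) (\<lambda>u. (if k < 0 then 0 else \<phi> u) - F N u * H u)"
      "\<forall>u. cmod u = \<rho> N \<longrightarrow> u \<noteq> 1 \<longrightarrow> u \<noteq> zN N \<longrightarrow> u \<noteq> cnj (zN N) \<longrightarrow>
       cmod ((if Re u > Re (zN N) then 0 else \<phi> u) - F N u * H u) \<le>
         C * real (n N) powr (- (1/8)) * min (cmod (u - zN N)) (cmod (u - cnj (zN N))) powr (- (3/4))"
      by blast
    have Imz: "Im (zN N) > 0" using elim(2) z_Im by linarith
    hence \<rho>p: "\<rho> N > 0" by auto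
    define E where "E = (\<lambda>u. (if k < 0 then 0 else \<phi> u) - F N u * H u)"
    have Ec: "continuous_on (sphere 0 (\<rho> N)) E"
    proof -
      have "continuous_on (sphere 0 (\<rho> N)) \<phi>" if "k \<ge> 0"
        using \<rho>p that by (intro holomorphic_on_imp_continuous_on beta_integrand_holomorphic) auto
      thus ?thesis unfolding E_def using regular_part_onD(1)[OF H(1)] continuous_on_F[OF \<rho>p, of N]
        by (cases "k < 0") (auto intro!: continuous_intros)
    qed
    have Bp: "C * real (n N) powr (- (1/8)) \<ge> 0" using C(1) by simp
    have "cmod (contour_integral (circlepath 0 (\<rho> N)) E - (P (zN N) - P (cnj (zN N)))) \<le> Q N"
    proof (cases "k \<ge> 0")
      case True
      have "cmod (contour_integral (circlepath 0 (\<rho> N)) E - ((P (zN N) - P (cnj (zN N))) - ((\<lambda>_. 0) (zN N) - (\<lambda>_. 0) (cnj (zN N))))) \<le> Q N"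
        unfolding Q_def
      proof (rule circle_integral_two_arcs[OF Imz Ec Bp, where Mr = \<phi> and Ml = "\<lambda>_. 0"])
        fix u assume "cmod u = \<rho> N" "u \<noteq> 1" "u \<noteq> zN N" "u \<noteq> cnj (zN N)"
        thus "cmod (E u - (if Re u > Re (zN N) then \<phi> u else 0)) \<le>
         C * real (n N) powr (- (1/8)) * min (cmod (u - zN N)) (cmod (u - cnj (zN N))) powr (- (3/4))"
          using H(3)[rule_format, of u] True by (auto simp: E_def)
      qed (use P(1) True in \<open>auto intro: DERIV_const\<close>)
      thus ?thesis by simp
    next
      case False
      have "cmod (contour_integral (circlepath 0 (\<rho> N)) E - (((\<lambda>_. 0) (zN N) - (\<lambda>_. 0) (cnj (zN N))) - ((\<lambda>u. - P u) (zN N) - (\<lambda>u. - P u) (cnj (zN N))))) \<le> Q N"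
        unfolding Q_def
      proof (rule circle_integral_two_arcs[OF Imz Ec Bp, where Ml = "\<lambda>u. - \<phi> u" and Mr = "\<lambda>_. 0"])
        fix u assume "cmod u = \<rho> N" "u \<noteq> 1" "u \<noteq> zN N" "u \<noteq> cnj (zN N)"
        thus "cmod (E u - (if Re u > Re (zN N) then 0 else - \<phi> u)) \<le>
         C * real (n N) powr (- (1/8)) * min (cmod (u - zN N)) (cmod (u - cnj (zN N))) powr (- (3/4))"
          using H(3)[rule_format, of u] False by (auto simp: E_def)
      qed (use P(1) False in \<open>auto intro: DERIV_const DERIV_minus\<close>)
      thus ?thesis by simp
    qed
    thus ?case using H(2) unfolding E_def by simp
  qed
  have "(\<lambda>N. real (n N) powr (- (1/8))) \<longlonglongrightarrow> 0"
    using n_lim by (intro tendsto_neg_powr filterlim_compose[OF filterlim_real_sequentially]) auto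
  hence "Q \<longlonglongrightarrow> 4 * (C * 0 * (cmod z / 3) powr (- (3/4)) * cmod z * (4 * pi powr (1/4)))"
    unfolding Q_def using z_nonzero by (intro tendsto_intros \<rho>_lim) auto
  hence Q0: "Q \<longlonglongrightarrow> 0" by simp
  have "(\<lambda>N. 2 * of_real pi * \<i> * K r \<epsilon> N - (P (zN N) - P (cnj (zN N)))) \<longlonglongrightarrow> 0"
    by (rule Lim_null_comparison[OF bound Q0])
  moreover have "(\<lambda>N. P (zN N) - P (cnj (zN N))) \<longlonglongrightarrow> P z - P (cnj z)"
  proof (intro tendsto_diff)
    have "isCont P z" using P(1)[of z] z_Im by (auto intro: DERIV_isCont)
    thus "(\<lambda>N. P (zN N)) \<longlonglongrightarrow> P z" using zN_lim by (rule isCont_tendsto_compose)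
    have "isCont P (cnj z)" using P(1)[of "cnj z"] z_Im by (auto intro: DERIV_isCont)
    thus "(\<lambda>N. P (cnj (zN N))) \<longlonglongrightarrow> P (cnj z)" using tendsto_cnj[OF zN_lim] by (rule isCont_tendsto_compose)
  qed
  ultimately have "(\<lambda>N. (2 * of_real pi * \<i> * K r \<epsilon> N - (P (zN N) - P (cnj (zN N)))) + (P (zN N) - P (cnj (zN N)))) \<longlonglongrightarrow> 0 + (P z - P (cnj z))"
    by (rule tendsto_add)
  hence "(\<lambda>N. 1 / (2 * of_real pi * \<i>) * (2 * of_real pi * \<i> * K r \<epsilon> N)) \<longlonglongrightarrow> 1 / (2 * of_real pi * \<i>) * (P z - P (cnj z))"
    by (intro tendsto_mult_left) simp
  thus ?thesis using P(2)[OF z_Im] by simp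
qed

end

lemma (in kernel_scaling) limit_type_N:
  assumes r: "0 < r" "r < 1" "0 < \<epsilon>" "\<epsilon> < 1 - r" and z: "R_poly a b c z = 0" "Im z > 0"
  shows "K r \<epsilon> \<longlonglongrightarrow> incomplete_beta z k l"
proof -
  obtain zN where "zN \<longlonglongrightarrow> z" "\<forall>\<^sub>F N in sequentially. R_poly (gp N / n N) (gm N / n N) (x N / n N) (zN N) = 0"
    by (rule R_poly_roots_converge[OF a_lim b_lim c_lim b_pos z(1)])
  then interpret nonreal_saddle gp gm n n' x x' k l a b c z zN
    using z by unfold_locales
  show ?thesis by (rule limit_nonreal[OF r])
qed

section \<open>Convergence of the determinants\<close>

text \<open>A permutation preserves the sum of \<open>r\<close>, so it cannot lower \<open>r\<close>
  at every point that it moves.\<close>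

lemma permutation_nondecreasing_step:
  fixes r :: "'k::finite \<Rightarrow> int"
  assumes p: "p permutes UNIV" "p \<noteq> id"
  obtains i where "p i \<noteq> i" "r i \<le> r (p i)"
proof -
  have "\<exists>i. p i \<noteq> i \<and> r i \<le> r (p i)"
  proof (rule ccontr)
    assume "\<not> ?thesis"
    hence lt: "r (p i) < r i" if "p i \<noteq> i" for i using that by auto
    obtain i where i: "p i \<noteq> i" using p(2) by (auto simp: fun_eq_iff)
    have "(\<Sum>j\<in>UNIV. r (p j)) < (\<Sum>j\<in>UNIV. r j)"
    proof (rule sum_strict_mono_ex1)
      show "\<forall>j\<in>UNIV. r (p j) \<le> r j" using lt by (metis order_refl order_less_imp_le)
      show "\<exists>j\<in>UNIV. r (p j) < r j" using lt[OF i] by blast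
    qed simp
    moreover have "(\<Sum>j\<in>UNIV. r (p j)) = (\<Sum>j\<in>UNIV. r j)"
      using sum.permute[OF p(1), of r] by (simp add: o_def)
    ultimately show False by simp
  qed
  thus ?thesis using that by blast
qed

text \<open>Triangularity is expressed by a rank instead of a numbering of the index type; entries
  between different indices of equal rank must vanish as well.\<close>

lemma det_ranked_triangular:
  fixes A :: "complex ^ 'k ^ 'k::finite" and r :: "'k \<Rightarrow> int"
  assumes A: "\<And>i j. i \<noteq> j \<Longrightarrow> r i \<le> r j \<Longrightarrow> A $ i $ j = 0"
  shows "det A = (\<Prod>i\<in>UNIV. A $ i $ i)"
proof -
  have "det A = (\<Sum>p\<in>{p. p permutes (UNIV :: 'k set)}. if p = id then \<Prod>i\<in>UNIV. A $ i $ i else 0)"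
    unfolding det_def
  proof (rule sum.cong[OF refl])
    fix p :: "'k \<Rightarrow> 'k" assume p: "p \<in> {p. p permutes UNIV}"
    show "of_int (sign p) * (\<Prod>i\<in>UNIV. A $ i $ p i) = (if p = id then \<Prod>i\<in>UNIV. A $ i $ i else 0)"
    proof (cases "p = id")
      case False
      obtain i where "p i \<noteq> i" "r i \<le> r (p i)"
        using permutation_nondecreasing_step[of p r] p False by auto
      hence "A $ i $ p i = 0" by (intro A) auto
      hence "(\<Prod>i\<in>UNIV. A $ i $ p i) = 0" by (intro prod_zero) auto
      thus ?thesis using False by simp
    qed (simp add: sign_id)
  qed
  also have "\<dots> = (\<Prod>i\<in>UNIV. A $ i $ i)"
    using permutes_id[of "UNIV :: 'k set"] by (simp add: sum.delta finite_permutations)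
  finally show ?thesis .
qed

lemma tendsto_det:
  fixes A :: "nat \<Rightarrow> 'k::finite \<Rightarrow> 'k \<Rightarrow> complex"
  assumes "\<And>i j. (\<lambda>N. A N i j) \<longlonglongrightarrow> L i j"
  shows "(\<lambda>N. det (\<chi> i j. A N i j)) \<longlonglongrightarrow> det (\<chi> i j. L i j)"
  unfolding det_def by (simp, intro tendsto_sum tendsto_mult tendsto_const tendsto_prod assms)

lemma ratio_one_imp_at_top:
  fixes f :: "nat \<Rightarrow> nat"
  assumes "(\<lambda>N. real (f N) / real N) \<longlonglongrightarrow> 1"
  shows "filterlim f at_top sequentially"
proof -
  have "filterlim (\<lambda>N. real (f N) / real N * real N) at_top sequentially"
    by (rule filterlim_tendsto_pos_mult_at_top[OF assms zero_less_one filterlim_real_sequentially])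
  moreover have "\<forall>\<^sub>F N in sequentially. real (f N) / real N * real N = real (f N)"
    using eventually_gt_at_top[of 0] by eventually_elim simp
  ultimately have "filterlim (\<lambda>N. real (f N)) at_top sequentially"
    by (simp cong: filterlim_cong)
  thus ?thesis by (simp add: filterlim_sequentially_iff_filterlim_real)
qed

lemma tendsto_rescale_denominator:
  fixes g :: "nat \<Rightarrow> real" and f :: "nat \<Rightarrow> nat"
  assumes "(\<lambda>N. g N / real N) \<longlonglongrightarrow> a" "(\<lambda>N. real (f N) / real N) \<longlonglongrightarrow> 1"
  shows "(\<lambda>N. g N / real (f N)) \<longlonglongrightarrow> a"
proof -
  have "(\<lambda>N. (g N / real N) / (real (f N) / real N)) \<longlonglongrightarrow> a / 1"
    by (intro tendsto_divide assms) simp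
  moreover have "\<forall>\<^sub>F N in sequentially. (g N / real N) / (real (f N) / real N) = g N / real (f N)"
    using eventually_gt_at_top[of 0] by eventually_elim (simp add: field_simps)
  ultimately show ?thesis unfolding div_by_1 by (rule Lim_transform_eventually)
qed

theorem theorem4p6:
  fixes a b c r \<epsilon> :: real
    and gp gm :: "nat \<Rightarrow> real"
    and n :: "nat \<Rightarrow> 'k::finite \<Rightarrow> nat"
    and x :: "nat \<Rightarrow> 'k \<Rightarrow> int"
    and dn dx :: "'k \<Rightarrow> 'k \<Rightarrow> int"
    and m :: nat and q :: "nat \<Rightarrow> real"
    and zp :: complex
  assumes "a > 0" "b > 0"
    and "r > 0" "\<epsilon> > 0" "r < 1" "\<epsilon> < 1 - r"
    and "\<And>N. gp N > 0" "\<And>N. gm N > 0"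
    and "(\<lambda>N. gp N / real N) \<longlonglongrightarrow> a" "(\<lambda>N. gm N / real N) \<longlonglongrightarrow> b"
    and "\<And>N i. n N i > 0"
    and "\<And>N i j. int (n N i) - int (n N j) = dn i j"
    and "\<And>N i j. x N i - x N j = dx i j"
    and "\<And>N i j. i \<noteq> j \<Longrightarrow> (n N i, x N i) \<noteq> (n N j, x N j)"
    and "\<And>j. (\<lambda>N. real (n N j) / real N) \<longlonglongrightarrow> 1"
    and "\<And>j. (\<lambda>N. real_of_int (x N j) / real N) \<longlonglongrightarrow> c"
    and "strict_mono_on {1..m} q" "q ` {1..m} = {t. Q_poly a b t = 0}"
    and "Q_poly a b c \<noteq> 0"
    and "R_poly a b c zp = 0" "Im zp \<ge> 0"
    and "(\<exists>w. R_poly a b c w = 0 \<and> w \<notin> \<real>) \<Longrightarrow> zp \<notin> \<real>"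
  defines "D \<equiv> \<lambda>N. det (\<chi> i j. plancherel_kernel r \<epsilon> (gp N) (gm N)
                                 (n N i) (x N i) (n N j) (x N j) :: complex ^ 'k ^ 'k)"
    and "L \<equiv> det (\<chi> i j. incomplete_beta zp (dn i j) (dx j i) :: complex ^ 'k ^ 'k)"
  shows "m \<in> {2, 3, 4} \<and>
    (m = 4 \<longrightarrow>
       D \<longlonglongrightarrow> (if c \<le> q 1 then 0
            else if c < q 2 then L
            else if c \<le> q 3 then 1
            else if c < q 4 then L
            else 0)) \<and>
    (m = 2 \<or> m = 3 \<longrightarrow>
       D \<longlonglongrightarrow> (if c \<le> q 1 then 0
            else if c < q m then L
            else 0))"
proof -
  note ab = assms(1,2)
  note r = assms(3,5,4,6)
  note diff = assms(12)
  have scaling: "kernel_scaling gp gm (\<lambda>N. n N i) (\<lambda>N. n N j) (\<lambda>N. x N i) (\<lambda>N. x N j) (dn i j) (dx j i) a b c" for i j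
    by unfold_locales (intro assms(11) assms(12) assms(13) ab ratio_one_imp_at_top[OF assms(15)]
      tendsto_rescale_denominator[OF assms(9) assms(15)] tendsto_rescale_denominator[OF assms(10) assms(15)]
      tendsto_rescale_denominator[OF assms(16) assms(15)])+
  define K where "K = (\<lambda>i j N. plancherel_kernel r \<epsilon> (gp N) (gm N) (n N i) (x N i) (n N j) (x N j))"
  have D_lim: "D \<longlonglongrightarrow> det (\<chi> i j. M i j)" if "\<And>i j. K i j \<longlonglongrightarrow> M i j" for M
    unfolding D_def by (rule tendsto_det) (use that in \<open>simp add: K_def\<close>)
  \<comment> \<open>The entries with \<open>dn i j \<ge> 0\<close> vanish in the limit, the diagonal
    among them, so the limit matrix is strictly triangular in the order given by
    \<open>n\<close>.\<close>
  have frozen: "D \<longlonglongrightarrow> 0" if "\<And>i j. \<exists>M. K i j \<longlonglongrightarrow> M \<and> (dn i j \<ge> 0 \<longrightarrow> M = 0)"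
  proof -
    have "\<forall>i j. \<exists>M. K i j \<longlonglongrightarrow> M \<and> (dn i j \<ge> 0 \<longrightarrow> M = 0)" using that by blast
    then obtain M where M: "\<And>i j. K i j \<longlonglongrightarrow> M i j" "\<And>i j. dn i j \<ge> 0 \<Longrightarrow> M i j = 0" by metis
    \<comment> \<open>The order of the \<open>n N i\<close> does not depend on \<open>N\<close>, so
      stage 0 serves as rank.\<close>
    have M0: "M i j = 0" if "- int (n 0 i) \<le> - int (n 0 j)" for i j
      using M(2)[of i j] diff[of 0 i j] that by linarith
    hence "det (\<chi> i j. M i j) = (\<Prod>i\<in>UNIV. M i i)"
      by (subst det_ranked_triangular[where r = "\<lambda>i. - int (n 0 i)"]) auto
    also have "\<dots> = 0" using M0 by simp
    finally show ?thesis using D_lim[OF M(1)] by simp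
  qed
  \<comment> \<open>Different indices with equal \<open>n\<close> belong to distinct points, hence
    have different \<open>x\<close>, and the entry vanishes in the limit; the diagonal entries tend
    to 1.\<close>
  have packed: "D \<longlonglongrightarrow> 1"
    if "\<And>i j. \<exists>M. K i j \<longlonglongrightarrow> M \<and> (dn i j < 0 \<longrightarrow> M = 0) \<and> (dn i j = 0 \<longrightarrow> M = (if dx j i = 0 then 1 else 0))"
  proof -
    have "\<forall>i j. \<exists>M. K i j \<longlonglongrightarrow> M \<and> (dn i j < 0 \<longrightarrow> M = 0) \<and> (dn i j = 0 \<longrightarrow> M = (if dx j i = 0 then 1 else 0))"
      using that by blast
    then obtain M where M: "\<And>i j. K i j \<longlonglongrightarrow> M i j" "\<And>i j. dn i j < 0 \<Longrightarrow> M i j = 0"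
      "\<And>i j. dn i j = 0 \<Longrightarrow> M i j = (if dx j i = 0 then 1 else 0)" by metis
    have d0: "dn i i = 0" "dx i i = 0" for i using diff[of 0 i i] assms(13)[of 0 i i] by auto
    have "M i j = 0" if "i \<noteq> j" "int (n 0 i) \<le> int (n 0 j)" for i j
    proof (cases "dn i j < 0")
      case False
      hence "dn i j = 0" using that(2) diff[of 0 i j] by linarith
      moreover have "dx j i \<noteq> 0"
        using \<open>dn i j = 0\<close> assms(14)[OF that(1), of 0] diff[of 0 i j] assms(13)[of 0 j i] by auto
      ultimately show ?thesis using M(3) by simp
    qed (rule M(2))
    hence "det (\<chi> i j. M i j) = (\<Prod>i\<in>UNIV. M i i)"
      by (subst det_ranked_triangular[where r = "\<lambda>i. int (n 0 i)"]) auto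
    also have "\<dots> = 1" using M(3) d0 by simp
    finally show ?thesis using D_lim[OF M(1)] by simp
  qed
  have liquid: "D \<longlonglongrightarrow> L" if "\<exists>w. R_poly a b c w = 0 \<and> w \<notin> \<real>"
  proof -
    have "Im zp > 0" using assms(22)[OF that] assms(21) by (simp add: complex_is_Real_iff)
    thus ?thesis unfolding L_def K_def
      by (intro D_lim, unfold K_def) (rule kernel_scaling.limit_type_N[OF scaling r assms(20)])
  qed
  note ph = phase_cases[OF ab assms(17,18)]
  have left: "D \<longlonglongrightarrow> 0" if c: "c < q 1"
  proof -
    obtain x1 x2 x3 where v: "vieta3 a b c x1 x2 x3" "x1 < 0" "1 < x2" "x2 < x3" using ph(2)[OF c] by blast
    show ?thesis by (rule frozen, unfold K_def) (rule kernel_scaling.limit_type_B[OF scaling r v])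
  qed
  have right: "D \<longlonglongrightarrow> 0" if c: "c > q m"
  proof -
    obtain x1 x2 x3 where v: "vieta3 a b c x1 x2 x3" "x1 < 0" "0 < x2" "x2 < x3" "x3 < 1" using ph(3)[OF c] by blast
    show ?thesis by (rule frozen, unfold K_def) (rule kernel_scaling.limit_type_A[OF scaling r v])
  qed
  have middle: "D \<longlonglongrightarrow> 1" if c: "m = 4" "q 2 < c" "c < q 3"
  proof -
    obtain x1 x2 x3 where v: "vieta3 a b c x1 x2 x3" "x1 < x2" "x2 < x3" "x3 < 0" using ph(4)[OF c] by blast
    show ?thesis by (rule packed, unfold K_def) (rule kernel_scaling.limit_type_C[OF scaling r v])
  qed
  have bulk: "D \<longlonglongrightarrow> L" if "q 1 < c" "c < q m" "\<not> (m = 4 \<and> q 2 < c \<and> c < q 3)"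
    by (rule liquid) (rule ph(5)[OF that(1,2) assms(19) that(3)])
  \<comment> \<open>As \<open>Q_poly a b c \<noteq> 0\<close>, the weak inequalities of the
    statement are never equalities.\<close>
  have c_ne: "c \<noteq> q i" if "1 \<le> i" "i \<le> m" for i
    using assms(18,19) that by (metis (mono_tags) atLeastAtMost_iff image_eqI mem_Collect_eq)
  have mono: "q i < q j" if "1 \<le> i" "i < j" "j \<le> m" for i j
    using strict_mono_onD[OF assms(17), of i j] that by auto
  show ?thesis
  proof (intro conjI impI)
    show "m \<in> {2, 3, 4}" by (rule ph(1))
  next
    assume m: "m = 4"
    have ne: "c \<noteq> q 1" "c \<noteq> q 2" "c \<noteq> q 3" "c \<noteq> q 4" using c_ne m by auto
    have lt: "q 1 < q 2" "q 2 < q 3" "q 3 < q 4" using mono m by auto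
    consider "c < q 1" | "q 1 < c" "c < q 2" | "q 2 < c" "c < q 3" | "q 3 < c" "c < q 4" | "q 4 < c"
      using ne by linarith
    thus "D \<longlonglongrightarrow> (if c \<le> q 1 then 0 else if c < q 2 then L else if c \<le> q 3 then 1
        else if c < q 4 then L else 0)"
    proof cases
      case 1 thus ?thesis using left by simp
    next
      case 2 thus ?thesis using bulk m lt by simp
    next
      case 3 thus ?thesis using middle m lt by simp
    next
      case 4 thus ?thesis using bulk m lt by simp
    next
      case 5 thus ?thesis using right m lt by simp
    qed
  next
    assume m: "m = 2 \<or> m = 3"
    have ne: "c \<noteq> q 1" "c \<noteq> q m" using c_ne[of 1] c_ne[of m] m by auto
    have lt: "q 1 < q m" using mono m by auto
    consider "c < q 1" | "q 1 < c" "c < q m" | "q m < c" using ne by linarith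
    thus "D \<longlonglongrightarrow> (if c \<le> q 1 then 0 else if c < q m then L else 0)"
    proof cases
      case 1 thus ?thesis using left by simp
    next
      case 2 thus ?thesis using bulk m lt by auto
    next
      case 3 thus ?thesis using right lt by simp
    qed
  qed
qed

end
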